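(* The following decision problem is $NP$-complete. Instance: a bipartite graph $G$ with $\Delta(G)=3$. Question: does $G$ have a locally-balanced $2$-partition with a closed neighborhood?
   Context: All graphs are finite, undirected, without loops or multiple edges. $V(G)$ denotes the vertex set of $G$, $N_G(v)$ the set of neighbors of a vertex $v$, $N_G[v]=N_G(v)\cup\{v\}$, and $\Delta(G)$ the maximum degree of $G$. A $2$-partition of a graph $G$ is a function $f:V(G)\to\{0,1\}$. A $2$-partition $f$ of $G$ is locally-balanced with a closed neighborhood if for every $v\in V(G)$, $\bigl|\,|\{u\in N_G[v]: f(u)=0\}|-|\{u\in N_G[v]: f(u)=1\}|\,\bigr|\le 1$. *)

theory Defs
  imports "HOL-Computational_Algebra.Polynomial"
begin

section \<open>Deterministic multi-tape Turing machines\<close>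

datatype move = MoveLeft | Stay | MoveRight

fun offset :: "move \<Rightarrow> int" where
  "offset MoveLeft = -1"
| "offset Stay = 0"
| "offset MoveRight = 1"

text \<open>
  States are the numbers below \<open>num_states\<close>, tape symbols the numbers below \<open>num_symbols\<close>.
  Every alphabet contains the blank 0, the two bits 1 and 2 and the separator 3.
  Given the current state and the symbols under the heads, \<open>transition\<close> yields the new state and,
  for each tape, the symbol to write and the head movement.
\<close>

record tm =
  num_tapes :: nat
  num_states :: nat
  num_symbols :: nat
  start_state :: nat
  accept_state :: nat
  reject_state :: nat
  transition :: "nat \<Rightarrow> nat list \<Rightarrow> nat \<times> (nat \<times> move) list"

definition halting_states :: "tm \<Rightarrow> nat set" where
  "halting_states M = {accept_state M, reject_state M}"

definition turing_machine :: "tm \<Rightarrow> bool" where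
  "turing_machine M \<longleftrightarrow>
     1 \<le> num_tapes M \<and> 4 \<le> num_symbols M \<and>
     start_state M < num_states M \<and> accept_state M < num_states M \<and>
     reject_state M < num_states M \<and> accept_state M \<noteq> reject_state M \<and>
     (\<forall>q ss q' acts.
        q < num_states M \<and> q \<notin> halting_states M \<and>
        length ss = num_tapes M \<and> set ss \<subseteq> {..<num_symbols M} \<and>
        transition M q ss = (q', acts) \<longrightarrow>
          q' < num_states M \<and> length acts = num_tapes M \<and>
          fst ` set acts \<subseteq> {..<num_symbols M})"

text \<open>
  Tapes are infinite in both directions; a configuration consists of the state and, for each
  tape, its contents and head position.
\<close>

type_synonym tape = "(int \<Rightarrow> nat) \<times> int"
type_synonym config = "nat \<times> tape list"

fun act :: "nat \<times> move \<Rightarrow> tape \<Rightarrow> tape" where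
  "act (s, m) (t, h) = (t(h := s), h + offset m)"

fun step :: "tm \<Rightarrow> config \<Rightarrow> config" where
  "step M (q, ts) =
     (if q \<in> halting_states M then (q, ts)
      else let (q', acts) = transition M q (map (\<lambda>(t, h). t h) ts)
           in (q', map2 act acts ts))"

definition contents :: "nat list \<Rightarrow> int \<Rightarrow> nat" where
  "contents w i = (if 0 \<le> i \<and> i < int (length w) then w ! nat i else 0)"

definition initial :: "tm \<Rightarrow> nat list \<Rightarrow> config" where
  "initial M w =
     (start_state M, (contents w, 0) # replicate (num_tapes M - 1) (contents [], 0))"

definition run :: "tm \<Rightarrow> nat list \<Rightarrow> nat \<Rightarrow> config" where
  "run M w n = (step M ^^ n) (initial M w)"

definition halts_within :: "tm \<Rightarrow> nat list \<Rightarrow> nat \<Rightarrow> bool" where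
  "halts_within M w n \<longleftrightarrow> fst (run M w n) \<in> halting_states M"

definition accepts :: "tm \<Rightarrow> nat list \<Rightarrow> bool" where
  "accepts M w \<longleftrightarrow> (\<exists>n. fst (run M w n) = accept_state M)"

section \<open>NP-completeness\<close>

definition bits :: "bool list \<Rightarrow> nat list" where
  "bits = map (\<lambda>b. if b then 2 else 1)"

definition pair_word :: "bool list \<Rightarrow> bool list \<Rightarrow> nat list" where
  "pair_word x u = bits x @ [3] @ bits u"

text \<open>
  The input is written on the first tape, the output is read off the last tape
  (the same tape if there is only one), which is blank outside the output.
\<close>

definition poly_time_computable :: "(bool list \<Rightarrow> bool list) \<Rightarrow> bool" where
  "poly_time_computable f \<longleftrightarrow>
     (\<exists>M (p :: nat poly). turing_machine M \<and>
        (\<forall>x. halts_within M (bits x) (poly p (length x)) \<and>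
             fst (last (snd (run M (bits x) (poly p (length x))))) = contents (bits (f x))))"

text \<open>
  NP is defined by polynomial-time verifiers and certificates of polynomial length.
\<close>

definition NP :: "bool list set set" where
  "NP = {L. \<exists>M (p :: nat poly) (q :: nat poly). turing_machine M \<and>
          (\<forall>x u. halts_within M (pair_word x u) (poly q (length (pair_word x u)))) \<and>
          (\<forall>x. x \<in> L \<longleftrightarrow>
             (\<exists>u. length u \<le> poly p (length x) \<and> accepts M (pair_word x u)))}"

definition poly_time_reducible :: "bool list set \<Rightarrow> bool list set \<Rightarrow> bool" where
  "poly_time_reducible L L' \<longleftrightarrow>
     (\<exists>f. poly_time_computable f \<and> (\<forall>x. x \<in> L \<longleftrightarrow> f x \<in> L'))"

definition NP_complete :: "bool list set \<Rightarrow> bool" where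
  "NP_complete L \<longleftrightarrow> L \<in> NP \<and> (\<forall>L' \<in> NP. poly_time_reducible L' L)"

section \<open>Graphs\<close>

definition simple_graph :: "'a set \<Rightarrow> 'a set set \<Rightarrow> bool" where
  "simple_graph V E \<longleftrightarrow> finite V \<and> (\<forall>e\<in>E. e \<subseteq> V \<and> card e = 2)"

definition neighbors :: "'a set set \<Rightarrow> 'a \<Rightarrow> 'a set" where
  "neighbors E v = {u. {v, u} \<in> E}"

definition closed_neighbors :: "'a set set \<Rightarrow> 'a \<Rightarrow> 'a set" where
  "closed_neighbors E v = neighbors E v \<union> {v}"

text \<open>The graph without vertices is given maximum degree 0, as \<open>Max {}\<close> is unspecified.\<close>

definition max_degree :: "'a set \<Rightarrow> 'a set set \<Rightarrow> nat" where
  "max_degree V E = Max (insert 0 ((\<lambda>v. card (neighbors E v)) ` V))"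

definition bipartite :: "'a set \<Rightarrow> 'a set set \<Rightarrow> bool" where
  "bipartite V E \<longleftrightarrow>
     (\<exists>A B. A \<union> B = V \<and> A \<inter> B = {} \<and> (\<forall>e\<in>E. \<exists>a\<in>A. \<exists>b\<in>B. e = {a, b}))"

definition two_partition :: "'a set \<Rightarrow> ('a \<Rightarrow> nat) \<Rightarrow> bool" where
  "two_partition V f \<longleftrightarrow> (\<forall>v\<in>V. f v \<in> {0, 1})"

definition locally_balanced_closed :: "'a set \<Rightarrow> 'a set set \<Rightarrow> ('a \<Rightarrow> nat) \<Rightarrow> bool" where
  "locally_balanced_closed V E f \<longleftrightarrow>
     (\<forall>v\<in>V. \<bar>int (card {u \<in> closed_neighbors E v. f u = 0})
             - int (card {u \<in> closed_neighbors E v. f u = 1})\<bar> \<le> 1)"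

text \<open>
  Graphs with vertex set \<open>{..<n}\<close> are presented to machines as their adjacency matrices,
  written row by row. Strings that are not the code of an instance count as no-instances.
\<close>

definition adjacency_code :: "nat \<Rightarrow> nat set set \<Rightarrow> bool list" where
  "adjacency_code n E = concat (map (\<lambda>i. map (\<lambda>j. {i, j} \<in> E) [0..<n]) [0..<n])"

lemma length_adjacency_code: "length (adjacency_code n E) = n * n"
  by (simp add: adjacency_code_def length_concat o_def sum_list_triv)

lemma concat_rows_inj:
  assumes "\<And>i. i \<in> set xs \<Longrightarrow> length (f i) = length (g i)"
    and "concat (map f xs) = concat (map g xs)"
  shows "\<forall>i\<in>set xs. f i = g i"
  using assms by (induction xs) auto

lemma adjacency_code_inj:
  assumes "simple_graph {..<n} E" "simple_graph {..<m} F" "adjacency_code n E = adjacency_code m F"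
  shows "n = m \<and> E = F"
proof -
  have nm: "n = m" using arg_cong[OF assms(3), of length]
    by (simp add: length_adjacency_code) (metis power2_eq_square power2_eq_iff_nonneg zero_le)
  have eq: "\<forall>i\<in>{0..<n}. map (\<lambda>j. {i, j} \<in> E) [0..<n] = map (\<lambda>j. {i, j} \<in> F) [0..<n]"
    using concat_rows_inj[of "[0..<n]" "\<lambda>i. map (\<lambda>j. {i, j} \<in> E) [0..<n]"
        "\<lambda>i. map (\<lambda>j. {i, j} \<in> F) [0..<n]"] assms(3) nm
    by (simp add: adjacency_code_def)
  have ed: "{i,j} \<in> E \<longleftrightarrow> {i,j} \<in> F" if "i<n" "j<n" for i j using eq that by auto
  have "e \<in> E \<longleftrightarrow> e \<in> F" for e
  proof -
    have "\<exists>i j. i<n \<and> j<n \<and> e = {i,j}" if "e \<in> E \<union> F" using that assms nm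
      unfolding simple_graph_def card_2_iff by (metis Un_iff insertCI lessThan_iff subsetD)
    then show ?thesis using ed by auto
  qed
  then show ?thesis using nm by auto
qed

definition decision_language ::
  "(nat set \<Rightarrow> nat set set \<Rightarrow> bool) \<Rightarrow> (nat set \<Rightarrow> nat set set \<Rightarrow> bool) \<Rightarrow> bool list set" where
  "decision_language inst question =
     {adjacency_code n E | n E.
        simple_graph {..<n} E \<and> inst {..<n} E \<and> question {..<n} E}"

end

(*
A certificate for membership in NP is a locally balanced 2-partition together with a bipartition.
Checking it, and computing every bit of the reduction, are instances of bounded arithmetic over the
letters of the input: terms with bounded sums, in unary. Such a term is evaluated by a
Turing machine that uses tapes as counters, and all bounds are automatically polynomial, so that
no further machine has to be programmed.

For hardness, the run of a polynomial-time verifier is described by clauses over the facts "cell i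
of tape a contains s at time t", "head a is on cell i at time t" and "head a reads s at time t".
All of them are Horn clauses except those that guess the certificate; hence a model contains all
true facts of some run, and the facts of an accepting run form a model. Clauses become
not-all-equal constraints on three literals, and these become a graph: a vertex of degree 3 is
balanced iff exactly two of the four values in its closed neighborhood are 1, so it states, with
its own value free, that its three neighbors are not all equal, and, with a leaf attached, that its
two other neighbors are different.
*)

theory Submission
  imports Defs
begin

section \<open>Structured programs for Turing machines\<close>

text \<open>Every bit of the reduction must be defined by arithmetic from a row and a column number,
  which dictates uniform shapes: each clause has a place for every literal, absent literals are
  replaced by falsity, and clauses and facts are numbered through the digits of their parameters.
  The verifier is fixed, so its transition table enters as a finite case distinction.

  In the graph the obstacle is the degree bound: a vertex can pass its value to few others. So each
  variable gets a row of copies, with a private pair of positions for every place where a literal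
  may occur; as values alternate along a row, the choice between the two positions supplies
  negation. A constraint vertex with free value also enters the closed neighborhoods of the three
  vertices that it tests. Each gadget therefore has a vertex (number 6) that can compensate for it
  without affecting the value of the gadget. Finally, balance is invariant under exchanging 0 and 1,
  so falsity cannot be a fixed value: truth means being different from row 0.\<close>

datatype com =
    Act nat "nat \<Rightarrow> nat" move
  | Seq com com (infixr ";;" 60)
  | Cond nat nat com com
  | Loop nat nat com

type_synonym tapes = "nat \<Rightarrow> tape"

definition rd :: "tape \<Rightarrow> nat" where
  "rd t = fst t (snd t)"

text \<open>The number counts the steps of the flattened code exactly: one for a test, and one more
  in \<open>CondF\<close> and \<open>LoopStep\<close> for the jump that \<open>flat\<close> places
  behind the else branch or the loop body.\<close>

inductive big :: "com \<Rightarrow> tapes \<Rightarrow> nat \<Rightarrow> tapes \<Rightarrow> bool" where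
  Act: "big (Act r f m) ts (Suc 0) (ts(r := act (f (rd (ts r)), m) (ts r)))"
| Seq: "big c ts n ts' \<Longrightarrow> big d ts' n' ts'' \<Longrightarrow> big (c ;; d) ts (n + n') ts''"
| CondT: "rd (ts r) = s \<Longrightarrow> big c ts n ts' \<Longrightarrow> big (Cond r s c d) ts (Suc n) ts'"
| CondF: "rd (ts r) \<noteq> s \<Longrightarrow> big d ts n ts' \<Longrightarrow> big (Cond r s c d) ts (Suc (Suc n)) ts'"
| LoopEnd: "rd (ts r) = s \<Longrightarrow> big (Loop r s c) ts (Suc 0) ts"
| LoopStep: "rd (ts r) \<noteq> s \<Longrightarrow> big c ts n ts' \<Longrightarrow> big (Loop r s c) ts' n' ts'' \<Longrightarrow>
    big (Loop r s c) ts (Suc (Suc (n + n'))) ts''"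

section \<open>Flat code and its execution by a Turing machine\<close>

datatype instr = Op nat "nat \<Rightarrow> nat" move | Branch nat nat nat | Jump nat

primrec code_size :: "com \<Rightarrow> nat" where
  "code_size (Act r f m) = 1"
| "code_size (c ;; d) = code_size c + code_size d"
| "code_size (Cond r s c d) = code_size c + code_size d + 2"
| "code_size (Loop r s c) = code_size c + 2"

primrec flat :: "nat \<Rightarrow> com \<Rightarrow> instr list" where
  "flat a (Act r f m) = [Op r f m]"
| "flat a (c ;; d) = flat a c @ flat (a + code_size c) d"
| "flat a (Cond r s c d) =
     Branch r s (a + code_size d + 2) # flat (Suc a) d @
     Jump (a + code_size d + code_size c + 2) # flat (a + code_size d + 2) c"
| "flat a (Loop r s c) = Branch r s (a + code_size c + 2) # flat (Suc a) c @ [Jump a]"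

lemma length_flat [simp]: "length (flat a c) = code_size c"
  by (induction c arbitrary: a) auto

fun istep :: "instr list \<Rightarrow> nat \<times> tapes \<Rightarrow> nat \<times> tapes" where
  "istep P (pc, ts) =
     (if pc < length P then
        case P ! pc of
          Op r f m \<Rightarrow> (Suc pc, ts(r := act (f (rd (ts r)), m) (ts r)))
        | Branch r s l \<Rightarrow> (if rd (ts r) = s then l else Suc pc, ts)
        | Jump l \<Rightarrow> (l, ts)
      else (pc, ts))"

definition code_at :: "instr list \<Rightarrow> nat \<Rightarrow> instr list \<Rightarrow> bool" where
  "code_at P a is \<longleftrightarrow> (\<exists>xs ys. P = xs @ is @ ys \<and> length xs = a)"

lemma code_at_append: "code_at P a (is @ js) \<Longrightarrow> code_at P a is \<and> code_at P (a + length is) js"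
  proof -
  assume "code_at P a (is @ js)"
  then obtain xs ys where *: "P = xs @ (is @ js) @ ys" "length xs = a" unfolding code_at_def by auto
  have "P = xs @ is @ (js @ ys)" "P = (xs @ is) @ js @ ys" "length (xs @ is) = a + length is"
    using * by auto
  then show ?thesis using *(2) unfolding code_at_def by blast
qed

lemma code_at_Cons: "code_at P a (i # is) \<Longrightarrow> a < length P \<and> P ! a = i \<and> code_at P (Suc a) is"
proof -
  assume *: "code_at P a (i # is)"
  then obtain xs ys where "P = xs @ (i # is) @ ys" "length xs = a" unfolding code_at_def by blast
  then have "a < length P" "P ! a = i" by auto
  moreover have "code_at P (Suc a) is" using code_at_append[of P a "[i]" "is"] * by simp
  ultimately show ?thesis by simp
qed

lemma funpow_trans: "(f ^^ m) x = y \<Longrightarrow> (f ^^ n) y = z \<Longrightarrow> (f ^^ (m + n)) x = z"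
  by (simp add: funpow_add add.commute[of m n])

lemma funpow_first: "f x = y \<Longrightarrow> (f ^^ n) y = z \<Longrightarrow> (f ^^ Suc n) x = z"
  by (simp add: funpow_swap1)

text \<open>Jump addresses are absolute, so the induction needs code that sits at an arbitrary
  address inside a larger program.\<close>

lemma flat_correct:
  "big c ts n ts' \<Longrightarrow> code_at P a (flat a c) \<Longrightarrow> (istep P ^^ n) (a, ts) = (a + code_size c, ts')"
proof (induction arbitrary: a rule: big.induct)
  case (Act r f m ts)
  then show ?case by (auto dest!: code_at_Cons simp: fun_upd_def)
next
  case (Seq c ts n ts' d n' ts'')
  from Seq.prems have "code_at P a (flat a c)" "code_at P (a + code_size c) (flat (a + code_size c) d)"
    using code_at_append by fastforce+
  from funpow_trans[OF Seq.IH(1)[OF this(1)] Seq.IH(2)[OF this(2)]] show ?case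
    by (simp add: add.assoc)
next
  case (CondT ts r s c n ts' d)
  from CondT.prems have *: "a < length P" "P ! a = Branch r s (a + code_size d + 2)"
    "code_at P (a + code_size d + 2) (flat (a + code_size d + 2) c)"
    by (auto dest!: code_at_Cons code_at_append)
  have "(istep P ^^ Suc n) (a, ts) = (a + code_size d + 2 + code_size c, ts')"
    by (rule funpow_first[OF _ CondT.IH[OF *(3)]]) (use * CondT.hyps in auto)
  then show ?case by (simp only: code_size.simps ac_simps)
next
  case (CondF ts r s d n ts' c)
  from CondF.prems have *: "a < length P" "P ! a = Branch r s (a + code_size d + 2)"
    "code_at P (Suc a) (flat (Suc a) d)" "Suc a + code_size d < length P"
    "P ! (Suc a + code_size d) = Jump (a + code_size d + code_size c + 2)"
    by (auto dest!: code_at_Cons code_at_append)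
  have 1: "(istep P ^^ Suc n) (a, ts) = (Suc a + code_size d, ts')"
    by (rule funpow_first[OF _ CondF.IH[OF *(3)]]) (use * CondF.hyps in auto)
  have "(istep P ^^ (Suc n + 1)) (a, ts) = (a + code_size (Cond r s c d), ts')"
    by (rule funpow_trans[OF 1]) (use * in auto)
  then show ?case by (metis Suc_eq_plus1)
next
  case (LoopEnd ts r s c)
  then show ?case by (auto dest!: code_at_Cons)
next
  case (LoopStep ts r s c n ts' n' ts'')
  from LoopStep.prems have *: "a < length P" "P ! a = Branch r s (a + code_size c + 2)"
    "code_at P (Suc a) (flat (Suc a) c)" "Suc a + code_size c < length P"
    "P ! (Suc a + code_size c) = Jump a"
    by (auto dest!: code_at_Cons code_at_append)
  have 1: "(istep P ^^ Suc n) (a, ts) = (Suc a + code_size c, ts')"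
    by (rule funpow_first[OF _ LoopStep.IH(1)[OF *(3)]]) (use * LoopStep.hyps in auto)
  have 2: "(istep P ^^ (Suc n + 1)) (a, ts) = (a, ts')"
    by (rule funpow_trans[OF 1]) (use * in auto)
  have "(istep P ^^ (Suc n + 1 + n')) (a, ts) = (a + code_size (Loop r s c), ts'')"
    by (rule funpow_trans[OF 2 LoopStep.IH(2)[OF LoopStep.prems]])
  moreover have "Suc n + 1 + n' = Suc (Suc (n + n'))" by simp
  ultimately show ?case by metis
qed

primrec wf_instr :: "nat \<Rightarrow> nat \<Rightarrow> instr \<Rightarrow> bool" where
  "wf_instr k l (Op r f m) \<longleftrightarrow> r < k \<and> (\<forall>s<4. f s < 4)"
| "wf_instr k l (Branch r s l') \<longleftrightarrow> r < k \<and> l' \<le> l"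
| "wf_instr k l (Jump l') \<longleftrightarrow> l' \<le> l"

primrec wf_com :: "nat \<Rightarrow> com \<Rightarrow> bool" where
  "wf_com k (Act r f m) \<longleftrightarrow> r < k \<and> (\<forall>s<4. f s < 4)"
| "wf_com k (c ;; d) \<longleftrightarrow> wf_com k c \<and> wf_com k d"
| "wf_com k (Cond r s c d) \<longleftrightarrow> r < k \<and> wf_com k c \<and> wf_com k d"
| "wf_com k (Loop r s c) \<longleftrightarrow> r < k \<and> wf_com k c"

lemma wf_flat:
  "wf_com k c \<Longrightarrow> a + code_size c \<le> l \<Longrightarrow> i \<in> set (flat a c) \<Longrightarrow> wf_instr k l i"
  by (induction c arbitrary: a) (auto; force)+

text \<open>The two addresses behind the code are the halting states: control that runs off the end
  accepts, and a jump one address further rejects. This is why \<open>wf_instr\<close> is used with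
  the bound \<open>Suc (length P)\<close> for jump targets.\<close>

definition machine :: "nat \<Rightarrow> instr list \<Rightarrow> tm" where
  "machine k P =
     \<lparr>num_tapes = k, num_states = length P + 2, num_symbols = 4, start_state = 0,
      accept_state = length P, reject_state = Suc (length P),
      transition = \<lambda>q ss.
        case P ! q of
          Op r f m \<Rightarrow>
            (Suc q, map (\<lambda>i. if i = r then (f (ss ! i), m) else (ss ! i, Stay)) [0..<length ss])
        | Branch r s l \<Rightarrow> (if ss ! r = s then l else Suc q, map (\<lambda>x. (x, Stay)) ss)
        | Jump l \<Rightarrow> (l, map (\<lambda>x. (x, Stay)) ss)\<rparr>"

lemma machine_simps [simp]:
  "num_tapes (machine k P) = k" "num_states (machine k P) = length P + 2"
  "num_symbols (machine k P) = 4" "start_state (machine k P) = 0"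
  "accept_state (machine k P) = length P" "reject_state (machine k P) = Suc (length P)"
  by (simp_all add: machine_def)

lemma turing_machine_machine:
  assumes "1 \<le> k" "\<And>i. i \<in> set P \<Longrightarrow> wf_instr k (Suc (length P)) i"
  shows "turing_machine (machine k P)"
proof -
  have key: "q' < length P + 2 \<and> length acts = k \<and> fst ` set acts \<subseteq> {..<4}"
    if q: "q < length P" and ss: "length ss = k" "set ss \<subseteq> {..<4}"
      and t: "transition (machine k P) q ss = (q', acts)" for q ss q' acts
  proof -
    have wf: "wf_instr k (Suc (length P)) (P ! q)" using q assms(2) by simp
    have "ss ! i < 4" if "i < k" for i using ss that nth_mem by blast
    then show ?thesis using t wf ss q
      by (cases "P ! q") (auto simp: machine_def split: if_splits)
  qed
  show ?thesis
    unfolding turing_machine_def halting_states_def machine_simps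
  proof (intro conjI allI impI; (elim conjE)?)
    fix q ss q' acts
    assume "q < length P + 2" "q \<notin> {length P, Suc (length P)}" "length ss = k" "set ss \<subseteq> {..<4}"
      "transition (machine k P) q ss = (q', acts)"
    then have "q' < length P + 2 \<and> length acts = k \<and> fst ` set acts \<subseteq> {..<4}"
      by (intro key) auto
    then show "q' < length P + 2" "length acts = k" "fst ` set acts \<subseteq> {..<4}" by auto
  qed (use assms(1) in auto)
qed

lemma act_stay: "act (rd t, Stay) t = t"
  by (cases t) (simp add: rd_def)

lemma step_machine:
  assumes "\<And>i. i \<in> set P \<Longrightarrow> wf_instr k (Suc (length P)) i" "pc \<le> Suc (length P)"
  shows "step (machine k P) (pc, map ts [0..<k]) =
    (fst (istep P (pc, ts)), map (snd (istep P (pc, ts))) [0..<k]) \<and>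
    fst (istep P (pc, ts)) \<le> Suc (length P)"
proof (cases "pc < length P")
  case False
  then show ?thesis using assms by (auto simp: machine_def halting_states_def)
next
  case True
  have wf: "wf_instr k (Suc (length P)) (P ! pc)" using True assms by simp
  have rd: "map (\<lambda>(t, h). t h) (map ts [0..<k]) = map (\<lambda>i. rd (ts i)) [0..<k]"
    by (simp add: rd_def case_prod_beta)
  have id: "map2 act (map (\<lambda>x. (x, Stay)) (map (\<lambda>i. rd (ts i)) [0..<k])) (map ts [0..<k]) =
      map ts [0..<k]"
    by (auto simp: act_stay intro: nth_equalityI)
  show ?thesis
  proof (cases "P ! pc")
    case (Op r f m)
    have "map2 act (map (\<lambda>i. if i = r then (f (map (\<lambda>i. rd (ts i)) [0..<k] ! i), m)
        else (map (\<lambda>i. rd (ts i)) [0..<k] ! i, Stay)) [0..<k]) (map ts [0..<k]) =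
      map (ts(r := act (f (rd (ts r)), m) (ts r))) [0..<k]"
      by (rule nth_equalityI) (auto simp: act_stay)
    then show ?thesis using True Op wf unfolding step.simps rd
      by (simp add: machine_def halting_states_def Let_def del: map_map)
  next
    case (Branch r s l)
    then show ?thesis using True wf id unfolding step.simps rd
      by (auto simp: machine_def halting_states_def Let_def simp del: map_map)
  next
    case (Jump l)
    then show ?thesis using True wf id unfolding step.simps rd
      by (auto simp: machine_def halting_states_def Let_def simp del: map_map)
  qed
qed

lemma steps_machine:
  assumes "\<And>i. i \<in> set P \<Longrightarrow> wf_instr k (Suc (length P)) i" "pc \<le> Suc (length P)"
  shows "(step (machine k P) ^^ n) (pc, map ts [0..<k]) =
    (fst ((istep P ^^ n) (pc, ts)), map (snd ((istep P ^^ n) (pc, ts))) [0..<k]) \<and>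
    fst ((istep P ^^ n) (pc, ts)) \<le> Suc (length P)"
proof (induction n)
  case (Suc n)
  then show ?case
    using step_machine[OF assms(1), of "fst ((istep P ^^ n) (pc, ts))" "snd ((istep P ^^ n) (pc, ts))"]
    by simp
qed (use assms in simp)

definition start_tapes :: "nat list \<Rightarrow> tapes" where
  "start_tapes w r = (if r = 0 then (contents w, 0) else (contents [], 0))"

lemma initial_machine:
  "1 \<le> k \<Longrightarrow> initial (machine k P) w = (0, map (start_tapes w) [0..<k])"
  by (auto simp: initial_def machine_def start_tapes_def nth_Cons' intro!: nth_equalityI)

text \<open>The final branch turns a register into a verdict: the symbol 1 is the mark on cell 0, so
  the branch is taken to the rejecting state if the value is 0, and otherwise control falls through
  to acceptance.\<close>

definition program :: "nat \<Rightarrow> com \<Rightarrow> nat \<Rightarrow> tm" where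
  "program k c r = machine k (flat 0 c @ [Branch r 1 (code_size c + 2)])"

lemma wf_program:
  assumes "wf_com k c" "r < k"
  shows "i \<in> set (flat 0 c @ [Branch r 1 (code_size c + 2)]) \<Longrightarrow>
    wf_instr k (Suc (length (flat 0 c @ [Branch r 1 (code_size c + 2)]))) i"
  using wf_flat[OF assms(1), of 0 "code_size c + 2"] assms(2) by auto

lemma turing_machine_program:
  "wf_com k c \<Longrightarrow> r < k \<Longrightarrow> turing_machine (program k c r)"
  unfolding program_def by (rule turing_machine_machine) (use wf_program in auto)

lemma run_program:
  assumes "wf_com k c" "r < k" "big c (start_tapes w) n ts" "n < n'"
  shows "run (program k c r) w n' =
    (if rd (ts r) = 1 then reject_state (program k c r) else accept_state (program k c r),
     map ts [0..<k])"
proof -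
  let ?P = "flat 0 c @ [Branch r 1 (code_size c + 2)]"
  let ?q = "if rd (ts r) = 1 then code_size c + 2 else code_size c + 1"
  have "code_at ?P 0 (flat 0 c)" unfolding code_at_def by auto
  from flat_correct[OF assms(3) this] have "(istep ?P ^^ n) (0, start_tapes w) = (code_size c, ts)"
    by simp
  then have "(istep ?P ^^ (n + 1)) (0, start_tapes w) = (?q, ts)"
    by (rule funpow_trans) (simp add: nth_append)
  moreover have "(istep ?P ^^ d) (?q, ts) = (?q, ts)" for d
    by (induction d) auto
  ultimately have "(istep ?P ^^ (n + 1 + (n' - n - 1))) (0, start_tapes w) = (?q, ts)"
    by (rule funpow_trans)
  then have "(istep ?P ^^ n') (0, start_tapes w) = (?q, ts)" using assms(4) by simp
  moreover have "run (program k c r) w n' = (fst ((istep ?P ^^ n') (0, start_tapes w)),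
      map (snd ((istep ?P ^^ n') (0, start_tapes w))) [0..<k])"
    unfolding run_def program_def
    using steps_machine[OF wf_program[OF assms(1,2)], of 0] initial_machine[of k ?P w] assms(2)
    by (simp add: program_def)
  ultimately show ?thesis by (simp add: program_def machine_def)
qed

section \<open>Bounded arithmetic over words\<close>

text \<open>\<open>Ren\<close> is an explicit renaming of variables. It makes weakening under a
  binder available semantically, so that no lifting of terms has to be defined.\<close>

datatype exp =
    Var nat
  | One
  | Len
  | Look exp
  | Add exp exp
  | Sub exp exp
  | Sum exp exp
  | Ren "nat \<Rightarrow> nat" exp

definition letter :: "nat list \<Rightarrow> nat \<Rightarrow> nat" where
  "letter w i = (if i < length w then w ! i else 0)"

text \<open>Variables are de Bruijn indices: \<open>Sum a b\<close> binds the summation index in \<open>b\<close>.\<close>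

primrec eval :: "exp \<Rightarrow> nat list \<Rightarrow> (nat \<Rightarrow> nat) \<Rightarrow> nat" where
  "eval (Var n) w e = e n"
| "eval One w e = 1"
| "eval Len w e = length w"
| "eval (Look a) w e = letter w (eval a w e)"
| "eval (Add a b) w e = eval a w e + eval b w e"
| "eval (Sub a b) w e = eval a w e - eval b w e"
| "eval (Sum a b) w e = (\<Sum>i<eval a w e. eval b w (case_nat i e))"
| "eval (Ren \<rho> a) w e = eval a w (e \<circ> \<rho>)"

text \<open>A register is a tape with a mark on cell 0 whose head position is its value.\<close>

definition reg :: "nat \<Rightarrow> tape" where
  "reg v = (contents [1], int v)"

abbreviation inc :: "nat \<Rightarrow> com" where
  "inc r \<equiv> Act r id MoveRight"

abbreviation dec :: "nat \<Rightarrow> com" where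
  "dec r \<equiv> Act r id MoveLeft"

text \<open>Variable \<open>n\<close> is kept in register \<open>\<rho> n\<close> below
  \<open>b\<close>, the result goes to register \<open>b\<close>, and registers above
  \<open>b\<close> are scratch. Testing a counter consumes it, so a variable is drained into a
  scratch register and then refilled while the result is counted up. There is no empty program;
  \<open>inc b ;; dec b\<close> takes its place.\<close>

primrec compile :: "exp \<Rightarrow> (nat \<Rightarrow> nat) \<Rightarrow> nat \<Rightarrow> com" where
  "compile (Var n) \<rho> b =
     Loop (\<rho> n) 1 (dec (\<rho> n) ;; inc (Suc b)) ;;
     Loop (Suc b) 1 (dec (Suc b) ;; inc (\<rho> n) ;; inc b)"
| "compile One \<rho> b = inc b"
| "compile Len \<rho> b =
     Loop 0 0 (inc 0 ;; inc b ;; inc (Suc b)) ;; Loop (Suc b) 1 (dec (Suc b) ;; dec 0)"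
| "compile (Look a) \<rho> b =
     compile a \<rho> (Suc b) ;;
     Loop (Suc b) 1 (dec (Suc b) ;; inc (Suc (Suc b)) ;; inc 0) ;;
     Cond 0 0 (inc b ;; dec b)
       (inc b ;; Cond 0 1 (inc b ;; dec b) (inc b ;; Cond 0 2 (inc b ;; dec b) (inc b))) ;;
     Loop (Suc (Suc b)) 1 (dec (Suc (Suc b)) ;; dec 0)"
| "compile (Add a c) \<rho> b =
     compile a \<rho> b ;; compile c \<rho> (Suc b) ;; Loop (Suc b) 1 (dec (Suc b) ;; inc b)"
| "compile (Sub a c) \<rho> b =
     compile a \<rho> b ;; compile c \<rho> (Suc b) ;;
     Loop (Suc b) 1 (dec (Suc b) ;; Cond b 1 (inc b ;; dec b) (dec b))"
| "compile (Sum a c) \<rho> b =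
     compile a \<rho> (Suc b) ;;
     Loop (Suc b) 1
       (dec (Suc b) ;; compile c (case_nat (b + 2) \<rho>) (b + 3) ;;
        Loop (b + 3) 1 (dec (b + 3) ;; inc b) ;; inc (b + 2)) ;;
     Loop (b + 2) 1 (dec (b + 2))"
| "compile (Ren f a) \<rho> b = compile a (\<rho> \<circ> f) b"

primrec need :: "exp \<Rightarrow> nat" where
  "need (Var n) = 2"
| "need One = 1"
| "need Len = 2"
| "need (Look a) = need a + 3"
| "need (Add a b) = need a + need b + 1"
| "need (Sub a b) = need a + need b + 1"
| "need (Sum a b) = need a + need b + 4"
| "need (Ren f a) = need a"

lemma need_pos: "0 < need x"
  by (induction x) auto

lemma wf_compile:
  "b + need x \<le> k \<Longrightarrow> (\<And>i. \<rho> i < k) \<Longrightarrow> 0 < k \<Longrightarrow> wf_com k (compile x \<rho> b)"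
proof (induction x arbitrary: \<rho> b)
  case (Sum a c)
  have "wf_com k (compile c (case_nat (b + 2) \<rho>) (b + 3))"
    using Sum.prems by (intro Sum.IH(2)) (auto split: nat.split)
  moreover have "wf_com k (compile a \<rho> (Suc b))"
    using Sum.prems by (intro Sum.IH(1)) auto
  ultimately show ?case using Sum.prems by simp
next
  case (Look a)
  have "wf_com k (compile a \<rho> (Suc b))"
    using Look.prems by (intro Look.IH) auto
  then show ?case using Look.prems by simp
next
  case (Add a c)
  have "wf_com k (compile a \<rho> b)" "wf_com k (compile c \<rho> (Suc b))"
    using Add.prems by (auto intro: Add.IH)
  then show ?case using Add.prems need_pos[of c] by simp
next
  case (Sub a c)
  have "wf_com k (compile a \<rho> b)" "wf_com k (compile c \<rho> (Suc b))"
    using Sub.prems by (auto intro: Sub.IH)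
  then show ?case using Sub.prems need_pos[of c] by simp
qed auto

lemma poly_nat_mono: "x \<le> y \<Longrightarrow> poly p x \<le> poly (p :: nat poly) y"
  by (induction p) (auto intro: add_mono mult_mono)

section \<open>Execution within a time bound, and rules for counting loops\<close>

definition runs :: "com \<Rightarrow> tapes \<Rightarrow> nat \<Rightarrow> tapes \<Rightarrow> bool" where
  "runs c ts t ts' \<longleftrightarrow> (\<exists>n\<le>t. big c ts n ts')"

lemma runs_mono: "runs c ts t ts' \<Longrightarrow> t \<le> t' \<Longrightarrow> runs c ts t' ts'"
  unfolding runs_def by (meson le_trans)

lemma runs_Seq:
  "runs c ts t ts' \<Longrightarrow> runs d ts' t' ts'' \<Longrightarrow> runs (c ;; d) ts (t + t') ts''"
  unfolding runs_def by (meson Seq add_mono)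

lemma runs_Act: "runs (Act r f m) ts 1 (ts(r := act (f (rd (ts r)), m) (ts r)))"
  unfolding runs_def by (metis Act One_nat_def order_refl)

lemma runs_inc:
  assumes "ts r = (c, h)" "ts' = ts(r := (c, h + 1))" "0 < t"
  shows "runs (inc r) ts t ts'"
  by (rule runs_mono[of _ _ 1]) (use runs_Act[of r id MoveRight ts] assms in \<open>auto simp: rd_def\<close>)

lemma runs_dec:
  assumes "ts r = (c, h)" "ts' = ts(r := (c, h - 1))" "0 < t"
  shows "runs (dec r) ts t ts'"
  by (rule runs_mono[of _ _ 1]) (use runs_Act[of r id MoveLeft ts] assms in \<open>auto simp: rd_def\<close>)

lemma runs_Cond:
  assumes "rd (ts r) = s \<Longrightarrow> runs c ts t ts'" "rd (ts r) \<noteq> s \<Longrightarrow> runs d ts t ts'"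
  shows "runs (Cond r s c d) ts (t + 2) ts'"
proof (cases "rd (ts r) = s")
  case True
  then obtain n where "n \<le> t" "big c ts n ts'" using assms(1) unfolding runs_def by auto
  then show ?thesis using CondT[of ts r s, OF True] unfolding runs_def
    by (intro exI[of _ "Suc n"]) auto
next
  case False
  then obtain n where "n \<le> t" "big d ts n ts'" using assms(2) unfolding runs_def by auto
  then show ?thesis using CondF[of ts r s, OF False] unfolding runs_def
    by (intro exI[of _ "Suc (Suc n)"]) auto
qed

lemma runs_Loop:
  assumes "\<And>j. j < v \<Longrightarrow> rd (f j r) \<noteq> s" "rd (f v r) = s"
    and "\<And>j. j < v \<Longrightarrow> runs c (f j) t (f (Suc j))"
  shows "runs (Loop r s c) (f 0) (v * (t + 2) + 1) (f v)"
  using assms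
proof (induction v arbitrary: f)
  case 0
  then show ?case using LoopEnd[of "f 0" r s] unfolding runs_def by auto
next
  case (Suc v)
  have "runs (Loop r s c) (f (Suc 0)) (v * (t + 2) + 1) (f (Suc v))"
    using Suc.IH[of "\<lambda>j. f (Suc j)"] Suc.prems by auto
  then obtain n' where n': "n' \<le> v * (t + 2) + 1" "big (Loop r s c) (f (Suc 0)) n' (f (Suc v))"
    unfolding runs_def by auto
  have "runs c (f 0) t (f (Suc 0))" "rd (f 0 r) \<noteq> s" using Suc.prems by auto
  then obtain n where n: "n \<le> t" "big c (f 0) n (f (Suc 0))" "rd (f 0 r) \<noteq> s"
    unfolding runs_def by auto
  from LoopStep[of "f 0" r s, OF n(3,2) n'(2)]
  have "big (Loop r s c) (f 0) (Suc (Suc (n + n'))) (f (Suc v))" by simp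
  moreover have "Suc (Suc (n + n')) \<le> Suc v * (t + 2) + 1" using n n' by simp
  ultimately show ?case unfolding runs_def by blast
qed

lemma rd_reg: "rd (reg v) = (if v = 0 then 1 else 0)"
  by (auto simp: rd_def reg_def contents_def)

lemma rd_input: "rd (contents w, int i) = letter w i"
  by (auto simp: rd_def letter_def contents_def)

lemma runs_inc_reg:
  "ts r = reg v \<Longrightarrow> ts' = ts(r := reg (Suc v)) \<Longrightarrow> 0 < t \<Longrightarrow> runs (inc r) ts t ts'"
  by (rule runs_inc) (auto simp: reg_def)

lemma runs_dec_reg:
  "ts r = reg (Suc v) \<Longrightarrow> ts' = ts(r := reg v) \<Longrightarrow> 0 < t \<Longrightarrow> runs (dec r) ts t ts'"
  by (rule runs_dec) (auto simp: reg_def)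

lemma runs_nop:
  assumes "ts r = reg v" "2 \<le> t"
  shows "runs (inc r ;; dec r) ts t ts"
proof -
  have "runs (inc r) ts 1 (ts(r := reg (Suc v)))"
    using assms by (intro runs_inc_reg[where v=v]) auto
  moreover have "runs (dec r) (ts(r := reg (Suc v))) 1 ts"
    using assms by (intro runs_dec_reg[where v=v]) auto
  ultimately show ?thesis by (rule runs_mono[OF runs_Seq]) (use assms in simp)
qed

text \<open>\<open>g j\<close> gives the tapes after \<open>j\<close> rounds except for the counter
  \<open>r\<close>, whose entry is always overwritten. The 3 in the bound consists of the test, the
  jump back and the decrement.\<close>

lemma runs_count:
  assumes "\<And>j. j < v \<Longrightarrow>
      runs c ((g j)(r := reg (v - Suc j))) t ((g (Suc j))(r := reg (v - Suc j)))"
    and "ts = (g 0)(r := reg v)" "ts' = (g v)(r := reg 0)"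
  shows "runs (Loop r 1 (dec r ;; c)) ts (v * (t + 3) + 1) ts'"
proof -
  define f where "f j = (g j)(r := reg (v - j))" for j
  have "runs (dec r ;; c) (f j) (1 + t) (f (Suc j))" if "j < v" for j
  proof -
    have "runs (dec r) (f j) 1 ((g j)(r := reg (v - Suc j)))"
      by (rule runs_dec_reg[where v="v - Suc j"]) (use that in \<open>auto simp: f_def Suc_diff_Suc\<close>)
    then show ?thesis unfolding f_def by (rule runs_Seq) (use assms(1) that in auto)
  qed
  then have "runs (Loop r 1 (dec r ;; c)) (f 0) (v * (1 + t + 2) + 1) (f v)"
    by (rule runs_Loop[rotated 2]) (simp_all add: f_def rd_reg)
  moreover have "f 0 = ts" "f v = ts'" using assms(2,3) by (auto simp: f_def)
  moreover have "v * (1 + t + 2) + 1 = v * (t + 3) + 1" by (simp add: algebra_simps)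
  ultimately show ?thesis by metis
qed

lemma runs_clear:
  assumes "ts r = reg v" "ts' = ts(r := reg 0)"
  shows "runs (Loop r 1 (dec r)) ts (v * 3 + 1) ts'"
proof -
  define f where "f j = ts(r := reg (v - j))" for j
  have "runs (dec r) (f j) 1 (f (Suc j))" if "j < v" for j
    by (rule runs_dec_reg[where v="v - Suc j"]) (use that in \<open>auto simp: f_def Suc_diff_Suc\<close>)
  then have "runs (Loop r 1 (dec r)) (f 0) (v * (1 + 2) + 1) (f v)"
    by (rule runs_Loop[rotated 2]) (simp_all add: f_def rd_reg)
  moreover have "f 0 = ts" "f v = ts'" using assms by (auto simp: f_def)
  moreover have "v * (1 + 2) + 1 = v * 3 + 1" by simp
  ultimately show ?thesis by metis
qed

text \<open>The argument is the word length plus a common bound on all variables. Inside a sum the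
  index is below the value of \<open>a\<close>, so that bound grows by this value; hence the
  composition with \<open>[:0, 1:] + val_poly a\<close>.\<close>

primrec val_poly :: "exp \<Rightarrow> nat poly" where
  "val_poly (Var n) = [:0, 1:]"
| "val_poly One = [:1:]"
| "val_poly Len = [:0, 1:]"
| "val_poly (Look a) = [:3:]"
| "val_poly (Add a b) = val_poly a + val_poly b"
| "val_poly (Sub a b) = val_poly a"
| "val_poly (Sum a b) = val_poly a * pcompose (val_poly b) ([:0, 1:] + val_poly a)"
| "val_poly (Ren f a) = val_poly a"

text \<open>The constants are those of \<open>runs_count\<close> for the loops in
  \<open>compile\<close>. In \<open>Var\<close>, for example, the two loops cost 4 and 5 per unit
  and one step each for leaving.\<close>

primrec time_poly :: "exp \<Rightarrow> nat poly" where
  "time_poly (Var n) = [:2, 9:]"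
| "time_poly One = [:1:]"
| "time_poly Len = [:2, 9:]"
| "time_poly (Look a) = time_poly a + [:9:] * val_poly a + [:12:]"
| "time_poly (Add a b) = time_poly a + time_poly b + [:4:] * val_poly b + [:1:]"
| "time_poly (Sub a b) = time_poly a + time_poly b + [:7:] * val_poly b + [:1:]"
| "time_poly (Sum a b) = time_poly a + [:2:] +
     val_poly a * (pcompose (time_poly b + [:4:] * val_poly b) ([:0, 1:] + val_poly a) + [:8:])"
| "time_poly (Ren f a) = time_poly a"

lemma eval_le:
  assumes "set w \<subseteq> {1, 2, 3}" "\<And>i. e i \<le> m"
  shows "eval x w e \<le> poly (val_poly x) (length w + m)"
  using assms(2)
proof (induction x arbitrary: e m)
  case (Var n)
  then show ?case by (simp add: trans_le_add2)
next
  case (Look a)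
  have "w ! i \<le> 3" if "i < length w" for i
    using assms(1) nth_mem[OF that] by fastforce
  then show ?case by (simp add: letter_def)
next
  case (Sub a b)
  show ?case using le_trans[OF diff_le_self Sub.IH(1)[OF Sub.prems]] by simp
next
  case (Add a b)
  show ?case using Add.IH[OF Add.prems] by (simp add: add_mono)
next
  case (Sum a b)
  let ?A = "poly (val_poly a) (length w + m)"
  have A: "eval a w e \<le> ?A" by (rule Sum.IH(1)[OF Sum.prems])
  have "eval b w (case_nat i e) \<le> poly (val_poly b) (length w + (m + ?A))" if "i < eval a w e" for i
    using that A Sum.prems by (intro Sum.IH(2)) (auto split: nat.split intro: trans_le_add1)
  then have "eval (Sum a b) w e \<le> (\<Sum>i<eval a w e. poly (val_poly b) (length w + (m + ?A)))"
    by (simp only: eval.simps) (rule sum_mono; simp)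
  also have "\<dots> \<le> ?A * poly (val_poly b) (length w + (m + ?A))"
    using A by simp
  finally show ?case by (simp add: poly_pcompose add.assoc)
next
  case (Ren \<rho> a)
  show ?case using Ren.IH[of "e \<circ> \<rho>" m] Ren.prems by (simp add: comp_def)
qed auto

text \<open>Apart from register \<open>b\<close> all tapes are as before: scratch registers are 0
  again and the input head is back on cell 0. This exactness lets the induction hypothesis be used
  afresh in every round of a sum.\<close>

lemma compile_runs:
  assumes w: "set w \<subseteq> {1, 2, 3}"
    and "ts 0 = (contents w, 0)" "0 < b" "\<And>i. 0 < \<rho> i \<and> \<rho> i < b" "\<And>i. ts (\<rho> i) = reg (e i)"
    and "\<And>r. b \<le> r \<Longrightarrow> r < b + need x \<Longrightarrow> ts r = reg 0" "\<And>i. e i \<le> m"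
  shows "runs (compile x \<rho> b) ts (poly (time_poly x) (length w + m)) (ts(b := reg (eval x w e)))"
  using assms(2-)
proof (induction x arbitrary: \<rho> b ts e m)
  case (Var n)
  note [simp] = Var.prems(1,4)
  have b: "0 < \<rho> n" "\<rho> n < b" "\<rho> n \<noteq> b" "\<rho> n \<noteq> Suc b" using Var.prems(3)[of n] by auto
  have z: "ts b = reg 0" "ts (Suc b) = reg 0" using Var.prems(5) by auto
  define v where "v = e n"
  define ts1 where "ts1 = ts(\<rho> n := reg 0, Suc b := reg v)"
  have 1: "runs (Loop (\<rho> n) 1 (dec (\<rho> n) ;; inc (Suc b))) ts (v * (1 + 3) + 1) ts1"
    by (rule runs_count[where g="\<lambda>j. ts(Suc b := reg j)"])
      (use b z in \<open>auto simp: ts1_def v_def fun_eq_iff intro!: runs_inc_reg\<close>)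
  have 2: "runs (Loop (Suc b) 1 (dec (Suc b) ;; inc (\<rho> n) ;; inc b)) ts1 (v * (1 + 1 + 3) + 1)
      (ts(b := reg v))"
    by (rule runs_count[where g="\<lambda>j. ts(\<rho> n := reg j, b := reg j)"],
        rule runs_Seq[OF runs_inc_reg[OF _ refl] runs_inc_reg])
      (use b z in \<open>auto simp: ts1_def v_def fun_eq_iff\<close>)
  have "v \<le> m" using Var.prems(6) by (simp add: v_def)
  then show ?case
    using runs_mono[OF runs_Seq[OF 1 2], of "poly (time_poly (Var n)) (length w + m)"]
    by (simp add: v_def fun_upd_def)
next
  case One
  then have "runs (inc b) ts 1 (ts(b := reg (Suc 0)))" by (auto intro: runs_inc_reg)
  then show ?case by (simp add: fun_upd_def)
next
  case Len
  define v where "v = length w"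
  have z: "ts b = reg 0" "ts (Suc b) = reg 0" using Len.prems(5) by auto
  \<comment> \<open>The word contains no blank, so the first blank marks its end.\<close>
  have rdw: "rd (contents w, int j) \<noteq> 0 \<longleftrightarrow> j < v" for j
  proof (cases "j < v")
    case True
    then have "w ! j \<in> {1, 2, 3}" using w nth_mem[of j w] unfolding v_def by blast
    then show ?thesis using True unfolding rd_input letter_def v_def by auto
  qed (auto simp: rd_input letter_def v_def)
  define f where "f j = ts(0 := (contents w, int j), b := reg j, Suc b := reg j)" for j
  have f0: "f 0 = ts" using Len.prems(1) z by (auto simp: f_def fun_eq_iff)
  have 1: "runs (Loop 0 0 (inc 0 ;; inc b ;; inc (Suc b))) (f 0) (v * (1 + (1 + 1) + 2) + 1) (f v)"
  proof (rule runs_Loop)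
    show "runs (inc 0 ;; inc b ;; inc (Suc b)) (f j) (1 + (1 + 1)) (f (Suc j))" if "j < v" for j
      by (rule runs_Seq[OF runs_inc[OF _ refl] runs_Seq[OF runs_inc_reg[OF _ refl] runs_inc_reg]])
        (use Len.prems(2) in \<open>auto simp: f_def fun_eq_iff\<close>)
  qed (use rdw Len.prems(2) in \<open>auto simp: f_def\<close>)
  have 2: "runs (Loop (Suc b) 1 (dec (Suc b) ;; dec 0)) (f v) (v * (1 + 3) + 1) (ts(b := reg v))"
    by (rule runs_count[where g="\<lambda>j. ts(0 := (contents w, int (v - j)), b := reg v)"])
      (use z Len.prems(1,2) in \<open>auto simp: f_def fun_eq_iff intro!: runs_dec\<close>)
  show ?case
    using runs_mono[OF runs_Seq[OF 1 2], of "poly (time_poly Len) (length w + m)"] f0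
    by (simp add: v_def fun_upd_def)
next
  case (Look a)
  define v where "v = eval a w e"
  define V where "V = poly (val_poly a) (length w + m)"
  have "v \<le> V" unfolding v_def V_def by (rule eval_le) (use w Look.prems(6) in auto)
  have z: "ts b = reg 0" "ts (Suc b) = reg 0" "ts (Suc (Suc b)) = reg 0"
    using Look.prems(5) by auto
  have 1: "runs (compile a \<rho> (Suc b)) ts (poly (time_poly a) (length w + m)) (ts(Suc b := reg v))"
    unfolding v_def by (rule Look.IH) (use Look.prems in \<open>auto simp: less_Suc_eq\<close>)
  define ts1 where "ts1 = ts(Suc (Suc b) := reg v, 0 := (contents w, int v))"
  have 2: "runs (Loop (Suc b) 1 (dec (Suc b) ;; inc (Suc (Suc b)) ;; inc 0)) (ts(Suc b := reg v))
     (v * (1 + 1 + 3) + 1) ts1"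
    by (rule runs_count[where g="\<lambda>j. ts(Suc (Suc b) := reg j, 0 := (contents w, int j))"],
        rule runs_Seq[OF runs_inc_reg[OF _ refl] runs_inc])
      (use z Look.prems(1,2) in \<open>auto simp: ts1_def fun_eq_iff\<close>)
  define ts2 where "ts2 = ts1(b := reg (letter w v))"
  have s: "rd (ts1 0) = letter w v" by (simp add: ts1_def rd_input)
  have s03: "letter w v \<in> {0,1,2,3}"
  proof (cases "v < length w")
    case True
    then have "w ! v \<in> {1, 2, 3}" using w nth_mem[of v w] by blast
    then show ?thesis using True by (auto simp: letter_def)
  qed (auto simp: letter_def)
  have b0: "0 \<noteq> b" using Look.prems(2) by auto
  \<comment> \<open>Three nested tests identify the letter: every failed test adds 1 to register
    \<open>b\<close>, and after three failures only the letter 3 remains.\<close>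
  have 3: "runs (Cond 0 0 (inc b ;; dec b)
       (inc b ;; Cond 0 1 (inc b ;; dec b) (inc b ;; Cond 0 2 (inc b ;; dec b) (inc b))))
       ts1 (1 + (1 + (2 + 2) + 2) + 2) ts2"
  proof -
    have rb: "ts1 b = reg 0" and r0: "rd ((ts1(b := t)) 0) = letter w v" for t
      using z s b0 by (auto simp: ts1_def)
    have "runs (Cond 0 2 (inc b ;; dec b) (inc b)) (ts1(b := reg 2)) (2 + 2) ts2"
      if "letter w v \<noteq> 0" "letter w v \<noteq> 1"
    proof (rule runs_Cond; unfold r0)
      assume "letter w v = 2"
      then show "runs (inc b ;; dec b) (ts1(b := reg 2)) 2 ts2"
        using runs_nop[of "ts1(b := reg 2)" b 2] by (simp add: ts2_def numeral_2_eq_2)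
    next
      assume "letter w v \<noteq> 2"
      then have "letter w v = 3" using s03 that by auto
      then show "runs (inc b) (ts1(b := reg 2)) 2 ts2"
        by (intro runs_inc_reg[where v=2]) (auto simp: ts2_def)
    qed
    moreover have "runs (inc b) (ts1(b := reg 1)) 1 (ts1(b := reg 2))"
      by (intro runs_inc_reg[where v=1]) (auto simp: numeral_2_eq_2)
    ultimately have 2: "runs (inc b ;; Cond 0 2 (inc b ;; dec b) (inc b)) (ts1(b := reg 1)) (1 + (2 + 2)) ts2"
      if "letter w v \<noteq> 0" "letter w v \<noteq> 1"
      using that by (intro runs_Seq)
    have "runs (Cond 0 1 (inc b ;; dec b) (inc b ;; Cond 0 2 (inc b ;; dec b) (inc b)))
      (ts1(b := reg 1)) (1 + (2 + 2) + 2) ts2" if "letter w v \<noteq> 0"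
    proof (rule runs_Cond; unfold r0)
      assume "letter w v = 1"
      then show "runs (inc b ;; dec b) (ts1(b := reg 1)) (1 + (2 + 2)) ts2"
        using runs_nop[of "ts1(b := reg 1)" b 1] by (simp add: ts2_def)
    qed (use 2 that in auto)
    moreover have "runs (inc b) ts1 1 (ts1(b := reg 1))"
      by (intro runs_inc_reg[where v=0]) (use rb in auto)
    ultimately have 1: "runs (inc b ;; Cond 0 1 (inc b ;; dec b) (inc b ;; Cond 0 2 (inc b ;; dec b) (inc b)))
      ts1 (1 + (1 + (2 + 2) + 2)) ts2" if "letter w v \<noteq> 0"
      using that by (intro runs_Seq)
    show ?thesis
    proof (rule runs_Cond; unfold s)
      assume "letter w v = 0"
      then have "ts2 = ts1" using rb by (auto simp: ts2_def)
      then show "runs (inc b ;; dec b) ts1 (1 + (1 + (2 + 2) + 2)) ts2"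
        using runs_nop[where ts=ts1 and r=b and v=0, OF rb] by simp
    qed (use 1 in auto)
  qed
  have 4: "runs (Loop (Suc (Suc b)) 1 (dec (Suc (Suc b)) ;; dec 0)) ts2 (v * (1 + 3) + 1)
      (ts(b := reg (letter w v)))"
    by (rule runs_count[where g="\<lambda>j. ts2(0 := (contents w, int (v - j)))"])
      (use z Look.prems(1,2) in \<open>auto simp: ts2_def ts1_def fun_eq_iff intro!: runs_dec\<close>)
  have "poly (time_poly a) (length w + m) + (v * (1 + 1 + 3) + 1 + (1 + (1 + (2 + 2) + 2) + 2 + (v * (1 + 3) + 1)))
    \<le> poly (time_poly (Look a)) (length w + m)"
    using \<open>v \<le> V\<close> by (simp add: V_def)
  from runs_mono[OF runs_Seq[OF 1 runs_Seq[OF 2 runs_Seq[OF 3 4]]] this]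
  show ?case by (simp add: v_def fun_upd_def)
next
  case (Add a c)
  have ne: "\<rho> i \<noteq> b" "\<rho> i < Suc b" for i using Add.prems(3)[of i] by auto
  define u v where "u = eval a w e" and "v = eval c w e"
  define V where "V = poly (val_poly c) (length w + m)"
  have "v \<le> V" unfolding v_def V_def by (rule eval_le) (use w Add.prems(6) in auto)
  have z: "ts b = reg 0" "ts (Suc b) = reg 0"
    using Add.prems(5)[of b] Add.prems(5)[of "Suc b"] need_pos[of c] by auto
  have 1: "runs (compile a \<rho> b) ts (poly (time_poly a) (length w + m)) (ts(b := reg u))"
    unfolding u_def by (rule Add.IH(1)) (use Add.prems in auto)
  have 2: "runs (compile c \<rho> (Suc b)) (ts(b := reg u)) (poly (time_poly c) (length w + m))
      (ts(b := reg u, Suc b := reg v))"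
    unfolding v_def by (rule Add.IH(2)) (use Add.prems ne in auto)
  have 3: "runs (Loop (Suc b) 1 (dec (Suc b) ;; inc b)) (ts(b := reg u, Suc b := reg v))
     (v * (1 + 3) + 1) (ts(b := reg (u + v)))"
    by (rule runs_count[where g="\<lambda>j. ts(b := reg (u + j))"])
      (use z in \<open>auto simp: fun_eq_iff intro!: runs_inc_reg\<close>)
  have "poly (time_poly a) (length w + m) + (poly (time_poly c) (length w + m) + (v * (1 + 3) + 1))
    \<le> poly (time_poly (Add a c)) (length w + m)"
    using \<open>v \<le> V\<close> by (simp add: V_def)
  from runs_mono[OF runs_Seq[OF 1 runs_Seq[OF 2 3]] this]
  show ?case by (simp add: u_def v_def fun_upd_def)
next
  case (Sub a c)
  have ne: "\<rho> i \<noteq> b" "\<rho> i < Suc b" for i using Sub.prems(3)[of i] by auto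
  define u v where "u = eval a w e" and "v = eval c w e"
  define V where "V = poly (val_poly c) (length w + m)"
  have "v \<le> V" unfolding v_def V_def by (rule eval_le) (use w Sub.prems(6) in auto)
  have z: "ts b = reg 0" "ts (Suc b) = reg 0"
    using Sub.prems(5)[of b] Sub.prems(5)[of "Suc b"] need_pos[of c] by auto
  have 1: "runs (compile a \<rho> b) ts (poly (time_poly a) (length w + m)) (ts(b := reg u))"
    unfolding u_def by (rule Sub.IH(1)) (use Sub.prems in auto)
  have 2: "runs (compile c \<rho> (Suc b)) (ts(b := reg u)) (poly (time_poly c) (length w + m))
      (ts(b := reg u, Suc b := reg v))"
    unfolding v_def by (rule Sub.IH(2)) (use Sub.prems ne in auto)
  have 3: "runs (Loop (Suc b) 1 (dec (Suc b) ;; Cond b 1 (inc b ;; dec b) (dec b)))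
     (ts(b := reg u, Suc b := reg v)) (v * (2 + 2 + 3) + 1) (ts(b := reg (u - v)))"
  proof (rule runs_count[where g="\<lambda>j. ts(b := reg (u - j))"])
    fix j
    let ?t = "ts(b := reg (u - j), Suc b := reg (v - Suc j))"
    let ?t' = "ts(b := reg (u - Suc j), Suc b := reg (v - Suc j))"
    \<comment> \<open>A counter that is already 0 is left alone, which yields truncated
      subtraction.\<close>
    show "runs (Cond b 1 (inc b ;; dec b) (dec b)) ?t (2 + 2) ?t'"
    proof (rule runs_Cond)
      assume "rd (?t b) = 1"
      then have "u - j = 0" "?t = ?t'" by (auto simp: rd_reg split: if_splits)
      then show "runs (inc b ;; dec b) ?t 2 ?t'" using runs_nop[of ?t b 0] by simp
    next
      assume "rd (?t b) \<noteq> 1"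
      then have "u - j = Suc (u - Suc j)" by (auto simp: rd_reg split: if_splits)
      then have "runs (dec b) ?t 1 ?t'" by (intro runs_dec_reg) (auto simp: fun_eq_iff)
      then show "runs (dec b) ?t 2 ?t'" by (rule runs_mono) simp
    qed
  qed (use z in \<open>auto simp: fun_eq_iff\<close>)
  have "poly (time_poly a) (length w + m) + (poly (time_poly c) (length w + m) + (v * (2 + 2 + 3) + 1))
    \<le> poly (time_poly (Sub a c)) (length w + m)"
    using \<open>v \<le> V\<close> by (simp add: V_def)
  from runs_mono[OF runs_Seq[OF 1 runs_Seq[OF 2 3]] this]
  show ?case by (simp add: u_def v_def fun_upd_def)
next
  case (Sum a c)
  define v where "v = eval a w e"
  define A where "A = poly (val_poly a) (length w + m)"
  define s where "s j = (\<Sum>i<j. eval c w (case_nat i e))" for j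
  define N where "N = length w + (m + A)"
  have vA: "v \<le> A" unfolding v_def A_def by (rule eval_le) (use w Sum.prems(6) in auto)
  have z: "ts b = reg 0" "ts (Suc b) = reg 0" "ts (b + 2) = reg 0" "ts (b + 3) = reg 0"
    using Sum.prems(5) by auto
  have 1: "runs (compile a \<rho> (Suc b)) ts (poly (time_poly a) (length w + m)) (ts(Suc b := reg v))"
    unfolding v_def by (rule Sum.IH(1)) (use Sum.prems in \<open>auto simp: less_Suc_eq\<close>)
  define g where "g j = ts(b := reg (s j), b + 2 := reg j)" for j
  have 2: "runs (Loop (Suc b) 1
       (dec (Suc b) ;; compile c (case_nat (b + 2) \<rho>) (b + 3) ;;
        Loop (b + 3) 1 (dec (b + 3) ;; inc b) ;; inc (b + 2))) (ts(Suc b := reg v))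
     (v * (poly (time_poly c) N + (poly (val_poly c) N * 4 + 1 + 1) + 3) + 1)
     ((g v)(Suc b := reg 0))"
  proof (rule runs_count[where g=g])
    fix j assume j: "j < v"
    define y where "y = eval c w (case_nat j e)"
    have env: "case_nat j e i \<le> m + A" for i
      using Sum.prems(6) j vA by (auto split: nat.split intro: trans_le_add1)
    have yV: "y \<le> poly (val_poly c) N" unfolding y_def N_def
      by (rule eval_le) (use env w in auto)
    let ?t = "(g j)(Suc b := reg (v - Suc j))"
    have a: "runs (compile c (case_nat (b + 2) \<rho>) (b + 3)) ?t (poly (time_poly c) N) (?t(b + 3 := reg y))"
      unfolding y_def N_def
    proof (rule Sum.IH(2))
      show "?t 0 = (contents w, 0)" using Sum.prems(1,2) by (auto simp: g_def)
      show "?t (case_nat (b + 2) \<rho> i) = reg (case_nat j e i)" for i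
        using Sum.prems(3,4) by (auto simp: g_def less_Suc_eq split: nat.split) (metis less_irrefl less_Suc_eq trans_less_add1)+
      show "0 < case_nat (b + 2) \<rho> i \<and> case_nat (b + 2) \<rho> i < b + 3" for i
        using Sum.prems(3) by (auto split: nat.split intro: trans_less_add1)
      show "?t r = reg 0" if "b + 3 \<le> r" "r < b + 3 + need c" for r
        using Sum.prems(5)[of r] that by (auto simp: g_def)
    qed (use env in auto)
    have b: "runs (Loop (b + 3) 1 (dec (b + 3) ;; inc b)) (?t(b + 3 := reg y)) (y * (1 + 3) + 1)
      (?t(b := reg (s (Suc j))))"
      by (rule runs_count[where g="\<lambda>i. ?t(b := reg (s j + i))"])
        (use z in \<open>auto simp: fun_eq_iff g_def s_def y_def intro!: runs_inc_reg\<close>)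
    have c: "runs (inc (b + 2)) (?t(b := reg (s (Suc j)))) 1 ((g (Suc j))(Suc b := reg (v - Suc j)))"
      by (rule runs_inc_reg[where v=j]) (auto simp: g_def fun_eq_iff)
    show "runs (compile c (case_nat (b + 2) \<rho>) (b + 3) ;;
        Loop (b + 3) 1 (dec (b + 3) ;; inc b) ;; inc (b + 2)) ?t
       (poly (time_poly c) N + (poly (val_poly c) N * 4 + 1 + 1)) ((g (Suc j))(Suc b := reg (v - Suc j)))"
      by (rule runs_mono[OF runs_Seq[OF a runs_Seq[OF b c]]]) (use yV in simp)
  qed (use z in \<open>auto simp: g_def s_def fun_eq_iff\<close>)
  have 3: "runs (Loop (b + 2) 1 (dec (b + 2))) ((g v)(Suc b := reg 0)) (v * 3 + 1) (ts(b := reg (s v)))"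
    by (rule runs_clear[of _ _ v]) (use z in \<open>auto simp: g_def fun_eq_iff\<close>)
  define B where "B = poly (time_poly c) N + 4 * poly (val_poly c) N + 8"
  have "poly (time_poly (Sum a c)) (length w + m) = poly (time_poly a) (length w + m) + 2 + A * B"
    by (simp add: poly_pcompose A_def[symmetric] B_def N_def add.assoc)
  moreover have "v * (poly (time_poly c) N + (poly (val_poly c) N * 4 + 1 + 1) + 3) + 1 + (v * 3 + 1) = 2 + v * B"
    by (simp add: B_def algebra_simps)
  moreover have "v * B \<le> A * B" using vA by simp
  ultimately have "poly (time_poly a) (length w + m) +
      (v * (poly (time_poly c) N + (poly (val_poly c) N * 4 + 1 + 1) + 3) + 1 + (v * 3 + 1))
    \<le> poly (time_poly (Sum a c)) (length w + m)"
    by linarith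
  from runs_mono[OF runs_Seq[OF 1 runs_Seq[OF 2 3]] this]
  show ?case by (simp add: v_def s_def fun_upd_def)
next
  case (Ren f a)
  show ?case using Ren.IH[of ts b "\<rho> \<circ> f" "e \<circ> f" m] Ren.prems by (simp add: fun_upd_def comp_def)
qed

text \<open>\<open>Act 0 id Stay\<close> does nothing. Only tapes 1 to \<open>r\<close> receive a
  mark, so that a further tape can stay blank for the output.\<close>

primrec prepare :: "nat \<Rightarrow> com" where
  "prepare 0 = Act 0 id Stay"
| "prepare (Suc r) = prepare r ;; Act (Suc r) (\<lambda>_. 1) Stay"

lemma wf_prepare: "r < k \<Longrightarrow> wf_com k (prepare r)"
  by (induction r) auto

lemma prepare_runs:
  "runs (prepare r) (start_tapes w) (r + 1)
     (\<lambda>i. if 0 < i \<and> i \<le> r then reg 0 else start_tapes w i)"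
proof (induction r)
  case 0
  have "runs (Act 0 id Stay) (start_tapes w) 1 (start_tapes w)"
    using runs_Act[of 0 id Stay "start_tapes w"] by (simp add: act_stay)
  moreover have "(\<lambda>i. if 0 < i \<and> i \<le> 0 then reg 0 else start_tapes w i) = start_tapes w"
    by auto
  ultimately show ?case by simp
next
  case (Suc r)
  let ?ts = "\<lambda>i. if 0 < i \<and> i \<le> r then reg 0 else start_tapes w i"
  have "act (1, Stay) (contents [], 0) = reg 0"
    by (auto simp: reg_def contents_def fun_eq_iff)
  then have "runs (Act (Suc r) (\<lambda>_. 1) Stay) ?ts 1
      (\<lambda>i. if 0 < i \<and> i \<le> Suc r then reg 0 else start_tapes w i)"
    using runs_Act[of "Suc r" "\<lambda>_. 1" Stay ?ts]
    by (simp add: start_tapes_def fun_upd_def) (rule back_subst[of "runs _ _ _"], assumption, auto)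
  from runs_Seq[OF Suc.IH this] show ?case by simp
qed

lemma halting_run:
  assumes "fst (run M w n) \<in> halting_states M" "n \<le> n'"
  shows "run M w n' = run M w n"
proof -
  have "run M w (d + n) = run M w n" for d
  proof (induction d)
    case (Suc d)
    have "run M w (Suc d + n) = step M (run M w (d + n))" by (simp add: run_def)
    then show ?case using assms(1) Suc by (cases "run M w n") simp
  qed simp
  then show ?thesis using assms(2) by (metis le_add_diff_inverse2)
qed

text \<open>Halting states are fixed points of \<open>step\<close>, so the verdict can be read off
  at any time after halting.\<close>

lemma accepts_iff:
  assumes "halts_within M w n" "n \<le> n'"
  shows "accepts M w \<longleftrightarrow> fst (run M w n') = accept_state M"
proof
  assume "accepts M w"
  then obtain k where k: "fst (run M w k) = accept_state M" unfolding accepts_def by blast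
  then have "run M w (max k n') = run M w k"
    by (intro halting_run) (auto simp: halting_states_def)
  moreover have "run M w (max k n') = run M w n" "run M w n' = run M w n"
    using assms unfolding halts_within_def by (auto intro: halting_run)
  ultimately show "fst (run M w n') = accept_state M" using k by simp
qed (auto simp: accepts_def)

lemma exp_decider:
  "\<exists>M (q :: nat poly). turing_machine M \<and>
     (\<forall>w. set w \<subseteq> {1, 2, 3} \<longrightarrow>
        halts_within M w (poly q (length w)) \<and>
        (accepts M w \<longleftrightarrow> eval x w (\<lambda>_. 0) \<noteq> 0))"
proof -
  define k where "k = need x + 2"
  \<comment> \<open>Register 1 keeps the value 0 and represents all variables at once; the result is
    left in register 2.\<close>
  define c where "c = (prepare (need x + 1) ;; compile x (\<lambda>_. 1) 2)"
  define M where "M = program k c 2"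
  define q where "q = time_poly x + [:need x + 3:]"
  have wf: "wf_com k c" "2 < k"
    unfolding c_def k_def using need_pos[of x] by (auto intro!: wf_prepare wf_compile)
  have "halts_within M w (poly q (length w)) \<and> (accepts M w \<longleftrightarrow> eval x w (\<lambda>_. 0) \<noteq> 0)"
    if w: "set w \<subseteq> {1, 2, 3}" for w
  proof -
    let ?ts = "\<lambda>i. if 0 < i \<and> i \<le> need x + 1 then reg 0 else start_tapes w i"
    let ?ts' = "?ts(2 := reg (eval x w (\<lambda>_. 0)))"
    have "runs (compile x (\<lambda>_. 1) 2) ?ts (poly (time_poly x) (length w + 0)) ?ts'"
      by (rule compile_runs[OF w]) (auto simp: start_tapes_def)
    from runs_Seq[OF prepare_runs this]
    obtain n where "n \<le> need x + 1 + 1 + poly (time_poly x) (length w + 0)"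
      and big: "big c (start_tapes w) n ?ts'"
      unfolding runs_def c_def by blast
    then have "n < poly q (length w)" by (simp add: q_def)
    note n = this big
    have run: "fst (run M w n') = (if eval x w (\<lambda>_. 0) = 0 then reject_state M else accept_state M)"
      if "n < n'" for n'
      using run_program[OF wf n(2) that] by (simp add: M_def rd_reg)
    have halt: "fst (run M w (poly q (length w))) \<in> halting_states M"
      using run[OF n(1)] by (auto simp: halting_states_def)
    have "accepts M w \<longleftrightarrow> fst (run M w (poly q (length w))) = accept_state M"
      using halt by (intro accepts_iff) (auto simp: halts_within_def)
    also have "\<dots> \<longleftrightarrow> eval x w (\<lambda>_. 0) \<noteq> 0"
      using run[OF n(1)] by (simp add: M_def program_def)
    finally show ?thesis using halt unfolding halts_within_def by simp
  qed
  then show ?thesis using turing_machine_program[OF wf] unfolding M_def[symmetric] by blast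
qed

section \<open>Functions whose output bits are given by a term\<close>

lemma contents_snoc:
  "i < length v \<Longrightarrow> contents (take (Suc i) v) = (contents (take i v))(int i := v ! i)"
  by (auto simp: contents_def fun_eq_iff nat_less_iff min_def)

lemma exp_computable:
  "poly_time_computable
     (\<lambda>x. map (\<lambda>j. eval a (bits x) (case_nat j (\<lambda>_. 0)) \<noteq> 0) [0..<eval l (bits x) (\<lambda>_. 0)])"
    (is "poly_time_computable ?f")
proof -
  define k where "k = need a + need l + 6"
  define out where "out = need a + need l + 5"
  \<comment> \<open>Register 2 counts the positions still to be written, register 3 holds the
    current position and is variable 0 of \<open>a\<close>, register 4 receives the value of
    \<open>a\<close>, and register 1 stays 0 for the other variables. The head of tape
    \<open>out\<close> moves right together with register 3.\<close>
  define body where "body =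
    (compile a (case_nat 3 (\<lambda>_. 1)) 4 ;;
     Cond 4 1 (Act out (\<lambda>_. 1) MoveRight) (Act out (\<lambda>_. 2) MoveRight) ;;
     Loop 4 1 (dec 4) ;; inc 3)"
  define c where "c = (prepare (need a + need l + 4) ;; compile l (\<lambda>_. 1) 2 ;; Loop 2 1 (dec 2 ;; body))"
  define M where "M = program k c 2"
  define P where "P = [:0, 1:] + val_poly l"
  define q where "q = [:need a + need l + 6:] + time_poly l +
    val_poly l * (pcompose (time_poly a + [:3:] * val_poly a) P + [:8:]) + [:1:]"
  have wf: "wf_com k c" "2 < k"
    unfolding c_def body_def k_def out_def
    by (auto intro!: wf_prepare wf_compile split: nat.split)
  have "halts_within M (bits x) (poly q (length x)) \<and>
     fst (last (snd (run M (bits x) (poly q (length x))))) = contents (bits (?f x))" for x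
  proof -
    define w where "w = bits x"
    define n where "n = eval l w (\<lambda>_. 0)"
    define v where "v = bits (?f x)"
    have w: "set w \<subseteq> {1, 2, 3}" by (auto simp: w_def bits_def)
    have lw: "length w = length x" by (simp add: w_def bits_def)
    have lv: "length v = n" by (simp add: v_def n_def w_def bits_def)
    define A where "A = poly (val_poly l) (length w)"
    define N where "N = length w + A"
    have nA: "n \<le> A" unfolding n_def A_def using eval_le[OF w, of "\<lambda>_. 0" 0 l] by simp
    let ?r = "need a + need l + 4"
    define ts where "ts = (\<lambda>i. if 0 < i \<and> i \<le> ?r then reg 0 else start_tapes w i)"
    have o: "out \<noteq> 0" "out \<noteq> 2" "out \<noteq> 3" "out \<noteq> 4" "4 + need a < out" "2 + need l < out"
      by (auto simp: out_def)
    have ts: "ts 0 = (contents w, 0)" "ts out = (contents [], 0)" "\<And>i. 0 < i \<Longrightarrow> i < out \<Longrightarrow> ts i = reg 0"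
      by (auto simp: ts_def start_tapes_def out_def)
    have 1: "runs (compile l (\<lambda>_. 1) 2) ts (poly (time_poly l) (length w + 0)) (ts(2 := reg n))"
      unfolding n_def by (rule compile_runs[OF w]) (use ts o in auto)
    define g where "g j = ts(3 := reg j, out := (contents (take j v), int j))" for j
    have 2: "runs (Loop 2 1 (dec 2 ;; body)) (ts(2 := reg n))
      (n * (poly (time_poly a) N + (1 + 2 + (poly (val_poly a) N * 3 + 1 + 1)) + 3) + 1)
      ((g n)(2 := reg 0))"
    proof (rule runs_count[where g=g])
      show "ts(2 := reg n) = (g 0)(2 := reg n)"
        using ts o by (auto simp: g_def fun_eq_iff)
    next
      fix j assume j: "j < n"
      define y where "y = eval a w (case_nat j (\<lambda>_. 0))"
      have env: "case_nat j (\<lambda>_. 0) i \<le> A" for i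
        using j nA by (auto split: nat.split)
      have yV: "y \<le> poly (val_poly a) N" unfolding y_def N_def
        by (rule eval_le[OF w env])
      have vj: "v ! j = (if y = 0 then 1 else 2)"
        using j unfolding v_def y_def n_def w_def bits_def by simp
      let ?t = "(g j)(2 := reg (n - Suc j))"
      have a: "runs (compile a (case_nat 3 (\<lambda>_. 1)) 4) ?t (poly (time_poly a) N) (?t(4 := reg y))"
        unfolding y_def N_def
        by (rule compile_runs[OF w _ _ _ _ _ env])
          (use ts o in \<open>auto simp: g_def split: nat.split\<close>)
      let ?u = "?t(4 := reg y, out := (contents (take (Suc j) v), int (Suc j)))"
      have b: "runs (Cond 4 1 (Act out (\<lambda>_. 1) MoveRight) (Act out (\<lambda>_. 2) MoveRight))
        (?t(4 := reg y)) (1 + 2) ?u"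
      proof (rule runs_Cond)
        have t: "(?t(4 := reg y)) out = (contents (take j v), int j)"
          using o by (simp add: g_def)
        have "runs (Act out (\<lambda>_. s) MoveRight) (?t(4 := reg y)) 1 ?u" if s: "v ! j = s" for s
        proof -
          have "act (s, MoveRight) (contents (take j v), int j) =
              (contents (take (Suc j) v), int (Suc j))"
            using contents_snoc[of j v] j s lv by simp
          then show ?thesis
            using runs_Act[of out "\<lambda>_. s" MoveRight "?t(4 := reg y)"] unfolding t by metis
        qed
        note out1 = this[of 1] and out2 = this[of 2]
        have y: "rd ((?t(4 := reg y)) 4) = 1 \<longleftrightarrow> y = 0" by (simp add: rd_reg)
        show "runs (Act out (\<lambda>_. 1) MoveRight) (?t(4 := reg y)) 1 ?u"
          if "rd ((?t(4 := reg y)) 4) = 1"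
          by (rule out1) (use that[unfolded y] vj in simp)
        show "runs (Act out (\<lambda>_. 2) MoveRight) (?t(4 := reg y)) 1 ?u"
          if "rd ((?t(4 := reg y)) 4) \<noteq> 1"
          by (rule out2) (use that[unfolded y] vj in simp)
      qed
      have c: "runs (Loop 4 1 (dec 4)) ?u (y * 3 + 1) (?u(4 := reg 0))"
        by (rule runs_clear) (use o in auto)
      have d: "runs (inc 3) (?u(4 := reg 0)) 1 ((g (Suc j))(2 := reg (n - Suc j)))"
        by (rule runs_inc_reg[where v=j]) (use ts o in \<open>auto simp: g_def fun_eq_iff\<close>)
      show "runs body ?t (poly (time_poly a) N + (1 + 2 + (poly (val_poly a) N * 3 + 1 + 1)))
          ((g (Suc j))(2 := reg (n - Suc j)))"
        unfolding body_def
        by (rule runs_mono[OF runs_Seq[OF a runs_Seq[OF b runs_Seq[OF c d]]]]) (use yV in simp)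
    qed simp
    define B where "B = poly (time_poly a) N + 3 * poly (val_poly a) N + 8"
    have q: "poly q (length x) = need a + need l + 6 + poly (time_poly l) (length w) + A * B + 1"
      by (simp add: q_def P_def poly_pcompose lw[symmetric] A_def[symmetric] N_def[symmetric] B_def)
    have e: "n * (poly (time_poly a) N + (1 + 2 + (poly (val_poly a) N * 3 + 1 + 1)) + 3) = n * B"
      by (simp add: B_def algebra_simps)
    have "n * B \<le> A * B" using nA by simp
    moreover define U W where "U = n * B" and "W = A * B"
    ultimately have "U \<le> W" by simp
    then have t: "?r + 1 + (poly (time_poly l) (length w + 0) +
        (n * (poly (time_poly a) N + (1 + 2 + (poly (val_poly a) N * 3 + 1 + 1)) + 3) + 1)) < poly q (length x)"
      unfolding q e U_def[symmetric] W_def[symmetric] by simp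
    from runs_Seq[OF prepare_runs[of ?r w, folded ts_def] runs_Seq[OF 1 2]] t
    obtain n' where n': "n' < poly q (length x)" "big c (start_tapes w) n' ((g n)(2 := reg 0))"
      unfolding runs_def c_def by (auto dest: le_less_trans)
    have "k = Suc out" by (simp add: k_def out_def)
    then have "last (map ((g n)(2 := reg 0)) [0..<k]) = ((g n)(2 := reg 0)) out"
      by (simp add: last_map)
    moreover have "\<dots> = (contents v, int n)"
      using o lv by (simp add: g_def)
    ultimately show ?thesis
      using run_program[OF wf n'(2,1)]
      unfolding M_def[symmetric] v_def[symmetric] unfolding w_def[symmetric]
      by (simp add: halts_within_def halting_states_def)
  qed
  then show ?thesis using turing_machine_program[OF wf] unfolding poly_time_computable_def M_def[symmetric]
    by blast
qed

section \<open>Definable functions and predicates\<close>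

text \<open>Definability is a property of functions, not of terms: closure under each operation is
  proved once, and later goals are decomposed by \<open>intro\<close> with \<open>def_intro\<close>.
  Membership in NP and the efficiency of the reduction thus become goals that follow the shape of
  the defining formulas.\<close>

definition definable :: "(nat list \<Rightarrow> (nat \<Rightarrow> nat) \<Rightarrow> nat) \<Rightarrow> bool" where
  "definable F \<longleftrightarrow> (\<exists>x. \<forall>w e. eval x w e = F w e)"

definition definable_pred :: "(nat list \<Rightarrow> (nat \<Rightarrow> nat) \<Rightarrow> bool) \<Rightarrow> bool" where
  "definable_pred P \<longleftrightarrow> definable (\<lambda>w e. if P w e then 1 else 0)"

lemma definableE:
  assumes "definable F"
  obtains x where "\<And>w e. eval x w e = F w e"
  using assms unfolding definable_def by blast

lemma definableI: "(\<And>w e. eval x w e = F w e) \<Longrightarrow> definable F"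
  unfolding definable_def by blast

named_theorems def_intro

lemma def_var [def_intro]: "definable (\<lambda>w e. e n)"
  by (rule definableI[of "Var n"]) simp

lemma def_length [def_intro]: "definable (\<lambda>w e. length w)"
  by (rule definableI[of Len]) simp

lemma def_letter [def_intro]:
  assumes "definable F" shows "definable (\<lambda>w e. letter w (F w e))"
proof -
  obtain x where "\<And>w e. eval x w e = F w e" using assms by (rule definableE) blast
  then show ?thesis by (intro definableI[of "Look x"]) simp
qed

lemma def_add [def_intro]:
  assumes "definable F" "definable G" shows "definable (\<lambda>w e. F w e + G w e)"
proof -
  obtain x where "\<And>w e. eval x w e = F w e" using assms(1) by (rule definableE) blast
  moreover obtain y where "\<And>w e. eval y w e = G w e" using assms(2) by (rule definableE) blast
  ultimately show ?thesis by (intro definableI[of "Add x y"]) simp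
qed

lemma def_diff [def_intro]:
  assumes "definable F" "definable G" shows "definable (\<lambda>w e. F w e - G w e)"
proof -
  obtain x where "\<And>w e. eval x w e = F w e" using assms(1) by (rule definableE) blast
  moreover obtain y where "\<And>w e. eval y w e = G w e" using assms(2) by (rule definableE) blast
  ultimately show ?thesis by (intro definableI[of "Sub x y"]) simp
qed

lemma def_const [def_intro]: "definable (\<lambda>w e. c)"
proof (induction c)
  case 0
  show ?case by (rule definableI[of "Sub One One"]) simp
next
  case (Suc c)
  have "definable (\<lambda>w e. 1)" by (rule definableI[of One]) simp
  from def_add[OF Suc this] show ?case by simp
qed

lemma def_Suc [def_intro]: "definable F \<Longrightarrow> definable (\<lambda>w e. Suc (F w e))"
  using def_add[OF _ def_const[of 1], of F] by simp

lemma def_rename: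
  assumes "definable F" shows "definable (\<lambda>w e. F w (\<lambda>n. e (\<rho> n)))"
proof -
  obtain x where "\<And>w e. eval x w e = F w e" using assms by (rule definableE) blast
  then show ?thesis by (intro definableI[of "Ren \<rho> x"]) (simp add: comp_def)
qed

text \<open>In the second premise the index has become variable 0 and the other variables are
  shifted by one. The rules for bounded quantifiers, cardinalities and \<open>def_let\<close> follow
  the same pattern.\<close>

lemma def_sum [def_intro]:
  assumes "definable F" "definable (\<lambda>w e. G w (\<lambda>n. e (Suc n)) (e 0))"
  shows "definable (\<lambda>w e. \<Sum>i<F w e. G w e i)"
proof -
  obtain a where "\<And>w e. eval a w e = F w e" using assms(1) by (rule definableE) blast
  moreover obtain b where "\<And>w e. eval b w e = G w (\<lambda>n. e (Suc n)) (e 0)"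
    using assms(2) by (rule definableE) blast
  ultimately show ?thesis by (intro definableI[of "Sum a b"]) simp
qed

lemma def_mult [def_intro]:
  assumes "definable F" "definable G"
  shows "definable (\<lambda>w e. F w e * G w e)"
proof -
  have "definable (\<lambda>w e. \<Sum>i<F w e. G w e)"
    by (rule def_sum[where G="\<lambda>w e i. G w e", OF assms(1) def_rename[where \<rho>=Suc, OF assms(2)]])
  then show ?thesis by simp
qed

lemma def_pow [def_intro]: "definable F \<Longrightarrow> definable (\<lambda>w e. F w e ^ c)"
proof (induction c)
  case 0
  show ?case unfolding power_0 by (rule def_const)
next
  case (Suc c)
  then show ?case unfolding power_Suc by (intro def_mult) auto
qed

lemma def_poly [def_intro]: "definable F \<Longrightarrow> definable (\<lambda>w e. poly p (F w e))"
proof (induction p)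
  case 0
  show ?case unfolding poly_0 by (rule def_const)
next
  case (pCons a p)
  then show ?case unfolding poly_pCons by (intro def_add def_const def_mult) auto
qed

lemma def_le [def_intro]:
  assumes "definable F" "definable G"
  shows "definable_pred (\<lambda>w e. F w e \<le> G w e)"
proof -
  have "definable (\<lambda>w e. 1 - (F w e - G w e))"
    by (intro def_intro assms)
  moreover have "1 - (a - b) = (if a \<le> b then 1 else 0)" for a b :: nat by auto
  ultimately show ?thesis unfolding definable_pred_def by simp
qed

lemma def_not [def_intro]:
  assumes "definable_pred P"
  shows "definable_pred (\<lambda>w e. \<not> P w e)"
proof -
  have "definable (\<lambda>w e. 1 - (if P w e then 1 else 0))"
    using assms unfolding definable_pred_def by (intro def_diff def_const)
  moreover have "1 - (if b then 1 else 0) = (if \<not> b then 1 else (0 :: nat))" for b by auto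
  ultimately show ?thesis unfolding definable_pred_def by simp
qed

lemma def_conj [def_intro]:
  assumes "definable_pred P" "definable_pred Q"
  shows "definable_pred (\<lambda>w e. P w e \<and> Q w e)"
proof -
  have "definable (\<lambda>w e. (if P w e then 1 else 0) * (if Q w e then 1 else 0))"
    using assms unfolding definable_pred_def by (intro def_mult)
  moreover have "(if b then 1 else 0) * (if c then 1 else 0) = (if b \<and> c then 1 else (0 :: nat))" for b c
    by auto
  ultimately show ?thesis unfolding definable_pred_def by simp
qed

lemma def_disj [def_intro]:
  assumes "definable_pred P" "definable_pred Q"
  shows "definable_pred (\<lambda>w e. P w e \<or> Q w e)"
proof -
  have "(\<lambda>w e. P w e \<or> Q w e) = (\<lambda>w e. \<not> (\<not> P w e \<and> \<not> Q w e))" by auto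
  then show ?thesis using def_not[OF def_conj[OF assms[THEN def_not]]] by simp
qed

lemma def_imp [def_intro]:
  assumes "definable_pred P" "definable_pred Q"
  shows "definable_pred (\<lambda>w e. P w e \<longrightarrow> Q w e)"
proof -
  have eq: "(\<lambda>w e. P w e \<longrightarrow> Q w e) = (\<lambda>w e. \<not> P w e \<or> Q w e)"
    by (intro ext) auto
  show ?thesis unfolding eq by (intro def_disj def_not assms)
qed

lemma def_iff [def_intro]:
  assumes "definable_pred P" "definable_pred Q"
  shows "definable_pred (\<lambda>w e. P w e = Q w e)"
proof -
  have eq: "(\<lambda>w e. P w e = Q w e) = (\<lambda>w e. (P w e \<longrightarrow> Q w e) \<and> (Q w e \<longrightarrow> P w e))"
    by (intro ext) auto
  show ?thesis unfolding eq by (intro def_conj def_imp assms)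
qed

lemma def_eq [def_intro]:
  fixes F G :: "nat list \<Rightarrow> (nat \<Rightarrow> nat) \<Rightarrow> nat"
  assumes "definable F" "definable G"
  shows "definable_pred (\<lambda>w e. F w e = G w e)"
proof -
  have eq: "(\<lambda>w e. F w e = G w e) = (\<lambda>w e. F w e \<le> G w e \<and> G w e \<le> F w e)"
    by (intro ext) auto
  show ?thesis unfolding eq by (intro def_conj def_le assms)
qed

lemma def_less [def_intro]:
  assumes "definable F" "definable G"
  shows "definable_pred (\<lambda>w e. F w e < G w e)"
proof -
  have eq: "(\<lambda>w e. F w e < G w e) = (\<lambda>w e. \<not> G w e \<le> F w e)"
    by (intro ext) auto
  show ?thesis unfolding eq by (intro def_not def_le assms)
qed

lemma def_if [def_intro]:
  assumes "definable_pred P" "definable F" "definable G"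
  shows "definable (\<lambda>w e. if P w e then F w e else G w e)"
proof -
  have "definable (\<lambda>w e. (if P w e then 1 else 0) * F w e + (1 - (if P w e then 1 else 0)) * G w e)"
    using assms unfolding definable_pred_def
    by (intro def_add def_mult def_diff def_const) assumption+
  moreover have "(if b then 1 else 0) * x + (1 - (if b then 1 else 0)) * y = (if b then x else (y :: nat))"
    for b x y by auto
  ultimately show ?thesis by simp
qed

lemma def_ex [def_intro]:
  assumes "definable F" "definable_pred (\<lambda>w e. P w (\<lambda>n. e (Suc n)) (e 0))"
  shows "definable_pred (\<lambda>w e. \<exists>i<F w e. P w e i)"
proof -
  have "definable_pred (\<lambda>w e. (\<Sum>i<F w e. if P w e i then 1 else 0) \<noteq> (0 :: nat))"
    by (intro def_intro assms)
  moreover have "(\<Sum>i<n. if Q i then 1 else 0) \<noteq> (0 :: nat) \<longleftrightarrow> (\<exists>i<n. Q i)" for n :: nat and Q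
    by auto
  ultimately show ?thesis by simp
qed

lemma def_all [def_intro]:
  assumes "definable F" "definable_pred (\<lambda>w e. P w (\<lambda>n. e (Suc n)) (e 0))"
  shows "definable_pred (\<lambda>w e. \<forall>i<F w e. P w e i)"
  using def_not[OF def_ex[OF assms(1) def_not[OF assms(2)]]] by simp

text \<open>Only the summand at \<open>i = F w e\<close> survives, so a bounded sum does the work of
  substitution.\<close>

lemma def_let:
  assumes "definable F" "definable (\<lambda>w e. G w (\<lambda>n. e (Suc n)) (e 0))"
  shows "definable (\<lambda>w e. G w e (F w e))"
proof -
  have "definable (\<lambda>w e. \<Sum>i<Suc (F w e). if i = F w e then G w e i else 0)"
    by (intro def_intro assms def_rename[OF assms(1)])
  then show ?thesis by simp
qed

lemma card_bounded_eq_sum: "card {i. i < (n::nat) \<and> P i} = (\<Sum>i<n. if P i then 1 else 0)"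
proof -
  have "{i. i < n \<and> P i} = {i \<in> {..<n}. P i}" by auto
  then show ?thesis by (simp add: sum.If_cases Int_def)
qed

lemma def_card [def_intro]:
  assumes "definable F" "definable_pred (\<lambda>w e. P w (\<lambda>n. e (Suc n)) (e 0))"
  shows "definable (\<lambda>w e. card {i. i < F w e \<and> P w e i})"
  unfolding card_bounded_eq_sum by (intro def_intro assms)

lemma def_div [def_intro]:
  assumes "definable F" "definable G"
  shows "definable (\<lambda>w e. F w e div G w e)"
proof -
  \<comment> \<open>The quotient counts the positive multiples of the divisor up to the dividend;
    the last conjunct gives 0 for division by 0.\<close>
  have "definable (\<lambda>w e. card {i. i < F w e \<and> Suc i * G w e \<le> F w e \<and> 0 < G w e})"
    by (intro def_intro assms def_rename[OF assms(1)] def_rename[OF assms(2)])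
  moreover have "card {i. i < a \<and> Suc i * b \<le> a \<and> 0 < b} = a div b" for a b :: nat
  proof (cases "b = 0")
    case False
    then have pos: "0 < b" by simp
    have "Suc i * b \<le> a \<longleftrightarrow> i < a div b" for i
      unfolding less_eq_div_iff_mult_less_eq[OF pos, symmetric] by (rule Suc_le_eq)
    moreover have "i < a div b \<Longrightarrow> i < a" for i
      by (meson div_le_dividend less_le_trans)
    ultimately have "{i. i < a \<and> Suc i * b \<le> a \<and> 0 < b} = {..<a div b}"
      using False by auto
    then show ?thesis by simp
  qed simp
  ultimately show ?thesis by simp
qed

lemma def_mod [def_intro]:
  assumes "definable F" "definable G"
  shows "definable (\<lambda>w e. F w e mod G w e)"
proof -
  have "definable (\<lambda>w e. F w e - F w e div G w e * G w e)"
    by (intro def_intro assms)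
  then show ?thesis by (simp add: minus_div_mult_eq_mod)
qed

text \<open>\<open>h\<close> is arbitrary, since finitely many of its values are built into the
  term. This is the entry point for the tables of a fixed machine.\<close>

lemma def_table:
  assumes "definable F"
  shows "definable (\<lambda>w e. if F w e < c then h (F w e) else 0)"
proof (induction c)
  case (Suc c)
  have "definable (\<lambda>w e. (if F w e < c then h (F w e) else 0) + (if F w e = c then h c else 0))"
    by (intro def_intro Suc assms)
  moreover have "(if n < c then h n else 0) + (if n = c then h c else 0) = (if n < Suc c then h n else 0)"
    for n by auto
  ultimately show ?case by simp
qed (use def_const in simp)

lemma def_table2:
  assumes "definable F" "definable G"
  shows "definable (\<lambda>w e. if F w e < c \<and> G w e < d then h (F w e) (G w e) else 0)"
proof (induction c)
  case (Suc c)
  have "definable (\<lambda>w e. (if F w e < c \<and> G w e < d then h (F w e) (G w e) else 0) +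
      (if F w e = c then if G w e < d then h c (G w e) else 0 else 0))"
    by (intro def_intro Suc assms def_table)
  moreover have "(if n < c \<and> m < d then h n m else 0) + (if n = c then if m < d then h c m else 0 else 0) =
      (if n < Suc c \<and> m < d then h n m else 0)"
    for n m by auto
  ultimately show ?case by simp
qed (use def_const in simp)

theorem decider_of_definable:
  assumes "definable_pred (\<lambda>w e. P w)"
  shows "\<exists>M (q :: nat poly). turing_machine M \<and>
     (\<forall>w. set w \<subseteq> {1, 2, 3} \<longrightarrow>
        halts_within M w (poly q (length w)) \<and> (accepts M w \<longleftrightarrow> P w))"
proof -
  obtain x where x: "\<And>w e. eval x w e = (if P w then 1 else 0)"
    using assms unfolding definable_pred_def by (rule definableE) blast
  have "eval x w (\<lambda>_. 0) \<noteq> 0 \<longleftrightarrow> P w" for w by (simp add: x)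
  then show ?thesis using exp_decider[of x] by simp
qed

theorem computable_of_definable:
  assumes "definable (\<lambda>w e. l w)" "definable_pred (\<lambda>w e. P w (e 0))"
  shows "poly_time_computable (\<lambda>x. map (P (bits x)) [0..<l (bits x)])"
proof -
  obtain a where a: "\<And>w e. eval a w e = l w" using assms(1) by (rule definableE) blast
  obtain b where "\<And>w e. eval b w e = (if P w (e 0) then 1 else 0)"
    using assms(2) unfolding definable_pred_def by (rule definableE) blast
  with a have "(\<lambda>x. map (\<lambda>j. eval b (bits x) (case_nat j (\<lambda>_. 0)) \<noteq> 0) [0..<eval a (bits x) (\<lambda>_. 0)])
    = (\<lambda>x. map (P (bits x)) [0..<l (bits x)])" by auto
  then show ?thesis using exp_computable[of b a] by simp
qed

section \<open>Membership in NP\<close>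

lemma concat_map_upt:
  "concat (map (\<lambda>i. map (g i) [0..<n]) [0..<m]) = map (\<lambda>k. g (k div n) (k mod n)) [0..<m * n]"
proof (induction m)
  case (Suc m)
  have "[0..<Suc m * n] = [0..<m * n] @ map (\<lambda>j. j + m * n) [0..<n]"
    by (simp add: upt_add_eq_append[of 0 "m * n" n, simplified] map_add_upt add.commute[of n])
  then show ?case using Suc by simp
qed simp

lemma adjacency_code_eq:
  "adjacency_code n E = map (\<lambda>k. {k div n, k mod n} \<in> E) [0..<n * n]"
  unfolding adjacency_code_def by (rule concat_map_upt)

lemma pair_index_less: "i < n \<Longrightarrow> j < n \<Longrightarrow> i * n + j < n * (n :: nat)"
  using mult_le_mono1[of "Suc i" n n] by simp

lemma adjacency_code_nth:
  "i < n \<Longrightarrow> j < n \<Longrightarrow> adjacency_code n E ! (i * n + j) \<longleftrightarrow> {i, j} \<in> E"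
  by (simp add: adjacency_code_eq pair_index_less)

lemma max_degree_eq_iff:
  assumes "finite V" "0 < d"
  shows "max_degree V E = d \<longleftrightarrow>
    (\<forall>v\<in>V. card (neighbors E v) \<le> d) \<and> (\<exists>v\<in>V. card (neighbors E v) = d)"
  using assms unfolding max_degree_def by (subst Max_eq_iff) auto

lemma bipartite_iff:
  assumes "simple_graph V E"
  shows "bipartite V E \<longleftrightarrow> (\<exists>S. \<forall>i j. {i, j} \<in> E \<longrightarrow> S i \<noteq> (S j :: bool))"
proof
  assume "bipartite V E"
  then obtain A B where "A \<inter> B = {}" and e: "\<forall>e\<in>E. \<exists>a\<in>A. \<exists>b\<in>B. e = {a, b}"
    unfolding bipartite_def by blast
  then have "(i \<in> A) \<noteq> (j \<in> A)" if "{i, j} \<in> E" for i j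
    using bspec[OF e that] by (auto simp: doubleton_eq_iff)
  then show "\<exists>S. \<forall>i j. {i, j} \<in> E \<longrightarrow> S i \<noteq> (S j :: bool)"
    by (intro exI[of _ "\<lambda>i. i \<in> A"]) blast
next
  assume "\<exists>S. \<forall>i j. {i, j} \<in> E \<longrightarrow> S i \<noteq> (S j :: bool)"
  then obtain S where S: "\<And>i j. {i, j} \<in> E \<Longrightarrow> S i \<noteq> (S j :: bool)" by blast
  have "\<exists>a\<in>{v\<in>V. S v}. \<exists>b\<in>{v\<in>V. \<not> S v}. e = {a, b}" if "e \<in> E" for e
  proof -
    have "card e = 2" "e \<subseteq> V" using assms that unfolding simple_graph_def by blast+
    then obtain a b where e: "e = {a, b}" "a \<in> V" "b \<in> V" unfolding card_2_iff by blast
    show ?thesis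
    proof (cases "S a")
      case True
      then show ?thesis using S[of a b] e that by (intro bexI[of _ a] bexI[of _ b]) auto
    next
      case False
      then show ?thesis using S[of a b] e that
        by (intro bexI[of _ b] bexI[of _ a]) (auto simp: insert_commute)
    qed
  qed
  then show "bipartite V E" unfolding bipartite_def
    by (intro exI[of _ "{v\<in>V. S v}"] exI[of _ "{v\<in>V. \<not> S v}"]) auto
qed

lemma neighbors_eq:
  "simple_graph {..<n} E \<Longrightarrow> neighbors E i = {j. j < n \<and> {i, j} \<in> E}"
  unfolding simple_graph_def neighbors_def by auto

text \<open>
  The certificate of a graph with \<open>n\<close> vertices consists of \<open>n\<close> bits for the 2-partition
  followed by \<open>n\<close> bits for the bipartition.
\<close>

definition checks :: "nat list \<Rightarrow> nat \<Rightarrow> bool" where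
  "checks w n \<longleftrightarrow>
     (\<forall>i<n. \<forall>j<n. letter w (i * n + j) = 2 \<longrightarrow>
        (letter w (n * n + 1 + n + i) = 2) \<noteq> (letter w (n * n + 1 + n + j) = 2)) \<and>
     (\<forall>i<n. card {j. j < n \<and> letter w (i * n + j) = 2} \<le> 3) \<and>
     (\<exists>i<n. card {j. j < n \<and> letter w (i * n + j) = 2} = 3) \<and>
     (\<forall>i<n.
        card {j. j < n \<and> (letter w (i * n + j) = 2 \<or> j = i) \<and> letter w (n * n + 1 + j) \<noteq> 2} \<le>
        card {j. j < n \<and> (letter w (i * n + j) = 2 \<or> j = i) \<and> letter w (n * n + 1 + j) = 2} + 1 \<and>
        card {j. j < n \<and> (letter w (i * n + j) = 2 \<or> j = i) \<and> letter w (n * n + 1 + j) = 2} \<le>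
        card {j. j < n \<and> (letter w (i * n + j) = 2 \<or> j = i) \<and> letter w (n * n + 1 + j) \<noteq> 2} + 1)"

text \<open>The code does not contain the number of vertices; it is recovered from the position
  \<open>n * n\<close> of the separator. Symmetry and an empty diagonal make the matrix the code of
  a simple graph. Certificate letters are only compared with 2, so a certificate that is too short
  is read as if filled up with false bits.\<close>

definition verifies :: "nat list \<Rightarrow> bool" where
  "verifies w \<longleftrightarrow> (\<exists>n<Suc (length w). letter w (n * n) = 3 \<and>
     (\<forall>i<n. \<forall>j<n. (letter w (i * n + j) = 2) = (letter w (j * n + i) = 2)) \<and>
     (\<forall>i<n. letter w (i * n + i) \<noteq> 2) \<and> checks w n)"

lemma def_verifies: "definable_pred (\<lambda>w e. verifies w)"
  unfolding verifies_def checks_def by (intro def_intro)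

lemma checks_iff:
  assumes g: "simple_graph {..<n} E"
    and w: "\<And>i j. i < n \<Longrightarrow> j < n \<Longrightarrow> letter w (i * n + j) = 2 \<longleftrightarrow> {i, j} \<in> E"
  shows "checks w n \<longleftrightarrow>
    (\<forall>i j. {i, j} \<in> E \<longrightarrow> (letter w (n * n + 1 + n + i) = 2) \<noteq> (letter w (n * n + 1 + n + j) = 2)) \<and>
    max_degree {..<n} E = 3 \<and>
    locally_balanced_closed {..<n} E (\<lambda>i. of_bool (letter w (n * n + 1 + i) = 2))"
proof -
  have lt: "i < n \<and> j < n" if "{i, j} \<in> E" for i j
    using g that unfolding simple_graph_def by auto
  have 1: "(\<forall>i<n. \<forall>j<n. letter w (i * n + j) = 2 \<longrightarrow> S i \<noteq> S j) \<longleftrightarrow>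
      (\<forall>i j. {i, j} \<in> E \<longrightarrow> S i \<noteq> S j)" for S :: "nat \<Rightarrow> bool"
    using w lt by blast
  have 2: "{j. j < n \<and> letter w (i * n + j) = 2} = neighbors E i" if "i < n" for i
    using w that neighbors_eq[OF g] by auto
  have 3: "{j. j < n \<and> (letter w (i * n + j) = 2 \<or> j = i) \<and> Q j} = {j \<in> closed_neighbors E i. Q j}"
    if "i < n" for i and Q :: "nat \<Rightarrow> bool"
    using w that neighbors_eq[OF g] unfolding closed_neighbors_def by auto
  have 4: "max_degree {..<n} E = 3 \<longleftrightarrow>
     (\<forall>i<n. card (neighbors E i) \<le> 3) \<and> (\<exists>i<n. card (neighbors E i) = 3)"
    by (subst max_degree_eq_iff) auto
  have 5: "\<bar>int a - int b\<bar> \<le> 1 \<longleftrightarrow> a \<le> b + 1 \<and> b \<le> a + 1" for a b by auto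
  have 6: "{u \<in> C. of_bool (Q u) = (0 :: nat)} = {u \<in> C. \<not> Q u}"
    "{u \<in> C. of_bool (Q u) = (1 :: nat)} = {u \<in> C. Q u}" for C and Q :: "nat \<Rightarrow> bool"
    by auto
  show ?thesis
    unfolding checks_def locally_balanced_closed_def 4 5 6 1[symmetric]
    by (simp add: 2 3 Ball_def cong: conj_cong)
qed

lemma letter_pair_word:
  "k < length x \<Longrightarrow> letter (pair_word x u) k = (if x ! k then 2 else 1)"
  "letter (pair_word x u) (length x) = 3"
  "k < length u \<Longrightarrow> letter (pair_word x u) (length x + 1 + k) = (if u ! k then 2 else 1)"
  by (auto simp: letter_def pair_word_def bits_def nth_append)

lemma letter_pair_word_eq_3: "letter (pair_word x u) k = 3 \<Longrightarrow> k = length x"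
  by (auto simp: letter_def pair_word_def bits_def nth_append nth_Cons' split: if_splits)

abbreviation LB_instance :: "nat set \<Rightarrow> nat set set \<Rightarrow> bool" where
  "LB_instance V E \<equiv> bipartite V E \<and> max_degree V E = 3"

abbreviation LB_question :: "nat set \<Rightarrow> nat set set \<Rightarrow> bool" where
  "LB_question V E \<equiv> \<exists>f. two_partition V f \<and> locally_balanced_closed V E f"

lemma locally_balanced_closed_cong:
  assumes "simple_graph {..<n} E" "\<And>i. i < n \<Longrightarrow> f i = g i"
  shows "locally_balanced_closed {..<n} E f \<longleftrightarrow> locally_balanced_closed {..<n} E g"
proof -
  have "{u \<in> closed_neighbors E v. f u = c} = {u \<in> closed_neighbors E v. g u = c}" if "v < n" for v c
    using assms that neighbors_eq[OF assms(1)] unfolding closed_neighbors_def by auto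
  then show ?thesis unfolding locally_balanced_closed_def by simp
qed

text \<open>The \<open>2 * n\<close> bits of the certificate are at most twice the length
  \<open>n * n\<close> of the code, which explains \<open>[:0, 2:]\<close>.\<close>

lemma verifies_iff:
  "x \<in> decision_language LB_instance LB_question \<longleftrightarrow>
   (\<exists>u. length u \<le> poly [:0, 2:] (length x) \<and> verifies (pair_word x u))"
proof
  assume "x \<in> decision_language LB_instance LB_question"
  then obtain n E f where x: "x = adjacency_code n E" and g: "simple_graph {..<n} E"
    and b: "bipartite {..<n} E" and d: "max_degree {..<n} E = 3"
    and f: "two_partition {..<n} f" "locally_balanced_closed {..<n} E f"
    unfolding decision_language_def by blast
  obtain S :: "nat \<Rightarrow> bool" where S: "\<And>i j. {i, j} \<in> E \<Longrightarrow> S i \<noteq> S j"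
    using b unfolding bipartite_iff[OF g] by blast
  define u where "u = map (\<lambda>i. f i = 1) [0..<n] @ map S [0..<n]"
  define w where "w = pair_word x u"
  have lx: "length x = n * n" by (simp add: x length_adjacency_code)
  have A: "letter w (i * n + j) = 2 \<longleftrightarrow> {i, j} \<in> E" if "i < n" "j < n" for i j
    using that pair_index_less[OF that] letter_pair_word(1)[of "i * n + j" x u]
    by (simp add: w_def x length_adjacency_code adjacency_code_nth)
  have Fw: "letter w (n * n + 1 + i) = 2 \<longleftrightarrow> f i = 1" if "i < n" for i
    using that letter_pair_word(3)[of i u x] by (simp add: w_def lx u_def nth_append)
  have Sw: "letter w (n * n + 1 + n + i) = 2 \<longleftrightarrow> S i" if "i < n" for i
    using that letter_pair_word(3)[of "n + i" u x] by (simp add: w_def lx u_def nth_append add.assoc)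
  have lt: "i < n \<and> j < n" if "{i, j} \<in> E" for i j
    using g that unfolding simple_graph_def by auto
  have "f i = of_bool (letter w (n * n + 1 + i) = 2)" if "i < n" for i
    using Fw[OF that] f(1) that unfolding two_partition_def by auto
  then have "locally_balanced_closed {..<n} E (\<lambda>i. of_bool (letter w (n * n + 1 + i) = 2))"
    using f(2) locally_balanced_closed_cong[OF g, of f "\<lambda>i. of_bool (letter w (n * n + 1 + i) = 2)"]
    by simp
  moreover have "(letter w (n * n + 1 + n + i) = 2) \<noteq> (letter w (n * n + 1 + n + j) = 2)"
    if "{i, j} \<in> E" for i j
    using S[OF that] Sw lt[OF that] by simp
  ultimately have checks: "checks w n"
    using d A by (subst checks_iff[OF g]) blast+
  have no_loop: "{i} \<notin> E" for i
  proof
    assume "{i} \<in> E"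
    then have "card {i} = 2" using g unfolding simple_graph_def by blast
    then show False by simp
  qed
  have "length w = n * n + 1 + length u" by (simp add: w_def pair_word_def bits_def lx)
  then have "n < Suc (length w)" using le_square[of n] by linarith
  moreover have "letter w (n * n) = 3" using letter_pair_word(2)[of x u] by (simp add: w_def lx)
  moreover have "letter w (i * n + i) \<noteq> 2" if "i < n" for i
    using A[OF that that] no_loop by simp
  moreover have "(letter w (i * n + j) = 2) = (letter w (j * n + i) = 2)" if "i < n" "j < n" for i j
    using A[OF that] A[OF that(2,1)] by (simp add: insert_commute)
  ultimately have "verifies w" using checks unfolding verifies_def by (intro exI[of _ n] conjI allI impI)
  moreover have "length u \<le> poly [:0, 2:] (length x)"
  proof -
    have "length u = n + n" "poly [:0, 2:] (length x) = 2 * (n * n)" by (simp_all add: u_def lx)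
    then show ?thesis using le_square[of n] by linarith
  qed
  ultimately show "\<exists>u. length u \<le> poly [:0, 2:] (length x) \<and> verifies (pair_word x u)"
    unfolding w_def by blast
next
  assume "\<exists>u. length u \<le> poly [:0, 2:] (length x) \<and> verifies (pair_word x u)"
  then obtain u n where l3: "letter (pair_word x u) (n * n) = 3"
    and sym: "\<forall>i<n. \<forall>j<n. (letter (pair_word x u) (i * n + j) = 2) = (letter (pair_word x u) (j * n + i) = 2)"
    and irr: "\<forall>i<n. letter (pair_word x u) (i * n + i) \<noteq> 2" and chk: "checks (pair_word x u) n"
    unfolding verifies_def by blast
  have lx: "length x = n * n" using letter_pair_word_eq_3[OF l3] by simp
  define E where "E = {{i, j} | i j. i < n \<and> j < n \<and> x ! (i * n + j)}"
  have A: "letter (pair_word x u) (i * n + j) = 2 \<longleftrightarrow> x ! (i * n + j)" if "i < n" "j < n" for i j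
    using that pair_index_less[OF that] letter_pair_word(1)[of "i * n + j" x u] by (simp add: lx)
  have E: "{i, j} \<in> E \<longleftrightarrow> x ! (i * n + j)" if "i < n" "j < n" for i j
  proof
    assume "{i, j} \<in> E"
    then have "x ! (i * n + j) \<or> x ! (j * n + i)" by (auto simp: E_def doubleton_eq_iff)
    then show "x ! (i * n + j)" using sym A that by blast
  qed (use that in \<open>auto simp: E_def\<close>)
  have g: "simple_graph {..<n} E"
    unfolding simple_graph_def
  proof (intro conjI ballI)
    fix e assume "e \<in> E"
    then obtain i j where e: "e = {i, j}" "i < n" "j < n" "x ! (i * n + j)" unfolding E_def by blast
    have "i \<noteq> j"
    proof
      assume "i = j"
      then show False using irr A[OF e(2,2)] e by simp
    qed
    then show "e \<subseteq> {..<n}" "card e = 2" using e by auto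
  qed simp
  have "x = adjacency_code n E"
  proof (rule nth_equalityI)
    fix k assume "k < length x"
    then have k: "k < n * n" by (simp add: lx)
    then have "0 < n" by (cases n) auto
    note k this
    then have "k div n < n" "k mod n < n" by (simp_all add: less_mult_imp_div_less)
    then show "x ! k \<longleftrightarrow> adjacency_code n E ! k"
      using adjacency_code_nth[of "k div n" n "k mod n" E] E[of "k div n" "k mod n"] by simp
  qed (simp add: lx length_adjacency_code)
  moreover have *: "(\<forall>i j. {i, j} \<in> E \<longrightarrow>
        (letter (pair_word x u) (n * n + 1 + n + i) = 2) \<noteq> (letter (pair_word x u) (n * n + 1 + n + j) = 2)) \<and>
      max_degree {..<n} E = 3 \<and>
      locally_balanced_closed {..<n} E (\<lambda>i. of_bool (letter (pair_word x u) (n * n + 1 + i) = 2))"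
    by (rule iffD1[OF checks_iff[OF g] chk]) (use A E in simp)
  have "bipartite {..<n} E"
    unfolding bipartite_iff[OF g]
    by (rule exI[of _ "\<lambda>i. letter (pair_word x u) (n * n + 1 + n + i) = 2"]) (rule conjunct1[OF *])
  moreover have "LB_question {..<n} E"
    by (rule exI[of _ "\<lambda>i. of_bool (letter (pair_word x u) (n * n + 1 + i) = 2)"])
      (use * in \<open>simp add: two_partition_def\<close>)
  ultimately show "x \<in> decision_language LB_instance LB_question"
    unfolding decision_language_def using g * by (intro CollectI exI[of _ n] exI[of _ E]) simp
qed

lemma LB_in_NP: "decision_language LB_instance LB_question \<in> NP"
proof -
  obtain M and q :: "nat poly" where M: "turing_machine M"
    "\<And>w. set w \<subseteq> {1, 2, 3} \<Longrightarrow> halts_within M w (poly q (length w)) \<and> (accepts M w \<longleftrightarrow> verifies w)"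
    using decider_of_definable[OF def_verifies] by blast
  have "set (pair_word x u) \<subseteq> {1, 2, 3}" for x u by (auto simp: pair_word_def bits_def)
  from M(2)[OF this] show ?thesis
    unfolding NP_def using M(1) verifies_iff
    by (intro CollectI exI[of _ M] exI[of _ "[:0, 2:]"] exI[of _ q]) simp
qed

section \<open>From clause matrices to graphs\<close>

definition lit_true :: "(nat \<Rightarrow> bool) \<Rightarrow> nat \<Rightarrow> bool" where
  "lit_true a l \<longleftrightarrow> a (l div 2) = even l"

text \<open>\<open>P j l\<close> says that literal \<open>l\<close> occurs in clause
  \<open>j\<close>, where the literals of variable \<open>v\<close> are \<open>2 * v\<close> and its
  negation \<open>2 * v + 1\<close>.\<close>

definition satisfiable :: "nat \<Rightarrow> nat \<Rightarrow> (nat \<Rightarrow> nat \<Rightarrow> bool) \<Rightarrow> bool" where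
  "satisfiable V m P \<longleftrightarrow> (\<exists>a. \<forall>j<m. \<exists>l<2 * V. P j l \<and> lit_true a l)"

text \<open>
  A clause with literals \<open>L\<^sub>0, \<dots>, L\<^sub>n\<close> becomes the not-all-equal constraints on
  \<open>\<not> y\<^sub>l, L\<^sub>l, y\<^sub>l\<^sub>+\<^sub>1\<close>, where \<open>y\<^sub>l\<close> says that no literal before \<open>L\<^sub>l\<close> is true.
  Variable 0 stands for falsity, the variables up to \<open>V\<close> for those of the matrix.
\<close>

definition slot_var :: "nat \<Rightarrow> (nat \<Rightarrow> nat \<Rightarrow> bool) \<Rightarrow> nat \<Rightarrow> nat \<Rightarrow> nat" where
  "slot_var V P c k =
     (if k = 0 then if c mod (2 * V) = 0 then 0 else 1 + V + c
      else if k = 1 then if P (c div (2 * V)) (c mod (2 * V)) then 1 + c mod (2 * V) div 2 else 0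
      else if Suc c mod (2 * V) = 0 then 0 else 1 + V + Suc c)"

definition slot_neg :: "nat \<Rightarrow> (nat \<Rightarrow> nat \<Rightarrow> bool) \<Rightarrow> nat \<Rightarrow> nat \<Rightarrow> nat" where
  "slot_neg V P c k =
     (if k = 0 then if c mod (2 * V) = 0 then 0 else 1
      else if k = 1 then if P (c div (2 * V)) (c mod (2 * V)) then c mod (2 * V) mod 2 else 0
      else 0)"

definition slot_true :: "nat \<Rightarrow> (nat \<Rightarrow> nat \<Rightarrow> bool) \<Rightarrow> (nat \<Rightarrow> bool) \<Rightarrow> nat \<Rightarrow> nat \<Rightarrow> bool" where
  "slot_true V P X c k \<longleftrightarrow> X (slot_var V P c k) = (slot_neg V P c k = 0)"

definition nae :: "(nat \<Rightarrow> bool) \<Rightarrow> bool" where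
  "nae b \<longleftrightarrow> \<not> (b 0 = b 1 \<and> b 1 = b 2)"

text \<open>With \<open>none\<close> as the value of \<open>y\<close>,
  \<open>y\<^sub>l\<^sub>+\<^sub>1\<close> is the conjunction of \<open>y\<^sub>l\<close> and
  \<open>\<not> L\<^sub>l\<close>. The three slots are not all true because
  \<open>y\<^sub>l\<^sub>+\<^sub>1\<close> implies \<open>y\<^sub>l\<close>, and not all false
  because \<open>y\<^sub>l\<close> and \<open>\<not> L\<^sub>l\<close> imply
  \<open>y\<^sub>l\<^sub>+\<^sub>1\<close>. At the last literal, where falsity replaces
  \<open>y\<^sub>l\<^sub>+\<^sub>1\<close>, a true literal of the clause has been met.\<close>

lemma nae_if_satisfiable:
  assumes "0 < V" "satisfiable V m P"
  shows "\<exists>X. \<forall>c<m * (2 * V). nae (slot_true V P X c)"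
proof -
  define W where "W = 2 * V"
  obtain a where a: "\<And>j. j < m \<Longrightarrow> \<exists>l<W. P j l \<and> lit_true a l"
    using assms(2) unfolding satisfiable_def W_def by blast
  define none where "none c \<longleftrightarrow> (\<forall>l<c mod W. \<not> (P (c div W) l \<and> lit_true a l))" for c
  define X where "X v \<longleftrightarrow> (if v = 0 then False else if v \<le> V then a (v - 1) else none (v - V - 1))" for v
  have W: "0 < W" "W div 2 = V" using assms(1) by (auto simp: W_def)
  have "nae (slot_true V P X c)" if c: "c < m * W" for c
  proof -
    have j: "c div W < m" using c W by (simp add: less_mult_imp_div_less)
    have l: "c mod W < W" using W by simp
    then have lV: "c mod W div 2 < V" by (simp add: W_def less_mult_imp_div_less mult.commute)
    have 0: "slot_true V P X c 0 \<longleftrightarrow> c mod W \<noteq> 0 \<and> \<not> none c"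
      by (simp add: slot_true_def slot_var_def slot_neg_def X_def W_def)
    have 1: "slot_true V P X c 1 \<longleftrightarrow> P (c div W) (c mod W) \<and> lit_true a (c mod W)"
      using lV by (auto simp: slot_true_def slot_var_def slot_neg_def X_def W_def lit_true_def
          even_iff_mod_2_eq_zero)
    have 2: "slot_true V P X c 2 \<longleftrightarrow> Suc c mod W \<noteq> 0 \<and> none (Suc c)"
      by (simp add: slot_true_def slot_var_def slot_neg_def X_def W_def)
    show ?thesis
    proof (cases "Suc (c mod W) = W")
      case True
      then have "Suc c mod W = 0" by (simp add: mod_Suc)
      moreover have "\<not> none c \<or> P (c div W) (c mod W) \<and> lit_true a (c mod W)"
        using a[OF j] True unfolding none_def by (metis less_antisym)
      moreover have "c mod W = 0 \<Longrightarrow> none c" by (simp add: none_def)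
      ultimately show ?thesis unfolding nae_def 0 1 2 by blast
    next
      case False
      then have s: "Suc c mod W = Suc (c mod W)" "Suc c div W = c div W"
        by (simp_all add: mod_Suc div_Suc)
      have "none (Suc c) \<longleftrightarrow> none c \<and> \<not> (P (c div W) (c mod W) \<and> lit_true a (c mod W))"
        unfolding none_def s by (auto simp: less_Suc_eq)
      moreover have "c mod W = 0 \<Longrightarrow> none c" by (simp add: none_def)
      ultimately show ?thesis unfolding nae_def 0 1 2 s by auto
    qed
  qed
  then show ?thesis unfolding W_def by blast
qed

text \<open>The constraints cannot tell \<open>X\<close> from its complement, so \<open>X 0\<close>
  may be true, and variables are read relative to it. In a clause without a true literal, slot 1
  would always have the value \<open>X 0\<close>; the constraints would then pass the opposite of
  \<open>X 0\<close> through all the \<open>y\<close>, and in the last constraint all three slots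
  would agree.\<close>

lemma satisfiable_if_nae:
  assumes "0 < V" "\<And>c. c < m * (2 * V) \<Longrightarrow> nae (slot_true V P X c)"
  shows "satisfiable V m P"
proof -
  define W where "W = 2 * V"
  define a where "a v \<longleftrightarrow> X (Suc v) \<noteq> X 0" for v
  have W: "0 < W" using assms(1) by (simp add: W_def)
  have "\<exists>l<W. P j l \<and> lit_true a l" if j: "j < m" for j
  proof (rule ccontr)
    assume no: "\<not> ?thesis"
    have c: "(j * W + l) mod W = l" "(j * W + l) div W = j" "j * W + l < m * W" if "l < W" for l
    proof -
      have "j * W + l < Suc j * W" using that by simp
      also have "\<dots> \<le> m * W" using j by (intro mult_le_mono1) simp
      finally show "j * W + l < m * W" .
    qed (use that in auto)
    have 1: "slot_true V P X (j * W + l) 1 = X 0" if "l < W" for l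
    proof -
      have "\<not> (P j l \<and> lit_true a l)" using no that by blast
      then show ?thesis using c[OF that]
        by (auto simp: slot_true_def slot_var_def slot_neg_def W_def[symmetric] lit_true_def a_def
            even_iff_mod_2_eq_zero)
    qed
    have 0: "slot_true V P X (j * W + l) 0 = (if l = 0 then X 0 else \<not> X (1 + V + (j * W + l)))"
      if "l < W" for l
      using c[OF that] by (simp add: slot_true_def slot_var_def slot_neg_def W_def[symmetric])
    have 2: "slot_true V P X (j * W + l) 2 = (if Suc l = W then X 0 else X (1 + V + (j * W + Suc l)))"
      if "l < W" for l
    proof -
      have "Suc (j * W + l) mod W = (if Suc l = W then 0 else Suc l)"
        using c[OF that] by (simp add: mod_Suc)
      then show ?thesis by (simp add: slot_true_def slot_var_def slot_neg_def W_def[symmetric])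
    qed
    have nae: "nae (slot_true V P X (j * W + l))" if "l < W" for l
      using assms(2) c(3)[OF that] by (simp add: W_def)
    have "X (1 + V + (j * W + l)) \<noteq> X 0" if "l < W" "0 < l" for l
      using that
    proof (induction l)
      case (Suc l)
      then show ?case using nae[of l] 0[of l] 1[of l] 2[of l] by (cases "l = 0") (auto simp: nae_def)
    qed simp
    moreover obtain L where "W = Suc L" using W by (cases W) auto
    ultimately show False
      using nae[of L] 0[of L] 1[of L] 2[of L] by (cases "L = 0") (auto simp: nae_def)
  qed
  then show ?thesis unfolding satisfiable_def W_def by blast
qed

section \<open>The graph of the constraints\<close>

definition vertex :: "nat \<Rightarrow> nat \<Rightarrow> nat" where
  "vertex g t = 16 * g + t"

text \<open>There are \<open>m * (2 * V)\<close> constraints with three slots each, and every slot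
  owns two neighboring positions in each row, one of either parity.\<close>

definition copies :: "nat \<Rightarrow> nat \<Rightarrow> nat" where
  "copies V m = 6 * (m * (2 * V))"

definition gadgets :: "nat \<Rightarrow> nat \<Rightarrow> nat" where
  "gadgets V m = (2 + V + m * (2 * V)) * copies V m"

text \<open>The row is that of the variable in slot \<open>k\<close> of constraint \<open>c\<close>.
  Of the two positions owned by the slot the even one is taken for a positive and the odd one for a
  negated literal, as values alternate along the row. Distinct slots own distinct positions, so no
  gadget serves two of them.\<close>

definition port :: "nat \<Rightarrow> nat \<Rightarrow> (nat \<Rightarrow> nat \<Rightarrow> bool) \<Rightarrow> nat \<Rightarrow> nat \<Rightarrow> nat" where
  "port V m P c k = slot_var V P c k * copies V m + (2 * (3 * c + k) + slot_neg V P c k)"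

text \<open>
  The variable \<open>v\<close> has a row of \<open>copies V m\<close> gadgets, whose values alternate. Every gadget consists
  of vertices 0 to 10; in a locally balanced partition, vertices 2, 3, 4, 5 carry its value and
  vertices 0, 1, 8 the opposite one. Vertex 11 with its leaf 12 joins vertex 3 to vertex 2 of the
  next gadget and makes them differ. Vertex 13 of gadget \<open>c\<close> belongs to the constraint \<open>c\<close>: it is
  joined to vertex 4 of three gadgets, which must not have the same value.
\<close>

definition arc :: "nat \<Rightarrow> nat \<Rightarrow> (nat \<Rightarrow> nat \<Rightarrow> bool) \<Rightarrow> nat \<Rightarrow> nat \<Rightarrow> bool" where
  "arc V m P u v \<longleftrightarrow> (\<exists>g<gadgets V m.
     u = vertex g 0 \<and> v = vertex g 1 \<or>
     u = vertex g 0 \<and> v = vertex g 2 \<or>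
     u = vertex g 0 \<and> v = vertex g 3 \<or>
     u = vertex g 1 \<and> v = vertex g 4 \<or>
     u = vertex g 1 \<and> v = vertex g 5 \<or>
     u = vertex g 4 \<and> v = vertex g 6 \<or>
     u = vertex g 5 \<and> v = vertex g 7 \<or>
     u = vertex g 6 \<and> v = vertex g 8 \<or>
     u = vertex g 7 \<and> v = vertex g 8 \<or>
     u = vertex g 6 \<and> v = vertex g 9 \<or>
     u = vertex g 7 \<and> v = vertex g 10 \<or>
     u = vertex g 3 \<and> v = vertex g 11 \<or>
     u = vertex g 11 \<and> v = vertex g 12 \<or>
     Suc g mod copies V m \<noteq> 0 \<and> u = vertex g 11 \<and> v = vertex (Suc g) 2 \<or>
     g < m * (2 * V) \<and> (\<exists>k<3. u = vertex g 13 \<and> v = vertex (port V m P g k) 4))"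

definition graph :: "nat \<Rightarrow> nat \<Rightarrow> (nat \<Rightarrow> nat \<Rightarrow> bool) \<Rightarrow> nat set set" where
  "graph V m P = {{u, v} | u v. arc V m P u v}"

definition graph_size :: "nat \<Rightarrow> nat \<Rightarrow> nat" where
  "graph_size V m = 16 * gadgets V m"

lemma vertex_eq_iff: "s < 16 \<Longrightarrow> t < 16 \<Longrightarrow> vertex g s = vertex h t \<longleftrightarrow> g = h \<and> s = t"
  unfolding vertex_def by presburger

lemma vertex_mod: "t < 16 \<Longrightarrow> vertex g t mod 16 = t"
  by (simp add: vertex_def)

lemma vertex_less_iff: "t < 16 \<Longrightarrow> vertex g t < graph_size V m \<longleftrightarrow> g < gadgets V m"
proof -
  assume "t < 16"
  have "16 * g + t < 16 * n \<longleftrightarrow> g < n" if "t < 16" for n using that by linarith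
  then show ?thesis using \<open>t < 16\<close> unfolding vertex_def graph_size_def by blast
qed

lemma all_less_16:
  "(\<forall>t<16. Q t) \<longleftrightarrow> Q 15 \<and> Q 14 \<and> Q 13 \<and> Q 12 \<and> Q 11 \<and> Q 10 \<and> Q 9 \<and> Q 8 \<and> Q 7 \<and> Q 6 \<and>
     Q 5 \<and> Q 4 \<and> Q 3 \<and> Q 2 \<and> Q 1 \<and> Q (0 :: nat)"
proof -
  have "{..<16 :: nat} = {15, 14, 13, 12, 11, 10, 9, 8, 7, 6, 5, 4, 3, 2, 1, 0}"
    by (simp add: lessThan_nat_numeral lessThan_Suc)
  moreover have "(\<forall>t<16. Q t) \<longleftrightarrow> (\<forall>t\<in>{..<16}. Q t)" by (simp add: Ball_def)
  ultimately show ?thesis by (simp only: ball_simps) simp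
qed

lemma ex_less_3: "(\<exists>k<3. Q k) \<longleftrightarrow> Q 2 \<or> Q 1 \<or> Q (0 :: nat)"
proof -
  have "{..<3 :: nat} = {2, 1, 0}" by (simp add: lessThan_nat_numeral lessThan_Suc)
  moreover have "(\<exists>k<3. Q k) \<longleftrightarrow> (\<exists>k\<in>{..<3}. Q k)" by (simp add: Bex_def)
  ultimately show ?thesis by (simp only: bex_simps) simp
qed

lemma all_vertices:
  "(\<forall>u<graph_size V m. Q u) \<longleftrightarrow> (\<forall>g<gadgets V m. \<forall>t<16. Q (vertex g t))"
proof
  assume *: "\<forall>g<gadgets V m. \<forall>t<16. Q (vertex g t)"
  have "Q u" if "u < graph_size V m" for u
  proof -
    have "vertex (u div 16) (u mod 16) = u" "u div 16 < gadgets V m"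
      using that by (simp_all add: vertex_def graph_size_def less_mult_imp_div_less mult.commute)
    then show ?thesis using * by (metis mod_less_divisor zero_less_numeral)
  qed
  then show "\<forall>u<graph_size V m. Q u" by blast
qed (simp add: vertex_less_iff)

lemma graph_edge_iff: "{u, v} \<in> graph V m P \<longleftrightarrow> arc V m P u v \<or> arc V m P v u"
  unfolding graph_def by (auto simp: doubleton_eq_iff)

text \<open>With \<open>V = 0\<close> or \<open>m = 0\<close> there would be no gadget at all, and
  the maximum degree would not be 3.\<close>

locale clause_matrix =
  fixes V m :: nat and P :: "nat \<Rightarrow> nat \<Rightarrow> bool"
  assumes V_pos: "0 < V" and m_pos: "0 < m"
begin

abbreviation "C \<equiv> m * (2 * V)"
abbreviation "K \<equiv> copies V m"
abbreviation "G \<equiv> gadgets V m"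
abbreviation "E \<equiv> graph V m P"

lemma K_eq: "K = 6 * C" and K_pos: "0 < K" and C_pos: "0 < C"
  using V_pos m_pos by (auto simp: copies_def)

lemma C_le_G: "C \<le> G"
proof -
  have "C \<le> K" by (simp add: K_eq)
  also have "\<dots> \<le> G" unfolding gadgets_def by simp
  finally show ?thesis .
qed

lemma slot_neg_less: "slot_neg V P c k < 2"
  by (simp add: slot_neg_def)

lemma port_digit:
  assumes "c < C" "k < 3"
  shows "2 * (3 * c + k) + slot_neg V P c k < K"
proof -
  have "2 * (3 * c + k) + s < 6 * N" if "c < N" "s < 2" for N s :: nat
  proof -
    have "c + 1 \<le> N" "s \<le> 1" "k \<le> 2" using that assms(2) by auto
    then have "6 * c + 6 \<le> 6 * N" "2 * k + s \<le> 5" by simp_all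
    then show ?thesis by simp
  qed
  then show ?thesis using assms(1) slot_neg_less unfolding K_eq by blast
qed

lemma port_div_mod:
  assumes "c < C" "k < 3"
  shows "port V m P c k div K = slot_var V P c k"
    "port V m P c k mod K = 2 * (3 * c + k) + slot_neg V P c k"
  using port_digit[OF assms] unfolding port_def by simp_all

lemma port_decode:
  assumes "c < C" "k < 3"
  shows "port V m P c k mod K div 6 = c" "port V m P c k mod K div 2 mod 3 = k"
proof -
  have "(2 * (3 * c + k) + s) div 6 = c \<and> (2 * (3 * c + k) + s) div 2 mod 3 = k" if "s < 2" for s
  proof -
    have "k = 0 \<or> k = 1 \<or> k = 2" "s = 0 \<or> s = 1" using that assms(2) by auto
    then show ?thesis by (elim disjE) (simp; presburger)+
  qed
  then show "port V m P c k mod K div 6 = c" "port V m P c k mod K div 2 mod 3 = k"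
    using slot_neg_less unfolding port_div_mod[OF assms] by blast+
qed

lemma port_inj:
  "c < C \<Longrightarrow> k < 3 \<Longrightarrow> c' < C \<Longrightarrow> k' < 3 \<Longrightarrow> port V m P c k = port V m P c' k' \<longleftrightarrow> c = c' \<and> k = k'"
  by (metis port_decode)

lemma port_less:
  assumes "c < C" "k < 3"
  shows "port V m P c k < G"
proof -
  have "c mod (2 * V) < 2 * V" using V_pos by simp
  then have "c mod (2 * V) div 2 < V" by (simp add: less_mult_imp_div_less mult.commute)
  then have "slot_var V P c k < 2 + V + C"
    using assms unfolding slot_var_def by (simp split: if_split)
  moreover have "port V m P c k < Suc (slot_var V P c k) * K"
    using port_digit[OF assms] by (simp add: port_def)
  ultimately show ?thesis unfolding gadgets_def
    by (meson Suc_leI less_le_trans mult_le_mono1)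
qed

lemma Suc_less_G: "g < G \<Longrightarrow> Suc g mod K \<noteq> 0 \<Longrightarrow> Suc g < G"
  by (rule Suc_lessI) (auto simp: gadgets_def)

lemma arc_less: "arc V m P u v \<Longrightarrow> u < graph_size V m \<and> v < graph_size V m"
  unfolding arc_def by (elim exE conjE disjE) (auto simp: vertex_less_iff Suc_less_G port_less)

text \<open>The color of a vertex depends only on its place in the gadget, so the same check covers
  the links along a row and the edges of the constraints.\<close>

lemma arc_bipartite:
  "arc V m P u v \<Longrightarrow> (u mod 16 \<in> {0, 4, 5, 8, 9, 10, 11}) \<noteq> (v mod 16 \<in> {0, 4, 5, 8, 9, 10, 11})"
  unfolding arc_def by (elim exE conjE disjE) (simp_all add: vertex_mod)

lemma simple_graph_E: "simple_graph {..<graph_size V m} E"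
  unfolding simple_graph_def
proof (intro conjI ballI)
  fix e assume "e \<in> E"
  then obtain u v where e: "e = {u, v}" and a: "arc V m P u v" unfolding graph_def by blast
  have "u \<noteq> v" using arc_bipartite[OF a] by blast
  then show "e \<subseteq> {..<graph_size V m}" "card e = 2" using e arc_less[OF a] by auto
qed simp

lemma bipartite_E: "bipartite {..<graph_size V m} E"
  unfolding bipartite_iff[OF simple_graph_E]
proof (intro exI allI impI)
  fix u v assume "{u, v} \<in> E"
  then show "(u mod 16 \<in> {0, 4, 5, 8, 9, 10, 11}) \<noteq> (v mod 16 \<in> {0, 4, 5, 8, 9, 10, 11})"
    unfolding graph_edge_iff
  proof
    assume "arc V m P v u"
    from arc_bipartite[OF this] show ?thesis by (rule not_sym)
  qed (rule arc_bipartite)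
qed

definition constraint_of :: "nat \<Rightarrow> nat set" where
  "constraint_of g = {vertex c 13 | c. c < C \<and> (\<exists>k<3. g = port V m P c k)}"

lemma neighbors_E:
  assumes "g < G"
  shows
    "neighbors E (vertex g 0) = {vertex g 1, vertex g 2, vertex g 3}"
    "neighbors E (vertex g 1) = {vertex g 0, vertex g 4, vertex g 5}"
    "neighbors E (vertex g 2) = {vertex g 0} \<union> (if g mod K = 0 then {} else {vertex (g - 1) 11})"
    "neighbors E (vertex g 3) = {vertex g 0, vertex g 11}"
    "neighbors E (vertex g 4) = {vertex g 1, vertex g 6} \<union> constraint_of g"
    "neighbors E (vertex g 5) = {vertex g 1, vertex g 7}"
    "neighbors E (vertex g 6) = {vertex g 4, vertex g 8, vertex g 9}"
    "neighbors E (vertex g 7) = {vertex g 5, vertex g 8, vertex g 10}"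
    "neighbors E (vertex g 8) = {vertex g 6, vertex g 7}"
    "neighbors E (vertex g 9) = {vertex g 6}"
    "neighbors E (vertex g 10) = {vertex g 7}"
    "neighbors E (vertex g 11) = {vertex g 3, vertex g 12} \<union>
       (if Suc g mod K = 0 then {} else {vertex (Suc g) 2})"
    "neighbors E (vertex g 12) = {vertex g 11}"
    "neighbors E (vertex g 13) = (if g < C then
       {vertex (port V m P g 0) 4, vertex (port V m P g 1) 4, vertex (port V m P g 2) 4} else {})"
    "neighbors E (vertex g 14) = {}"
    "neighbors E (vertex g 15) = {}"
proof -
  have pred: "0 < g mod K \<Longrightarrow> g - Suc 0 < G \<and> Suc (g - Suc 0) = g"
    using assms by (cases g) auto
  have "c < C \<Longrightarrow> c < G" for c using C_le_G by simp
  then show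
    "neighbors E (vertex g 0) = {vertex g 1, vertex g 2, vertex g 3}"
    "neighbors E (vertex g 1) = {vertex g 0, vertex g 4, vertex g 5}"
    "neighbors E (vertex g 2) = {vertex g 0} \<union> (if g mod K = 0 then {} else {vertex (g - 1) 11})"
    "neighbors E (vertex g 3) = {vertex g 0, vertex g 11}"
    "neighbors E (vertex g 4) = {vertex g 1, vertex g 6} \<union> constraint_of g"
    "neighbors E (vertex g 5) = {vertex g 1, vertex g 7}"
    "neighbors E (vertex g 6) = {vertex g 4, vertex g 8, vertex g 9}"
    "neighbors E (vertex g 7) = {vertex g 5, vertex g 8, vertex g 10}"
    "neighbors E (vertex g 8) = {vertex g 6, vertex g 7}"
    "neighbors E (vertex g 9) = {vertex g 6}"
    "neighbors E (vertex g 10) = {vertex g 7}"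
    "neighbors E (vertex g 11) = {vertex g 3, vertex g 12} \<union>
       (if Suc g mod K = 0 then {} else {vertex (Suc g) 2})"
    "neighbors E (vertex g 12) = {vertex g 11}"
    "neighbors E (vertex g 13) = (if g < C then
       {vertex (port V m P g 0) 4, vertex (port V m P g 1) 4, vertex (port V m P g 2) 4} else {})"
    "neighbors E (vertex g 14) = {}"
    "neighbors E (vertex g 15) = {}"
    unfolding neighbors_def graph_edge_iff arc_def constraint_of_def ex_less_3
    using assms pred by (auto simp: vertex_eq_iff)
qed

end

text \<open>For values 0 and 1 the difference of the two counts is the size minus twice the sum.
  Balance becomes a linear condition.\<close>

lemma balanced_iff_sum:
  assumes "finite S" "\<And>u. u \<in> S \<Longrightarrow> f u \<in> {0, 1 :: nat}"
  shows "\<bar>int (card {u \<in> S. f u = 0}) - int (card {u \<in> S. f u = 1})\<bar> \<le> 1 \<longleftrightarrow>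
    \<bar>int (card S) - 2 * int (\<Sum>u\<in>S. f u)\<bar> \<le> 1"
proof -
  have "(\<Sum>u\<in>S. f u) = (\<Sum>u\<in>S. if f u = 1 then 1 else 0)"
    using assms(2) by (intro sum.cong) auto
  then have 1: "card {u \<in> S. f u = 1} = (\<Sum>u\<in>S. f u)"
    using assms(1) by (simp add: sum.If_cases Int_def)
  have "S = {u \<in> S. f u = 0} \<union> {u \<in> S. f u = 1}" using assms(2) by auto
  then have "card S = card {u \<in> S. f u = 0} + card {u \<in> S. f u = 1}"
    using assms(1) by (metis (mono_tags, lifting) card_Un_disjoint disjoint_iff finite_Un mem_Collect_eq zero_neq_one)
  then show ?thesis unfolding 1 by auto
qed

context clause_matrix
begin

definition is_port :: "nat \<Rightarrow> bool" where
  "is_port g \<longleftrightarrow> (\<exists>c<C. \<exists>k<3. g = port V m P c k)"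

text \<open>The position within the row determines the constraint, so at most one constraint is
  attached to a gadget. This keeps vertex 4 at degree 3.\<close>

lemma constraint_of_eq:
  "constraint_of g = (if is_port g then {vertex (g mod K div 6) 13} else {})"
proof -
  have "vertex c 13 = vertex (g mod K div 6) 13" if "c < C" "k < 3" "g = port V m P c k" for c k
    using port_decode(1)[OF that(1,2)] that(3) by simp
  then have "constraint_of g \<subseteq> (if is_port g then {vertex (g mod K div 6) 13} else {})"
    unfolding constraint_of_def is_port_def by auto
  moreover have "vertex (g mod K div 6) 13 \<in> constraint_of g" if "is_port g"
    using that port_decode(1) unfolding constraint_of_def is_port_def by fastforce
  ultimately show ?thesis unfolding constraint_of_def is_port_def by (auto split: if_splits)
qed

lemma gadget_less: "g mod K div 6 < C"
proof -
  have "g mod K < 6 * C" using K_pos unfolding K_eq by (simp only: mod_less_divisor)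
  then show ?thesis by (simp add: less_mult_imp_div_less mult.commute)
qed

lemma G_pos: "0 < G"
  using C_pos C_le_G by linarith

lemma max_degree_E: "max_degree {..<graph_size V m} E = 3"
proof (subst max_degree_eq_iff; (intro conjI)?)
  have le: "card {a} \<le> 3" "card {a, b} \<le> 3" "card {a, b, c} \<le> 3" for a b c :: nat
    by (simp_all add: card_insert_if)
  have "\<forall>t<16. card (neighbors E (vertex g t)) \<le> 3" if "g < G" for g
    unfolding all_less_16 neighbors_E[OF that] constraint_of_eq
    by (intro conjI) (simp_all add: le split: if_split)
  then show "\<forall>v\<in>{..<graph_size V m}. card (neighbors E v) \<le> 3"
    using all_vertices[of V m "\<lambda>v. card (neighbors E v) \<le> 3"] by simp
  have "card (neighbors E (vertex 0 0)) = 3"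
    unfolding neighbors_E[OF G_pos] by (simp add: vertex_eq_iff)
  then show "\<exists>v\<in>{..<graph_size V m}. card (neighbors E v) = 3"
    using G_pos by (intro bexI[of _ "vertex 0 0"]) (simp_all add: vertex_less_iff)
qed simp_all

text \<open>One conjunct for each of the vertices 0 to 13: a closed neighborhood of size 4 must have
  the sum 2, one of size 3 the sum 1 or 2, and one of size 2 the sum 1.\<close>

definition balanced :: "(nat \<Rightarrow> nat \<Rightarrow> nat) \<Rightarrow> nat \<Rightarrow> bool" where
  "balanced F g \<longleftrightarrow>
     F g 0 + F g 1 + F g 2 + F g 3 = 2 \<and>
     F g 1 + F g 0 + F g 4 + F g 5 = 2 \<and>
     (if g mod K = 0 then F g 2 + F g 0 = 1 else F g 2 + F g 0 + F (g - 1) 11 \<in> {1, 2}) \<and>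
     F g 3 + F g 0 + F g 11 \<in> {1, 2} \<and>
     (if is_port g then F g 4 + F g 1 + F g 6 + F (g mod K div 6) 13 = 2
      else F g 4 + F g 1 + F g 6 \<in> {1, 2}) \<and>
     F g 5 + F g 1 + F g 7 \<in> {1, 2} \<and>
     F g 6 + F g 4 + F g 8 + F g 9 = 2 \<and>
     F g 7 + F g 5 + F g 8 + F g 10 = 2 \<and>
     F g 8 + F g 6 + F g 7 \<in> {1, 2} \<and>
     F g 9 + F g 6 = 1 \<and>
     F g 10 + F g 7 = 1 \<and>
     (if Suc g mod K = 0 then F g 11 + F g 3 + F g 12 \<in> {1, 2}
      else F g 11 + F g 3 + F g 12 + F (Suc g) 2 = 2) \<and>
     F g 12 + F g 11 = 1 \<and>
     (g < C \<longrightarrow> F g 13 + F (port V m P g 0) 4 + F (port V m P g 1) 4 + F (port V m P g 2) 4 = 2)"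

lemma locally_balanced_iff:
  assumes "two_partition {..<graph_size V m} f"
  shows "locally_balanced_closed {..<graph_size V m} E f \<longleftrightarrow>
    (\<forall>g<G. balanced (\<lambda>g t. f (vertex g t)) g)"
proof -
  have f: "f u \<in> {0, 1}" if "u < graph_size V m" for u
    using assms that unfolding two_partition_def by auto
  define bal where "bal u \<longleftrightarrow> \<bar>int (card (closed_neighbors E u)) - 2 * int (\<Sum>u\<in>closed_neighbors E u. f u)\<bar> \<le> 1" for u
  have "\<bar>int (card {u \<in> closed_neighbors E v. f u = 0}) - int (card {u \<in> closed_neighbors E v. f u = 1})\<bar> \<le> 1
      \<longleftrightarrow> bal v" if "v < graph_size V m" for v
    unfolding bal_def
  proof (rule balanced_iff_sum)
    show "finite (closed_neighbors E v)"
      unfolding closed_neighbors_def neighbors_eq[OF simple_graph_E] by simp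
    show "f u \<in> {0, 1}" if "u \<in> closed_neighbors E v" for u
      using that \<open>v < graph_size V m\<close> f
      unfolding closed_neighbors_def neighbors_eq[OF simple_graph_E] by auto
  qed
  then have "locally_balanced_closed {..<graph_size V m} E f \<longleftrightarrow> (\<forall>v<graph_size V m. bal v)"
    unfolding locally_balanced_closed_def by (simp add: Ball_def)
  also have "\<dots> \<longleftrightarrow> (\<forall>g<G. \<forall>t<16. bal (vertex g t))" by (rule all_vertices)
  also have "\<dots> \<longleftrightarrow> (\<forall>g<G. balanced (\<lambda>g t. f (vertex g t)) g)"
  proof -
    have "(\<forall>t<16. bal (vertex g t)) \<longleftrightarrow> balanced (\<lambda>g t. f (vertex g t)) g" if g: "g < G" for g
    proof -
      have four: "\<bar>4 - 2 * int s\<bar> \<le> 1 \<longleftrightarrow> s = 2" and three: "\<bar>3 - 2 * int s\<bar> \<le> 1 \<longleftrightarrow> s \<in> {1, 2}"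
        and two: "\<bar>2 - 2 * int s\<bar> \<le> 1 \<longleftrightarrow> s = 1" for s
        by auto
      note C = closed_neighbors_def neighbors_E[OF g] constraint_of_eq
      have ports: "port V m P g 0 \<noteq> port V m P g 1" "port V m P g 0 \<noteq> port V m P g 2"
        "port V m P g 1 \<noteq> port V m P g 2" if "g < C"
        using port_inj[OF that _ that] by simp_all
      have 0: "bal (vertex g 0) \<longleftrightarrow> f (vertex g 0) + f (vertex g 1) + f (vertex g 2) + f (vertex g 3) = 2"
        unfolding bal_def C four[symmetric] by (simp add: vertex_eq_iff add_ac)
      have 1: "bal (vertex g 1) \<longleftrightarrow> f (vertex g 1) + f (vertex g 0) + f (vertex g 4) + f (vertex g 5) = 2"
        unfolding bal_def C four[symmetric] by (simp add: vertex_eq_iff add_ac)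
      have 2: "bal (vertex g 2) \<longleftrightarrow> (if g mod K = 0 then f (vertex g 2) + f (vertex g 0) = 1
          else f (vertex g 2) + f (vertex g 0) + f (vertex (g - 1) 11) \<in> {1, 2})"
        unfolding bal_def C three[symmetric] two[symmetric] by (simp add: vertex_eq_iff add_ac)
      have 3: "bal (vertex g 3) \<longleftrightarrow> f (vertex g 3) + f (vertex g 0) + f (vertex g 11) \<in> {1, 2}"
        unfolding bal_def C three[symmetric] by (simp add: vertex_eq_iff add_ac)
      have 4: "bal (vertex g 4) \<longleftrightarrow> (if is_port g
          then f (vertex g 4) + f (vertex g 1) + f (vertex g 6) + f (vertex (g mod K div 6) 13) = 2
          else f (vertex g 4) + f (vertex g 1) + f (vertex g 6) \<in> {1, 2})"
        unfolding bal_def C three[symmetric] four[symmetric] by (simp add: vertex_eq_iff add_ac)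
      have 5: "bal (vertex g 5) \<longleftrightarrow> f (vertex g 5) + f (vertex g 1) + f (vertex g 7) \<in> {1, 2}"
        unfolding bal_def C three[symmetric] by (simp add: vertex_eq_iff add_ac)
      have 6: "bal (vertex g 6) \<longleftrightarrow> f (vertex g 6) + f (vertex g 4) + f (vertex g 8) + f (vertex g 9) = 2"
        unfolding bal_def C four[symmetric] by (simp add: vertex_eq_iff add_ac)
      have 7: "bal (vertex g 7) \<longleftrightarrow> f (vertex g 7) + f (vertex g 5) + f (vertex g 8) + f (vertex g 10) = 2"
        unfolding bal_def C four[symmetric] by (simp add: vertex_eq_iff add_ac)
      have 8: "bal (vertex g 8) \<longleftrightarrow> f (vertex g 8) + f (vertex g 6) + f (vertex g 7) \<in> {1, 2}"
        unfolding bal_def C three[symmetric] by (simp add: vertex_eq_iff add_ac)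
      have 9: "bal (vertex g 9) \<longleftrightarrow> f (vertex g 9) + f (vertex g 6) = 1"
        unfolding bal_def C two[symmetric] by (simp add: vertex_eq_iff add_ac)
      have 10: "bal (vertex g 10) \<longleftrightarrow> f (vertex g 10) + f (vertex g 7) = 1"
        unfolding bal_def C two[symmetric] by (simp add: vertex_eq_iff add_ac)
      have 11: "bal (vertex g 11) \<longleftrightarrow> (if Suc g mod K = 0
          then f (vertex g 11) + f (vertex g 3) + f (vertex g 12) \<in> {1, 2}
          else f (vertex g 11) + f (vertex g 3) + f (vertex g 12) + f (vertex (Suc g) 2) = 2)"
        unfolding bal_def C three[symmetric] four[symmetric] by (simp add: vertex_eq_iff add_ac)
      have 12: "bal (vertex g 12) \<longleftrightarrow> f (vertex g 12) + f (vertex g 11) = 1"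
        unfolding bal_def C two[symmetric] by (simp add: vertex_eq_iff add_ac)
      \<comment> \<open>A closed neighborhood of a single vertex is always balanced. This settles
        the isolated vertices: 14, 15 and, in gadgets that own no constraint, 13.\<close>
      have one: "\<bar>1 - 2 * int (f (vertex g t))\<bar> \<le> 1" if "t < 16" for t
        using f[of "vertex g t"] vertex_less_iff[OF that] g by auto
      have 13: "bal (vertex g 13) \<longleftrightarrow> (g < C \<longrightarrow> f (vertex g 13) + f (vertex (port V m P g 0) 4) +
          f (vertex (port V m P g 1) 4) + f (vertex (port V m P g 2) 4) = 2)"
        using one[of 13] ports
        unfolding bal_def C four[symmetric] by (cases "g < C") (simp_all add: vertex_eq_iff add_ac)
      have 14: "bal (vertex g 14)" "bal (vertex g 15)"
        using one[of 14] one[of 15] unfolding bal_def C by simp_all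
      show ?thesis
        unfolding all_less_16 balanced_def 0 1 2 3 4 5 6 7 8 9 10 11 12 13
        using 14 by argo
    qed
    then show ?thesis by blast
  qed
  finally show ?thesis .
qed

lemma even_port_mod:
  assumes "c < C" "k < 3"
  shows "even (port V m P c k mod K) \<longleftrightarrow> slot_neg V P c k = 0"
  unfolding port_div_mod(2)[OF assms] using slot_neg_less[of c k] by (auto simp: less_2_cases_iff)

lemma div_mod_Suc:
  assumes "Suc g mod K \<noteq> 0"
  shows "Suc g div K = g div K" "Suc g mod K = Suc (g mod K)"
  using assms by (auto simp: div_Suc mod_Suc split: if_splits)

lemma satisfiable_if_balanced:
  fixes F :: "nat \<Rightarrow> nat \<Rightarrow> nat"
  assumes bal: "\<And>g. g < G \<Longrightarrow> balanced F g" and F: "\<And>g t. g < G \<Longrightarrow> t < 16 \<Longrightarrow> F g t \<in> {0, 1}"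
  shows "satisfiable V m P"
proof (rule satisfiable_if_nae[OF V_pos])
  define X where "X v \<longleftrightarrow> F (v * K) 4 = 1" for v
  \<comment> \<open>Because of the leaves 9 and 10, vertices 6 and 7 force 4 and 5 to differ from 8,
    hence to agree. Vertex 1 then forces 0 and 1 to the opposite value, and vertex 0 forces 2 and 3
    back to the value of 4.\<close>
  have val: "F g 2 = F g 4 \<and> F g 3 = F g 4 \<and> F g 0 + F g 4 = 1" if g: "g < G" for g
  proof -
    have le: "F g t \<le> 1" if "t < 16" for t using F[OF g that] by auto
    have "F g 0 + F g 1 + F g 2 + F g 3 = 2" "F g 1 + F g 0 + F g 4 + F g 5 = 2"
      "F g 6 + F g 4 + F g 8 + F g 9 = 2" "F g 9 + F g 6 = 1"
      "F g 7 + F g 5 + F g 8 + F g 10 = 2" "F g 10 + F g 7 = 1"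
      using bal[OF g] unfolding balanced_def by blast+
    moreover have "F g 0 \<le> 1" "F g 1 \<le> 1" "F g 2 \<le> 1" "F g 3 \<le> 1" "F g 4 = 0 \<or> F g 4 = 1"
      using le F[OF g, of 4] by simp_all
    ultimately show ?thesis by (elim disjE) linarith+
  qed
  have flip: "F (Suc g) 4 + F g 4 = 1" if "Suc g < G" "Suc g mod K \<noteq> 0" for g
  proof -
    have g: "g < G" using that by simp
    then have "F g 11 + F g 3 + F g 12 + F (Suc g) 2 = 2" "F g 12 + F g 11 = 1"
      using bal[OF g] that(2) unfolding balanced_def by (metis (no_types))+
    then show ?thesis using val[OF g] val[OF that(1)] by linarith
  qed
  \<comment> \<open>\<open>X\<close> is read at the first gadget of each row, and
    \<open>flip\<close> carries it along the row with alternating sign.\<close>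
  have copy: "(F g 4 = 1) \<longleftrightarrow> (X (g div K) = even (g mod K))" if "g < G" for g
    using that
  proof (induction g)
    case (Suc g)
    show ?case
    proof (cases "Suc g mod K = 0")
      case True
      then show ?thesis using div_mult_mod_eq[of "Suc g" K] by (simp add: X_def)
    next
      case False
      then show ?thesis using Suc flip[of g] div_mod_Suc[of g] F[of g 4] by auto
    qed
  qed (simp add: X_def)
  show "nae (slot_true V P X c)" if c: "c < C" for c
  proof -
    have port: "F (port V m P c k) 4 = of_bool (slot_true V P X c k)" if "k < 3" for k
      using copy[OF port_less[OF c that]] F[OF port_less[OF c that], of 4]
      unfolding port_div_mod(1)[OF c that] even_port_mod[OF c that] slot_true_def by auto
    have "c < G" using c C_le_G by simp
    then have "F c 13 + of_bool (slot_true V P X c 0) + of_bool (slot_true V P X c 1) +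
        of_bool (slot_true V P X c 2) = 2" "F c 13 \<in> {0, 1}"
      using bal[of c] F[of c 13] c port unfolding balanced_def by auto
    then show ?thesis unfolding nae_def by (auto split: if_splits simp: of_bool_def)
  qed
qed

lemma balanced_if_satisfiable:
  assumes "satisfiable V m P"
  shows "\<exists>F :: nat \<Rightarrow> nat \<Rightarrow> nat. (\<forall>g<G. balanced F g) \<and> (\<forall>g t. F g t \<in> {0, 1})"
proof -
  obtain X where nae: "\<And>c. c < C \<Longrightarrow> nae (slot_true V P X c)"
    using nae_if_satisfiable[OF V_pos assms] by blast
  define val :: "nat \<Rightarrow> nat" where "val g = of_bool (X (g div K) = even (g mod K))" for g
  \<comment> \<open>A satisfied constraint has one or two true slots, so the missing part of the sum
    2 is 1 or 0 and can be the value of vertex 13.\<close>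
  define z where "z c = 2 - (val (port V m P c 0) + val (port V m P c 1) + val (port V m P c 2))" for c
  \<comment> \<open>Vertices 4 and 1 have opposite values, so at a port vertex 4 is balanced iff
    vertex 6 is opposite to the constraint vertex. Vertex 6 may take either value: its leaf 9 takes
    the other one, and in the choice of \<open>F\<close> vertices 7 and 8 are opposite, which
    balances vertex 8 in any case.\<close>
  define F6 where "F6 g = (if is_port g then 1 - z (g mod K div 6) else 1 - val g)" for g
  define F where "F g t =
    (if t \<in> {2, 3, 4, 5, 7} then val g else if t \<in> {0, 1, 8, 10} then 1 - val g
     else if t = 6 then F6 g else if t = 9 then 1 - F6 g else if t = 12 then 1
     else if t = 13 \<and> g < C then z g else 0)" for g t :: nat
  have val: "val g \<le> 1" for g by (simp add: val_def)
  have port: "val (port V m P c k) = of_bool (slot_true V P X c k)" if "c < C" "k < 3" for c k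
    unfolding val_def port_div_mod(1)[OF that] even_port_mod[OF that] slot_true_def by simp
  have z: "z c + val (port V m P c 0) + val (port V m P c 1) + val (port V m P c 2) = 2" "z c \<le> 1"
    if "c < C" for c
    using nae[OF that] port[OF that] unfolding z_def nae_def by (auto simp: of_bool_def)
  have F6: "F6 g \<le> 1" for g by (simp add: F6_def)
  have flip: "val g + val (Suc g) = 1" if "Suc g mod K \<noteq> 0" for g
    unfolding val_def div_mod_Suc[OF that] by auto
  have "balanced F g" if "g < G" for g
  proof -
    have "is_port g \<Longrightarrow> F6 g + z (g mod K div 6) = 1"
      using z(2)[OF gadget_less[of g]] by (simp add: F6_def)
    then show ?thesis
      using val[of g] F6[of g] flip[of g] z(1)[of g] gadget_less[of g]
      unfolding balanced_def F_def by auto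
  qed
  moreover have "F g t \<in> {0, 1}" for g t
    using val[of g] F6[of g] z(2)[of g] unfolding F_def by auto
  ultimately show ?thesis by blast
qed

theorem LB_question_iff_satisfiable:
  "LB_question {..<graph_size V m} E \<longleftrightarrow> satisfiable V m P"
proof
  assume "LB_question {..<graph_size V m} E"
  then obtain f where f: "two_partition {..<graph_size V m} f"
    "\<forall>g<G. balanced (\<lambda>g t. f (vertex g t)) g"
    using locally_balanced_iff by blast
  then show "satisfiable V m P"
    by (intro satisfiable_if_balanced[of "\<lambda>g t. f (vertex g t)"])
      (auto simp: two_partition_def vertex_less_iff)
next
  assume "satisfiable V m P"
  from balanced_if_satisfiable[OF this]
  obtain F where F: "\<forall>g<G. balanced F g" "\<forall>g t. F g t \<in> {0, 1 :: nat}" by blast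
  define f where "f u = F (u div 16) (u mod 16)" for u
  have "f (vertex g t) = F g t" if "t < 16" for g t
    using that by (simp add: f_def vertex_def)
  then have "balanced (\<lambda>g t. f (vertex g t)) g = balanced F g" for g
    unfolding balanced_def by simp
  moreover have "two_partition {..<graph_size V m} f"
    using F(2) unfolding two_partition_def f_def by blast
  ultimately show "LB_question {..<graph_size V m} E"
    using locally_balanced_iff F(1) by blast
qed

end

text \<open>\<open>def_let\<close> always substitutes for variable 0. So variables 0 and 1 are first
  exchanged by the renaming with \<open>1 - n\<close>; then the second argument is substituted, and
  after it the first.\<close>

lemma def_app2:
  assumes "definable (\<lambda>w e. F w (e 0) (e 1))" "definable A" "definable B"
  shows "definable (\<lambda>w e. F w (A w e) (B w e))"
proof -
  have "definable (\<lambda>w e. F w (e (1 - 0)) (e (1 - 1)))"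
    by (rule def_rename[of "\<lambda>w e. F w (e 0) (e 1)" "\<lambda>n. 1 - n", OF assms(1)])
  then have "definable (\<lambda>w e. F w (e (Suc 0)) (e 0))" by simp
  then have "definable (\<lambda>w e. F w (e 0) (B w (\<lambda>n. e (Suc n))))"
    by (rule def_let[where G="\<lambda>w e j. F w (e 0) j", OF def_rename[where \<rho>=Suc, OF assms(3)]])
  then show ?thesis
    by (rule def_let[where G="\<lambda>w e i. F w i (B w e)", OF assms(2)])
qed

lemma def_app2_pred:
  assumes "definable_pred (\<lambda>w e. P w (e 0) (e 1))" "definable A" "definable B"
  shows "definable_pred (\<lambda>w e. P w (A w e) (B w e))"
  using def_app2[of "\<lambda>w i j. if P w i j then 1 else 0" A B] assms
  unfolding definable_pred_def by simp

locale clause_matrix_family =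
  fixes V m :: "nat list \<Rightarrow> nat" and P :: "nat list \<Rightarrow> nat \<Rightarrow> nat \<Rightarrow> bool"
  assumes V_pos: "\<And>w. 0 < V w" and m_pos: "\<And>w. 0 < m w"
    and def_V: "definable (\<lambda>w e. V w)" and def_m: "definable (\<lambda>w e. m w)"
    and def_P: "definable_pred (\<lambda>w e. P w (e 0) (e 1))"
begin

lemmas intros = def_intro def_V def_m def_app2_pred[OF def_P]

lemma def_graph_size: "definable (\<lambda>w e. graph_size (V w) (m w))"
  unfolding graph_size_def gadgets_def copies_def by (intro intros)

lemma def_port: "definable (\<lambda>w e. port (V w) (m w) (P w) (e 0) (e 1))"
  unfolding port_def slot_var_def slot_neg_def copies_def by (intro intros)

lemma def_arc: "definable_pred (\<lambda>w e. arc (V w) (m w) (P w) (e 0) (e 1))"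
  unfolding arc_def vertex_def gadgets_def copies_def
  by (intro intros def_app2[OF def_port])

text \<open>The constructed graph is always an instance, so only the question depends on the input;
  injectivity of the code rules out that \<open>f x\<close> also encodes another graph.\<close>

lemma reduction:
  "\<exists>f. poly_time_computable f \<and>
     (\<forall>x. f x \<in> decision_language LB_instance LB_question \<longleftrightarrow>
        satisfiable (V (bits x)) (m (bits x)) (P (bits x)))"
proof -
  define N where "N w = graph_size (V w) (m w)" for w
  define E where "E w = graph (V w) (m w) (P w)" for w
  define f where "f x = adjacency_code (N (bits x)) (E (bits x))" for x
  define A where "A w k \<longleftrightarrow> arc (V w) (m w) (P w) (k div N w) (k mod N w) \<or>
    arc (V w) (m w) (P w) (k mod N w) (k div N w)" for w k
  have "definable_pred (\<lambda>w e. A w (e 0))"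
    unfolding A_def N_def by (intro intros def_app2_pred[OF def_arc] def_graph_size)
  moreover have "definable (\<lambda>w e. N w * N w)"
    unfolding N_def by (intro intros def_graph_size)
  ultimately have "poly_time_computable (\<lambda>x. map (A (bits x)) [0..<N (bits x) * N (bits x)])"
    by (intro computable_of_definable)
  also have "(\<lambda>x. map (A (bits x)) [0..<N (bits x) * N (bits x)]) = f"
    unfolding f_def adjacency_code_eq E_def graph_edge_iff A_def by blast
  finally have "poly_time_computable f" .
  moreover have "f x \<in> decision_language LB_instance LB_question \<longleftrightarrow>
      satisfiable (V (bits x)) (m (bits x)) (P (bits x))" for x
  proof -
    interpret clause_matrix "V (bits x)" "m (bits x)" "P (bits x)"
      by unfold_locales (rule V_pos m_pos)+
    have "f x \<in> decision_language LB_instance LB_question \<longleftrightarrow>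
        LB_question {..<N (bits x)} (E (bits x))"
    proof
      assume "f x \<in> decision_language LB_instance LB_question"
      then obtain n F where *: "f x = adjacency_code n F" "simple_graph {..<n} F" "LB_question {..<n} F"
        unfolding decision_language_def by blast
      have "n = N (bits x) \<and> F = E (bits x)"
        using adjacency_code_inj[OF *(2) simple_graph_E] *(1) unfolding f_def N_def E_def by simp
      then show "LB_question {..<N (bits x)} (E (bits x))" using *(3) by simp
    next
      assume "LB_question {..<N (bits x)} (E (bits x))"
      then show "f x \<in> decision_language LB_instance LB_question"
        unfolding decision_language_def f_def N_def E_def
        using simple_graph_E bipartite_E max_degree_E by blast
    qed
    then show ?thesis unfolding N_def E_def LB_question_iff_satisfiable .
  qed
  ultimately show ?thesis by blast
qed

end

section \<open>Computations of Turing machines as clause matrices\<close>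

text \<open>This is all that the transition depends on. A machine has finitely many views, so
  clauses can refer to them by number.\<close>

definition view :: "config \<Rightarrow> nat \<times> nat list" where
  "view c = (fst c, map rd (snd c))"

text \<open>Halting states are treated as staying put, so that one description covers every step up
  to the time bound.\<close>

definition local_step :: "tm \<Rightarrow> nat \<times> nat list \<Rightarrow> nat \<times> (nat \<times> move) list" where
  "local_step M = (\<lambda>(q, ss). if q \<in> halting_states M then (q, map (\<lambda>s. (s, Stay)) ss) else transition M q ss)"

definition views :: "tm \<Rightarrow> (nat \<times> nat list) set" where
  "views M = {..<num_states M} \<times> {ss. set ss \<subseteq> {..<num_symbols M} \<and> length ss = num_tapes M}"

definition proper :: "tm \<Rightarrow> config \<Rightarrow> bool" where
  "proper M c \<longleftrightarrow> fst c < num_states M \<and> length (snd c) = num_tapes M \<and>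
     (\<forall>a<num_tapes M. \<forall>z. fst (snd c ! a) z < num_symbols M)"

lemma finite_views: "finite (views M)"
  unfolding views_def by (intro finite_cartesian_product finite_lists_length_eq) auto

lemma view_in_views: "proper M c \<Longrightarrow> view c \<in> views M"
  unfolding proper_def view_def views_def rd_def by (auto simp: set_conv_nth)

lemma local_step_views:
  assumes "turing_machine M" "v \<in> views M"
  shows "fst (local_step M v) < num_states M" "length (snd (local_step M v)) = num_tapes M"
    "a < num_tapes M \<Longrightarrow> fst (snd (local_step M v) ! a) < num_symbols M"
proof -
  obtain q ss where v: "v = (q, ss)" by fastforce
  then have q: "q < num_states M" and ss: "set ss \<subseteq> {..<num_symbols M}" "length ss = num_tapes M"
    using assms(2) unfolding views_def by auto
  have *: "fst (local_step M v) < num_states M \<and> length (snd (local_step M v)) = num_tapes M \<and>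
      fst ` set (snd (local_step M v)) \<subseteq> {..<num_symbols M}"
  proof (cases "q \<in> halting_states M")
    case True
    then show ?thesis using q ss by (auto simp: local_step_def v)
  next
    case False
    obtain q' acts where t: "transition M q ss = (q', acts)" by fastforce
    then have "q' < num_states M \<and> length acts = num_tapes M \<and> fst ` set acts \<subseteq> {..<num_symbols M}"
      using assms(1) q ss False unfolding turing_machine_def by blast
    then show ?thesis using False t by (simp add: local_step_def v)
  qed
  then show "fst (local_step M v) < num_states M" "length (snd (local_step M v)) = num_tapes M" by auto
  show "fst (snd (local_step M v) ! a) < num_symbols M" if "a < num_tapes M"
  proof -
    have "snd (local_step M v) ! a \<in> set (snd (local_step M v))" using that * by simp
    then show ?thesis using * by blast
  qed
qed

lemma step_eq:
  "step M c = (fst (local_step M (view c)), map2 act (snd (local_step M (view c))) (snd c))"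
proof -
  obtain q ts where c: "c = (q, ts)" by fastforce
  have rd: "map (\<lambda>(t, h). t h) ts = map rd ts" by (simp add: rd_def case_prod_beta)
  have "map2 act (map (\<lambda>s. (s, Stay)) (map rd ts)) ts = ts"
    by (rule nth_equalityI) (auto simp: act_stay)
  then show ?thesis unfolding c view_def local_step_def step.simps rd
    by (auto simp: Let_def case_prod_beta)
qed

lemma step_tape:
  assumes "turing_machine M" "proper M c" "a < num_tapes M"
  shows "snd (step M c) ! a = act (snd (local_step M (view c)) ! a) (snd c ! a)"
  using local_step_views(2)[OF assms(1) view_in_views[OF assms(2)]] assms(2,3)
  unfolding step_eq proper_def by simp

lemma act_eq: "act sm th = ((fst th)(snd th := fst sm), snd th + offset (snd sm))"
  by (cases sm; cases th) simp

lemma proper_step: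
  assumes "turing_machine M" "proper M c"
  shows "proper M (step M c)"
proof -
  note v = local_step_views[OF assms(1) view_in_views[OF assms(2)]]
  have "fst (step M c) < num_states M" "length (snd (step M c)) = num_tapes M"
    using v assms(2) unfolding step_eq proper_def by auto
  moreover have "fst (snd (step M c) ! a) z < num_symbols M" if "a < num_tapes M" for a z
    unfolding step_tape[OF assms that] act_eq using v(3)[OF that] assms(2) that
    unfolding proper_def by simp
  ultimately show ?thesis unfolding proper_def by blast
qed

lemma proper_run:
  assumes "turing_machine M" "set w \<subseteq> {..<num_symbols M}"
  shows "proper M (run M w t)"
proof (induction t)
  case 0
  have "contents v z < num_symbols M" if "set v \<subseteq> {..<num_symbols M}" for v z
  proof (cases "0 \<le> z \<and> z < int (length v)")
    case True
    then have "v ! nat z \<in> set v" by (intro nth_mem) linarith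
    then show ?thesis using True that by (auto simp: contents_def)
  qed (use assms(1) in \<open>auto simp: contents_def turing_machine_def\<close>)
  then have "contents w z < num_symbols M" "contents [] z < num_symbols M" for z
    using assms(2) by simp_all
  then show ?case using assms(1) unfolding run_def initial_def proper_def turing_machine_def
    by (simp add: nth_Cons')
next
  case (Suc t)
  then show ?case using proper_step[OF assms(1)] by (simp add: run_def)
qed

text \<open>Up to time \<open>n\<close> only positions from \<open>-n\<close> to \<open>n\<close>
  are visited; adding \<open>n\<close> to them gives natural numbers as cell indices.\<close>

lemma head_run:
  assumes "turing_machine M" "set w \<subseteq> {..<num_symbols M}" "a < num_tapes M"
  shows "\<bar>snd (snd (run M w t) ! a)\<bar> \<le> int t"
proof (induction t)
  case 0
  then show ?case using assms(3) by (simp add: run_def initial_def nth_Cons')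
next
  case (Suc t)
  have off: "\<bar>offset x\<bar> \<le> 1" for x by (cases x) auto
  have "snd (snd (run M w (Suc t)) ! a) =
      snd (snd (run M w t) ! a) + offset (snd (snd (local_step M (view (run M w t))) ! a))"
    using step_tape[OF assms(1) proper_run[OF assms(1,2)] assms(3), of t]
    by (simp add: act_eq run_def)
  then show ?case using Suc off[of "snd (snd (local_step M (view (run M w t))) ! a)"] by linarith
qed

section \<open>Tuples as numbers in a fixed base\<close>

definition digit :: "nat \<Rightarrow> nat \<Rightarrow> nat \<Rightarrow> nat" where
  "digit B n v = v div B ^ n mod B"

definition number :: "nat \<Rightarrow> nat list \<Rightarrow> nat" where
  "number B ds = foldr (\<lambda>d v. d + B * v) ds 0"

lemma digit_number:
  "(\<And>d. d \<in> set ds \<Longrightarrow> d < B) \<Longrightarrow> n < length ds \<Longrightarrow> digit B n (number B ds) = ds ! n"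
proof (induction ds arbitrary: n)
  case (Cons d ds)
  have "d < B" using Cons.prems by simp
  then have "(d + B * v) div B = v" "(d + B * v) mod B = d" for v by simp_all
  then show ?case using Cons.IH Cons.prems
    by (cases n) (simp_all add: digit_def number_def div_mult2_eq)
qed simp

lemma number_less: "(\<And>d. d \<in> set ds \<Longrightarrow> d < B) \<Longrightarrow> number B ds < B ^ length ds"
proof (induction ds)
  case (Cons d ds)
  have "d < B" "Suc (number B ds) \<le> B ^ length ds" using Cons by auto
  then have "d + B * number B ds < B * Suc (number B ds)" by simp
  also have "\<dots> \<le> B * B ^ length ds" by (rule mult_le_mono2) fact
  finally have "d + B * number B ds < B * B ^ length ds" .
  then show ?case by (simp add: number_def)
qed (simp add: number_def)

lemma number_digits: "v < B ^ n \<Longrightarrow> number B (map (\<lambda>i. digit B i v) [0..<n]) = v"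
proof (induction n arbitrary: v)
  case (Suc n)
  have "v div B < B ^ n" using Suc.prems by (simp add: less_mult_imp_div_less mult.commute)
  then have "number B (map (\<lambda>i. digit B i (v div B)) [0..<n]) = v div B" by (rule Suc.IH)
  moreover have "map (\<lambda>i. digit B i v) [0..<Suc n] = v mod B # map (\<lambda>i. digit B i (v div B)) [0..<n]"
    unfolding upt_conv_Cons[OF zero_less_Suc] map_Suc_upt[symmetric]
    by (simp add: digit_def div_mult2_eq)
  ultimately show ?case by (simp add: number_def)
qed (simp add: number_def)

text \<open>\<open>vw\<close> lists the views, so the numbers below \<open>c0\<close> serve as
  indices into the finite tables of the machine.\<close>

locale verifier =
  fixes M :: tm and p q :: "nat poly" and c0 :: nat and vw :: "nat \<Rightarrow> nat \<times> nat list"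
  assumes tm: "turing_machine M"
    and halts: "\<And>x u. halts_within M (pair_word x u) (poly q (length (pair_word x u)))"
    and vw: "views M = vw ` {..<c0}"
begin

abbreviation "k \<equiv> num_tapes M"

definition cert :: "nat list \<Rightarrow> nat" where
  "cert w = poly p (length w)"

text \<open>The polynomial is taken at the greatest length of an input with a certificate of
  admissible length, so it bounds all these runs at once.\<close>

definition time :: "nat list \<Rightarrow> nat" where
  "time w = poly q (length w + 1 + cert w)"

text \<open>Larger than every parameter of a relevant clause and every component of its literals;
  the 12 makes room for the clause kinds 0 to 10.\<close>

definition base :: "nat list \<Rightarrow> nat" where
  "base w = 2 * time w + length w + cert w + num_states M + num_symbols M + k + c0 + 12"

text \<open>Column \<open>k\<close> is the state. The guards with default 0, here and in the next
  three tables, have the form of \<open>def_table\<close> and \<open>def_table2\<close>.\<close>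

definition read :: "nat \<Rightarrow> nat \<Rightarrow> nat" where
  "read c a = (if c < c0 \<and> a < Suc k then if a = k then fst (vw c) else snd (vw c) ! a else 0)"

definition next_state :: "nat \<Rightarrow> nat" where
  "next_state c = (if c < c0 then fst (local_step M (vw c)) else 0)"

definition written :: "nat \<Rightarrow> nat \<Rightarrow> nat" where
  "written c a = (if c < c0 \<and> a < k then fst (snd (local_step M (vw c)) ! a) else 0)"

text \<open>One more than the offset, so as to be a natural number; kind 2 of \<open>member\<close>
  subtracts the 1 again.\<close>

definition shift :: "nat \<Rightarrow> nat \<Rightarrow> nat" where
  "shift c a =
     (if c < c0 \<and> a < k then nat (offset (snd (snd (local_step M (vw c)) ! a)) + 1) else 0)"

text \<open>
  The cell at position \<open>z\<close> of a tape has the index \<open>z + time w\<close>. A fact \<open>(0, t, a, i, s)\<close> says that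
  at time \<open>t\<close> the cell \<open>i\<close> of tape \<open>a\<close> contains \<open>s\<close>, a fact \<open>(1, t, a, i, 0)\<close> that the head
  of tape \<open>a\<close> is on cell \<open>i\<close>, and a fact \<open>(2, t, a, 0, s)\<close> that the head of tape \<open>a\<close> reads \<open>s\<close>
  or, if \<open>a = k\<close>, that the state is \<open>s\<close>. A literal is a fact preceded by 1 if it is negated,
  and by 0 otherwise.
\<close>

type_synonym literal = "nat \<times> nat \<times> nat \<times> nat \<times> nat \<times> nat"

definition is_cert :: "nat list \<Rightarrow> nat \<Rightarrow> bool" where
  "is_cert w i \<longleftrightarrow> time w + length w < i \<and> i \<le> time w + length w + cert w"

definition initial_cell :: "nat list \<Rightarrow> nat \<Rightarrow> nat \<Rightarrow> nat" where
  "initial_cell w a i =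
     (if a = 0 \<and> i = time w + length w then 3
      else if a = 0 \<and> time w \<le> i \<and> i < time w + length w then letter w (i - time w) else 0)"

text \<open>The kinds \<open>\<kappa>\<close> are: 0 what a head reads, 1 the next state, 2 the
  movement of a head, 3 the symbol written, 4 a cell away from the head, 5 the initial heads, 6 the
  initial state, 7 the prescribed initial cells, 8 the guess of a certificate cell, 9 no certificate
  letter after a blank, 10 no final state except acceptance. Only the side conditions stand here;
  \<open>member\<close> gives the literals.\<close>

definition clause :: "nat list \<Rightarrow> nat \<Rightarrow> nat \<Rightarrow> nat \<Rightarrow> nat \<Rightarrow> nat \<Rightarrow> nat \<Rightarrow> nat \<Rightarrow> bool" where
  "clause w \<kappa> t c a i i' s \<longleftrightarrow>
     \<kappa> = 0 \<and> t < time w \<or>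
     \<kappa> = 1 \<and> t < time w \<and> c < c0 \<or>
     \<kappa> = 2 \<and> t < time w \<and> c < c0 \<and> a < k \<or>
     \<kappa> = 3 \<and> t < time w \<and> c < c0 \<and> a < k \<or>
     \<kappa> = 4 \<and> t < time w \<and> i \<noteq> i' \<or>
     \<kappa> = 5 \<and> a < k \<or>
     \<kappa> = 6 \<or>
     \<kappa> = 7 \<and> a < k \<and> \<not> (a = 0 \<and> is_cert w i) \<or>
     \<kappa> = 8 \<and> is_cert w i \<or>
     \<kappa> = 9 \<and> is_cert w i \<and> is_cert w (Suc i) \<or>
     \<kappa> = 10 \<and> s \<noteq> accept_state M"

text \<open>In kind 4, "the head is not on \<open>i\<close>" is expressed by its being on some
  \<open>i'\<close> different from \<open>i\<close>. So the premise is a positive fact and the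
  clause is Horn; only kind 8 has more than one positive literal.\<close>

definition member :: "nat list \<Rightarrow> nat \<Rightarrow> nat \<Rightarrow> nat \<Rightarrow> nat \<Rightarrow> nat \<Rightarrow> nat \<Rightarrow> nat \<Rightarrow> literal \<Rightarrow> bool" where
  "member w \<kappa> t c a i i' s L \<longleftrightarrow>
     \<kappa> = 0 \<and> (L = (1, 1, t, a, i, 0) \<or> L = (1, 0, t, a, i, s) \<or> L = (0, 2, t, a, 0, s)) \<or>
     (\<kappa> = 1 \<or> \<kappa> = 2 \<or> \<kappa> = 3) \<and> (\<exists>b<Suc k. L = (1, 2, t, b, 0, read c b)) \<or>
     \<kappa> = 1 \<and> L = (0, 2, Suc t, k, 0, next_state c) \<or>
     (\<kappa> = 2 \<or> \<kappa> = 3) \<and> L = (1, 1, t, a, i, 0) \<or>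
     \<kappa> = 2 \<and> L = (0, 1, Suc t, a, i + shift c a - 1, 0) \<or>
     \<kappa> = 3 \<and> L = (0, 0, Suc t, a, i, written c a) \<or>
     \<kappa> = 4 \<and> (L = (1, 1, t, a, i', 0) \<or> L = (1, 0, t, a, i, s) \<or> L = (0, 0, Suc t, a, i, s)) \<or>
     \<kappa> = 5 \<and> L = (0, 1, 0, a, time w, 0) \<or>
     \<kappa> = 6 \<and> L = (0, 2, 0, k, 0, start_state M) \<or>
     \<kappa> = 7 \<and> L = (0, 0, 0, a, i, initial_cell w a i) \<or>
     \<kappa> = 8 \<and> (L = (0, 0, 0, 0, i, 0) \<or> L = (0, 0, 0, 0, i, 1) \<or> L = (0, 0, 0, 0, i, 2)) \<or>
     \<kappa> = 9 \<and> (L = (1, 0, 0, 0, i, 0) \<or> L = (0, 0, 0, 0, Suc i, 0)) \<or>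
     \<kappa> = 10 \<and> L = (1, 2, time w, k, 0, s)"

fun small :: "nat \<Rightarrow> literal \<Rightarrow> bool" where
  "small B (b, \<kappa>, t, a, i, s) \<longleftrightarrow> b < 2 \<and> \<kappa> < B \<and> t < B \<and> a < B \<and> i < B \<and> s < B"

definition true_in :: "(nat \<times> nat \<times> nat \<times> nat \<times> nat \<Rightarrow> bool) \<Rightarrow> literal \<Rightarrow> bool" where
  "true_in \<alpha> L \<longleftrightarrow> \<alpha> (snd L) = (fst L = 0)"

definition model :: "nat list \<Rightarrow> (nat \<times> nat \<times> nat \<times> nat \<times> nat \<Rightarrow> bool) \<Rightarrow> bool" where
  "model w \<alpha> \<longleftrightarrow> (\<forall>\<kappa> t c a i i' s. \<kappa> < base w \<longrightarrow> t < base w \<longrightarrow> c < base w \<longrightarrow> a < base w \<longrightarrow>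
     i < base w \<longrightarrow> i' < base w \<longrightarrow> s < base w \<longrightarrow> clause w \<kappa> t c a i i' s \<longrightarrow>
     (\<exists>L. small (base w) L \<and> member w \<kappa> t c a i i' s L \<and> true_in \<alpha> L))"

text \<open>The digits of a row number are the parameters of the clause. If they violate the side
  condition, the row contains all literals and is a tautology.\<close>

definition matrix :: "nat list \<Rightarrow> nat \<Rightarrow> nat \<Rightarrow> bool" where
  "matrix w j l \<longleftrightarrow>
     (clause w (digit (base w) 0 j) (digit (base w) 1 j) (digit (base w) 2 j) (digit (base w) 3 j)
        (digit (base w) 4 j) (digit (base w) 5 j) (digit (base w) 6 j) \<longrightarrow>
      member w (digit (base w) 0 j) (digit (base w) 1 j) (digit (base w) 2 j) (digit (base w) 3 j)
        (digit (base w) 4 j) (digit (base w) 5 j) (digit (base w) 6 j)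
        (l mod 2, digit (base w) 0 (l div 2), digit (base w) 1 (l div 2), digit (base w) 2 (l div 2),
         digit (base w) 3 (l div 2), digit (base w) 4 (l div 2)))"

lemma base_pos: "0 < base w"
  by (simp add: base_def)

lemma digit_less: "digit (base w) n v < base w"
  using base_pos by (simp add: digit_def)

lemma satisfiable_iff_model:
  "satisfiable (base w ^ 5) (base w ^ 7) (matrix w) \<longleftrightarrow> (\<exists>\<alpha>. model w \<alpha>)"
proof
  let ?B = "base w"
  let ?d = "digit ?B"
  assume "satisfiable (?B ^ 5) (?B ^ 7) (matrix w)"
  then obtain x where x: "\<And>j. j < ?B ^ 7 \<Longrightarrow> \<exists>l<2 * ?B ^ 5. matrix w j l \<and> lit_true x l"
    unfolding satisfiable_def by blast
  define \<alpha> where "\<alpha> = (\<lambda>(\<kappa>, t, a, i, s). x (number ?B [\<kappa>, t, a, i, s]))"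
  have "model w \<alpha>"
    unfolding model_def
  proof (intro allI impI)
    fix \<kappa> t c a i i' s
    assume less: "\<kappa> < ?B" "t < ?B" "c < ?B" "a < ?B" "i < ?B" "i' < ?B" "s < ?B"
      and clause: "clause w \<kappa> t c a i i' s"
    let ?ds = "[\<kappa>, t, c, a, i, i', s]"
    have ds: "d < ?B" if "d \<in> set ?ds" for d using that less by auto
    define j where "j = number ?B ?ds"
    have "j < ?B ^ 7" using number_less[of ?ds ?B, OF ds] by (simp add: j_def eval_nat_numeral)
    from x[OF this] obtain l where l: "l < 2 * ?B ^ 5" "matrix w j l" "lit_true x l" by blast
    have j: "?d 0 j = \<kappa>" "?d 1 j = t" "?d 2 j = c" "?d 3 j = a" "?d 4 j = i" "?d 5 j = i'" "?d 6 j = s"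
      using digit_number[of ?ds ?B, OF ds] unfolding j_def by (simp_all add: eval_nat_numeral)
    let ?v = "l div 2"
    define L where "L = (l mod 2, ?d 0 ?v, ?d 1 ?v, ?d 2 ?v, ?d 3 ?v, ?d 4 ?v)"
    have "member w \<kappa> t c a i i' s L" using l(2) clause unfolding matrix_def j L_def by blast
    moreover have "small ?B L" by (simp add: L_def digit_less)
    moreover have "?v < ?B ^ 5" using l(1) by (simp add: less_mult_imp_div_less mult.commute)
    from number_digits[OF this]
    have "number ?B [?d 0 ?v, ?d 1 ?v, ?d 2 ?v, ?d 3 ?v, ?d 4 ?v] = ?v"
      by (simp add: eval_nat_numeral upt_rec)
    then have "true_in \<alpha> L"
      using l(3) unfolding true_in_def L_def \<alpha>_def lit_true_def by (simp add: even_iff_mod_2_eq_zero)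
    ultimately show "\<exists>L. small ?B L \<and> member w \<kappa> t c a i i' s L \<and> true_in \<alpha> L" by blast
  qed
  then show "\<exists>\<alpha>. model w \<alpha>" by blast
next
  let ?B = "base w"
  let ?d = "digit ?B"
  assume "\<exists>\<alpha>. model w \<alpha>"
  then obtain \<alpha> where \<alpha>: "model w \<alpha>" by blast
  define x where "x v = \<alpha> (?d 0 v, ?d 1 v, ?d 2 v, ?d 3 v, ?d 4 v)" for v
  have "\<exists>l<2 * ?B ^ 5. matrix w j l \<and> lit_true x l" for j
  proof (cases "clause w (?d 0 j) (?d 1 j) (?d 2 j) (?d 3 j) (?d 4 j) (?d 5 j) (?d 6 j)")
    case False
    then have "matrix w j l" for l by (simp add: matrix_def)
    moreover have "lit_true x 0 \<or> lit_true x 1" by (auto simp: lit_true_def)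
    moreover have "0 < ?B ^ 5" using base_pos by simp
    then have "0 < 2 * ?B ^ 5" "1 < 2 * ?B ^ 5" by linarith+
    ultimately show ?thesis by blast
  next
    case True
    then obtain L where L: "small ?B L" "true_in \<alpha> L"
      "member w (?d 0 j) (?d 1 j) (?d 2 j) (?d 3 j) (?d 4 j) (?d 5 j) (?d 6 j) L"
      using \<alpha> digit_less unfolding model_def by blast
    obtain b \<kappa> t a i s where Leq: "L = (b, \<kappa>, t, a, i, s)" by (cases L) auto
    let ?ds = "[\<kappa>, t, a, i, s]"
    have ds: "d < ?B" if "d \<in> set ?ds" for d using that L(1) unfolding Leq by auto
    define v where "v = number ?B ?ds"
    have v: "?d 0 v = \<kappa>" "?d 1 v = t" "?d 2 v = a" "?d 3 v = i" "?d 4 v = s"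
      using digit_number[of ?ds ?B, OF ds] unfolding v_def by (simp_all add: eval_nat_numeral)
    have b: "b < 2" using L(1) unfolding Leq by simp
    have "v < ?B ^ 5" using number_less[of ?ds ?B, OF ds] by (simp add: v_def eval_nat_numeral)
    then have "b + 2 * v < 2 * ?B ^ 5" using b by linarith
    moreover have bv: "(b + 2 * v) mod 2 = b" "(b + 2 * v) div 2 = v" using b by simp_all
    moreover have "matrix w j (b + 2 * v)" using L(3) unfolding matrix_def bv v Leq by blast
    moreover have "lit_true x (b + 2 * v)"
      using L(2) b unfolding lit_true_def x_def true_in_def Leq bv v
      by (auto simp: less_2_cases_iff)
    ultimately show ?thesis by blast
  qed
  then show "satisfiable (?B ^ 5) (?B ^ 7) (matrix w)" unfolding satisfiable_def by blast
qed

section \<open>The facts of an actual run\<close>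

definition cell :: "nat list \<Rightarrow> nat list \<Rightarrow> nat \<Rightarrow> nat \<Rightarrow> nat \<Rightarrow> nat" where
  "cell w v t a i = fst (snd (run M v t) ! a) (int i - int (time w))"

definition head :: "nat list \<Rightarrow> nat list \<Rightarrow> nat \<Rightarrow> nat \<Rightarrow> nat" where
  "head w v t a = nat (snd (snd (run M v t) ! a) + int (time w))"

definition state :: "nat list \<Rightarrow> nat \<Rightarrow> nat" where
  "state v t = fst (run M v t)"

lemma k_pos: "0 < k"
  using tm by (simp add: turing_machine_def)

context
  fixes w :: "nat list" and x u :: "bool list" and v :: "nat list"
  assumes w: "w = bits x" and v: "v = pair_word x u"
begin

lemma v_symbols: "set v \<subseteq> {..<num_symbols M}"
  using tm unfolding v pair_word_def bits_def turing_machine_def by auto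

lemmas run_proper = proper_run[OF tm v_symbols]

lemma head_bounds:
  assumes "a < k" "t \<le> time w"
  shows "int (head w v t a) = snd (snd (run M v t) ! a) + int (time w)"
    "head w v t a \<le> 2 * time w" "t < time w \<Longrightarrow> 1 \<le> head w v t a"
  using head_run[OF tm v_symbols assms(1), of t] assms(2) unfolding head_def by linarith+

lemma cell_head:
  "a < k \<Longrightarrow> t \<le> time w \<Longrightarrow> cell w v t a (head w v t a) = rd (snd (run M v t) ! a)"
  unfolding cell_def rd_def by (simp add: head_bounds(1))

lemma read_view:
  assumes "c < c0" "vw c = view (run M v t)" "t \<le> time w"
  shows "read c k = state v t" "a < k \<Longrightarrow> read c a = cell w v t a (head w v t a)"
  using assms run_proper[of t] cell_head[of a t]
  unfolding read_def state_def view_def proper_def by simp_all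

lemma view_step:
  assumes c0: "c < c0" and c: "vw c = view (run M v t)" and t: "t < time w"
  shows "state v (Suc t) = next_state c"
    "a < k \<Longrightarrow> head w v (Suc t) a = head w v t a + shift c a - 1"
    "a < k \<Longrightarrow> cell w v (Suc t) a i = (if i = head w v t a then written c a else cell w v t a i)"
proof -
  have run: "run M v (Suc t) = step M (run M v t)" by (simp add: run_def)
  show "state v (Suc t) = next_state c"
    unfolding state_def run step_eq next_state_def c using c0 by simp
  assume a: "a < k"
  have tape: "snd (run M v (Suc t)) ! a = act (snd (local_step M (vw c)) ! a) (snd (run M v t) ! a)"
    unfolding run c by (rule step_tape[OF tm run_proper a])
  have "-1 \<le> offset m" for m by (cases m) auto
  from this[of "snd (snd (local_step M (vw c)) ! a)"]
  have "int (shift c a) = offset (snd (snd (local_step M (vw c)) ! a)) + 1"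
    unfolding shift_def using c0 a by simp
  moreover have "snd (snd (run M v (Suc t)) ! a) =
      snd (snd (run M v t) ! a) + offset (snd (snd (local_step M (vw c)) ! a))"
    unfolding tape act_eq by simp
  ultimately have "int (head w v (Suc t) a) = int (head w v t a) + int (shift c a) - 1"
    using head_bounds(1)[OF a, of t] head_bounds(1)[OF a, of "Suc t"] t by simp
  then show "head w v (Suc t) a = head w v t a + shift c a - 1" by linarith
  have "int i - int (time w) = snd (snd (run M v t) ! a) \<longleftrightarrow> i = head w v t a"
    using head_bounds(1)[OF a, of t] t by linarith
  then show "cell w v (Suc t) a i = (if i = head w v t a then written c a else cell w v t a i)"
    unfolding cell_def tape act_eq written_def using c0 a by simp
qed

lemma view_exists: "\<exists>c<c0. vw c = view (run M v t)"
proof -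
  have "view (run M v t) \<in> vw ` {..<c0}" using view_in_views[OF run_proper] unfolding vw .
  then show ?thesis by (elim imageE) auto
qed

lemma view_unique:
  assumes "c < c0" "t \<le> time w" "read c k = state v t"
    "\<And>a. a < k \<Longrightarrow> read c a = cell w v t a (head w v t a)"
  shows "vw c = view (run M v t)"
proof (rule prod_eqI)
  show "fst (vw c) = fst (view (run M v t))"
    using assms(1,3) by (simp add: read_def state_def view_def)
  have "vw c \<in> views M" unfolding vw using assms(1) by simp
  then have "length (snd (vw c)) = k" unfolding views_def by auto
  moreover have "length (snd (view (run M v t))) = k"
    using run_proper[of t] by (simp add: view_def proper_def)
  moreover have "snd (vw c) ! a = snd (view (run M v t)) ! a" if "a < k" for a
    using assms(1) assms(4)[OF that] cell_head[OF that assms(2)] that run_proper[of t]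
    by (simp add: read_def view_def proper_def)
  ultimately show "snd (vw c) = snd (view (run M v t))" by (intro nth_equalityI) simp_all
qed

lemma run_0: "state v 0 = start_state M"
  "a < k \<Longrightarrow> head w v 0 a = time w"
  "a < k \<Longrightarrow> cell w v 0 a i = (if a = 0 \<and> time w \<le> i then letter v (i - time w) else 0)"
  by (auto simp: state_def head_def cell_def run_def initial_def nth_Cons' contents_def letter_def
      nat_diff_distrib intro!: arg_cong[of _ _ "(!) v"])

lemma letter_v:
  "letter v i = (if i < length w then letter w i else if i = length w then 3
     else if i < length w + 1 + length u then if u ! (i - length w - 1) then 2 else 1 else 0)"
  by (auto simp: letter_def v w pair_word_def bits_def nth_append nth_Cons')

lemma length_w: "length w = length x"
  by (simp add: w bits_def)

lemma initial_cell_eq: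
  assumes "a < k" "\<not> (a = 0 \<and> is_cert w i)" "length u \<le> cert w"
  shows "cell w v 0 a i = initial_cell w a i"
  using assms unfolding run_0(3)[OF assms(1)] initial_cell_def letter_v is_cert_def by auto

lemma time_suffices:
  assumes "length u \<le> cert w"
  shows "accepts M v \<longleftrightarrow> state v (time w) = accept_state M"
  unfolding state_def
proof (rule accepts_iff)
  show "halts_within M v (poly q (length v))" unfolding v by (rule halts)
  show "poly q (length v) \<le> time w" unfolding time_def
    by (rule poly_nat_mono) (use assms in \<open>simp add: v length_w pair_word_def bits_def\<close>)
qed

lemma table_less:
  assumes "c < c0"
  shows "b \<le> k \<Longrightarrow> read c b < base w" "next_state c < base w" "a < k \<Longrightarrow> written c a < base w"
proof -
  have c: "vw c \<in> views M" unfolding vw using assms by simp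
  then have "fst (vw c) < num_states M" "length (snd (vw c)) = k" "set (snd (vw c)) \<subseteq> {..<num_symbols M}"
    unfolding views_def by auto
  then have "snd (vw c) ! b < num_symbols M" if "b < k" for b
  proof -
    have "snd (vw c) ! b \<in> set (snd (vw c))" using that \<open>length (snd (vw c)) = k\<close> by simp
    then show ?thesis using \<open>set (snd (vw c)) \<subseteq> {..<num_symbols M}\<close> by blast
  qed
  then show "read c b < base w" if "b \<le> k"
    using \<open>fst (vw c) < num_states M\<close> assms that unfolding read_def base_def
    by (cases "b = k") (simp_all add: trans_less_add1 trans_less_add2)
  show "next_state c < base w"
    using local_step_views(1)[OF tm c] assms unfolding next_state_def base_def by simp
  show "written c a < base w" if "a < k"
    using local_step_views(3)[OF tm c that] assms that unfolding written_def base_def by simp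
qed

lemma model_if_accepts:
  assumes "length u \<le> cert w" "accepts M v"
  shows "\<exists>\<alpha>. model w \<alpha>"
proof -
  define \<alpha> where "\<alpha> = (\<lambda>(\<kappa> :: nat, t, a, i, s).
    \<kappa> = 0 \<and> a < k \<and> cell w v t a i = s \<or>
    \<kappa> = 1 \<and> a < k \<and> head w v t a = i \<and> s = 0 \<or>
    \<kappa> = 2 \<and> i = 0 \<and> (a < k \<and> cell w v t a (head w v t a) = s \<or> a = k \<and> state v t = s))"
  let ?B = "base w"
  have "\<exists>L. small ?B L \<and> member w \<kappa> t c a i i' s L \<and> true_in \<alpha> L"
    if less: "\<kappa> < ?B" "t < ?B" "c < ?B" "a < ?B" "i < ?B" "i' < ?B" "s < ?B"
      and clause: "clause w \<kappa> t c a i i' s" for \<kappa> t c a i i' s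
  proof -
    have B: "k < ?B" "2 < ?B" "1 < ?B" "2 * time w + 1 < ?B" "num_states M \<le> ?B" "0 < ?B" "time w < ?B"
      "time w + length w + cert w + 1 < ?B"
      by (simp_all add: base_def)
    have tB: "Suc t < ?B" if "t < time w" using that B(4) by linarith
    show ?thesis
    proof (rule ccontr)
      assume no: "\<not> ?thesis"
      \<comment> \<open>If no literal holds, then all negated facts of the clause are true and all
        its positive facts are false. Each kind of clause is refuted from this.\<close>
      have neg: "\<alpha> F" if "member w \<kappa> t c a i i' s (1, F)" "small ?B (1, F)" for F
      proof -
        have "\<not> true_in \<alpha> (1, F)" using no that by blast
        then show ?thesis by (simp add: true_in_def)
      qed
      have pos: "\<not> \<alpha> F" if "member w \<kappa> t c a i i' s (0, F)" "small ?B (0, F)" for F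
      proof -
        have "\<not> true_in \<alpha> (0, F)" using no that by blast
        then show ?thesis by (simp add: true_in_def)
      qed
      have same_view: "vw c = view (run M v t)" if "\<kappa> = 1 \<or> \<kappa> = 2 \<or> \<kappa> = 3" "c < c0" "t < time w"
      proof -
        have r: "\<alpha> (2, t, b, 0, read c b)" if "b \<le> k" for b
          by (rule neg) (use less B that \<open>\<kappa> = 1 \<or> \<kappa> = 2 \<or> \<kappa> = 3\<close> table_less(1)[OF \<open>c < c0\<close> that]
              in \<open>auto simp: member_def\<close>)
        show ?thesis
        proof (rule view_unique)
          show "read c k = state v t" using r[of k] by (simp add: \<alpha>_def)
          show "read c a = cell w v t a (head w v t a)" if "a < k" for a
            using r[of a] that by (simp add: \<alpha>_def)
        qed (use that in auto)
      qed
      have head: "a < k \<and> head w v t a = i" if "\<kappa> = 0 \<or> \<kappa> = 2 \<or> \<kappa> = 3"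
        using neg[of "(1, t, a, i, 0)"] less B that by (auto simp: member_def \<alpha>_def)
      \<comment> \<open>The resulting cases are numbered from 1, so case \<open>n + 1\<close> is
        kind \<open>n\<close>.\<close>
      consider "\<kappa> = 0" | "\<kappa> = 1" | "\<kappa> = 2" | "\<kappa> = 3" | "\<kappa> = 4" | "\<kappa> = 5" | "\<kappa> = 6" | "\<kappa> = 7"
        | "\<kappa> = 8" | "\<kappa> = 9" | "\<kappa> = 10"
        using clause unfolding clause_def by blast
      then show False
      proof cases
        case 1
        have "\<alpha> (0, t, a, i, s)" "\<not> \<alpha> (2, t, a, 0, s)"
          by (rule neg pos; use 1 less B in \<open>simp add: member_def\<close>)+
        then show False using head 1 by (simp add: \<alpha>_def)
      next
        case 2
        then have *: "c < c0" "t < time w" using clause by (simp_all add: clause_def)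
        have "\<not> \<alpha> (2, Suc t, k, 0, next_state c)"
          by (rule pos) (use 2 less B tB * table_less(2)[OF *(1)] in \<open>simp_all add: member_def\<close>)
        then show False using view_step(1)[OF *(1) same_view] 2 * by (simp add: \<alpha>_def)
      next
        case 3
        then have *: "c < c0" "t < time w" "a < k" using clause by (simp_all add: clause_def)
        note v = same_view[OF _ *(1,2)]
        have h: "head w v (Suc t) a = i + shift c a - 1"
          using view_step(2)[OF *(1) v *(2,3)] head 3 by simp
        have "head w v (Suc t) a \<le> 2 * time w"
          using head_bounds(2)[OF *(3), of "Suc t"] *(2) by simp
        then have "\<not> \<alpha> (1, Suc t, a, i + shift c a - 1, 0)"
          by (intro pos) (use 3 less B tB * h in \<open>simp_all add: member_def\<close>)
        then show False using h * by (simp add: \<alpha>_def)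
      next
        case 4
        then have *: "c < c0" "t < time w" "a < k" using clause by (simp_all add: clause_def)
        note v = same_view[OF _ *(1,2)]
        have "\<not> \<alpha> (0, Suc t, a, i, written c a)"
          by (rule pos) (use 4 less B tB * table_less(3)[OF *(1,3)] in \<open>simp_all add: member_def\<close>)
        then show False using view_step(3)[OF *(1) v *(2,3), of i] head 4 * by (simp add: \<alpha>_def)
      next
        case 5
        then have *: "t < time w" "i \<noteq> i'" using clause by (simp_all add: clause_def)
        have "\<alpha> (1, t, a, i', 0)" "\<alpha> (0, t, a, i, s)" "\<not> \<alpha> (0, Suc t, a, i, s)"
          by (rule neg pos; use 5 less B tB * in \<open>simp add: member_def\<close>)+
        moreover obtain d where "d < c0" "vw d = view (run M v t)" using view_exists by blast
        ultimately show False using view_step(3)[of d t a i] * by (simp add: \<alpha>_def)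
      next
        case 6
        then have "a < k" using clause by (simp add: clause_def)
        moreover have "\<not> \<alpha> (1, 0, a, time w, 0)"
          by (rule pos; use 6 less B in \<open>simp add: member_def\<close>)
        ultimately show False using run_0(2) by (simp add: \<alpha>_def)
      next
        case 7
        have "start_state M < ?B" using tm B(5) by (simp add: turing_machine_def)
        then have "\<not> \<alpha> (2, 0, k, 0, start_state M)"
          by (intro pos) (use 7 less B in \<open>simp_all add: member_def\<close>)
        then show False using run_0(1) by (simp add: \<alpha>_def)
      next
        case 8
        then have *: "a < k" "\<not> (a = 0 \<and> is_cert w i)" using clause by (simp_all add: clause_def)
        have "letter w j \<le> 3" for j by (simp add: letter_def w bits_def)
        then have "initial_cell w a i \<le> 3" by (simp add: initial_cell_def)
        then have "initial_cell w a i < ?B" by (simp add: base_def)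
        then have "\<not> \<alpha> (0, 0, a, i, initial_cell w a i)"
          by (intro pos) (use 8 less B in \<open>simp_all add: member_def\<close>)
        then show False using initial_cell_eq[OF * assms(1)] * by (simp add: \<alpha>_def)
      next
        case 9
        then have "is_cert w i" using clause by (simp add: clause_def)
        then have "cell w v 0 0 i \<in> {0, 1, 2}"
          unfolding run_0(3)[OF k_pos] letter_v is_cert_def by auto
        moreover have "\<not> \<alpha> (0, 0, 0, i, 0)" "\<not> \<alpha> (0, 0, 0, i, 1)" "\<not> \<alpha> (0, 0, 0, i, 2)"
          by (rule pos; use 9 less B in \<open>simp add: member_def\<close>)+
        ultimately show False using k_pos by (simp add: \<alpha>_def)
      next
        case 10
        then have *: "is_cert w i" "is_cert w (Suc i)" using clause by (simp_all add: clause_def)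
        then have "Suc i < ?B" using B(8) unfolding is_cert_def by linarith
        then have "\<alpha> (0, 0, 0, i, 0)" "\<not> \<alpha> (0, 0, 0, Suc i, 0)"
          by (intro neg pos; use 10 less B in \<open>simp add: member_def\<close>)+
        then have "cell w v 0 0 i = 0" "cell w v 0 0 (Suc i) \<noteq> 0" using k_pos by (simp_all add: \<alpha>_def)
        then show False
          using * unfolding run_0(3)[OF k_pos] letter_v is_cert_def by (auto split: if_splits)
      next
        case 11
        then have "s \<noteq> accept_state M" using clause by (simp add: clause_def)
        moreover have "\<alpha> (2, time w, k, 0, s)"
          by (rule neg; use 11 less B in \<open>simp add: member_def\<close>)
        ultimately show False using time_suffices assms by (simp add: \<alpha>_def)
      qed
    qed
  qed
  then show ?thesis unfolding model_def by blast
qed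

end

lemma accepts_if_model:
  assumes w: "w = bits x" and model: "model w \<alpha>"
  shows "\<exists>u. length u \<le> cert w \<and> accepts M (pair_word x u)"
proof -
  let ?B = "base w"
  have B: "k < ?B" "2 < ?B" "1 < ?B" "0 < ?B" "time w < ?B" "2 * time w < ?B" "num_symbols M \<le> ?B"
    "num_states M \<le> ?B" "c0 \<le> ?B" "time w + length w + cert w + 1 < ?B" "12 \<le> ?B"
    by (simp_all add: base_def)
  have rule: "\<exists>L. member w \<kappa> t c a i i' s L \<and> \<alpha> (snd L) = (fst L = 0)"
    if "clause w \<kappa> t c a i i' s" "\<kappa> < ?B" "t < ?B" "c < ?B" "a < ?B" "i < ?B" "i' < ?B" "s < ?B"
    for \<kappa> t c a i i' s
  proof -
    from model[unfolded model_def, rule_format, OF that(2-8) that(1)]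
    obtain L where "member w \<kappa> t c a i i' s L" "true_in \<alpha> L" by (elim exE conjE)
    then show ?thesis unfolding true_in_def by (intro exI[of _ L] conjI)
  qed
  have kB: "a < ?B" if "a < k" for a using that B(1) by simp
  have tB: "t < ?B" if "t < time w" for t using that B(5) by simp
  have cB: "c < ?B" if "c < c0" for c using that B(9) by simp
  have read_rule: "\<alpha> (2, t, a, 0, s)"
    if "t < time w" "a < k" "i < ?B" "s < ?B" "\<alpha> (1, t, a, i, 0)" "\<alpha> (0, t, a, i, s)" for t a i s
    using rule[of 0 t 0 a i 0 s] that B kB tB by (auto simp: clause_def member_def)
  have state_rule: "\<alpha> (2, Suc t, k, 0, next_state c)"
    if "t < time w" "c < c0" "\<And>b. b \<le> k \<Longrightarrow> \<alpha> (2, t, b, 0, read c b)" for t c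
    using rule[of 1 t c 0 0 0 0] that B tB cB by (auto simp: clause_def member_def less_Suc_eq_le)
  have head_rule: "\<alpha> (1, Suc t, a, i + shift c a - 1, 0)"
    if "t < time w" "c < c0" "\<And>b. b \<le> k \<Longrightarrow> \<alpha> (2, t, b, 0, read c b)" "a < k" "i < ?B"
      "\<alpha> (1, t, a, i, 0)" for t c a i
    using rule[of 2 t c a i 0 0] that B tB cB kB by (auto simp: clause_def member_def less_Suc_eq_le)
  have write_rule: "\<alpha> (0, Suc t, a, i, written c a)"
    if "t < time w" "c < c0" "\<And>b. b \<le> k \<Longrightarrow> \<alpha> (2, t, b, 0, read c b)" "a < k" "i < ?B"
      "\<alpha> (1, t, a, i, 0)" for t c a i
    using rule[of 3 t c a i 0 0] that B tB cB kB by (auto simp: clause_def member_def less_Suc_eq_le)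
  have keep_rule: "\<alpha> (0, Suc t, a, i, s)"
    if "t < time w" "a < k" "i < ?B" "i' < ?B" "s < ?B" "i \<noteq> i'" "\<alpha> (1, t, a, i', 0)" "\<alpha> (0, t, a, i, s)"
    for t a i i' s
    using rule[of 4 t 0 a i i' s] that B kB tB by (auto simp: clause_def member_def)
  have head_start: "\<alpha> (1, 0, a, time w, 0)" if "a < k" for a
    using rule[of 5 0 0 a 0 0 0] that B kB by (auto simp: clause_def member_def)
  have state_start: "\<alpha> (2, 0, k, 0, start_state M)"
    using rule[of 6 0 0 0 0 0 0] B by (auto simp: clause_def member_def)
  have cell_start: "\<alpha> (0, 0, a, i, initial_cell w a i)"
    if "a < k" "\<not> (a = 0 \<and> is_cert w i)" "i < ?B" for a i
    using rule[of 7 0 0 a i 0 0] that B kB by (auto simp: clause_def member_def)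
  have cell_cert: "\<alpha> (0, 0, 0, i, 0) \<or> \<alpha> (0, 0, 0, i, 1) \<or> \<alpha> (0, 0, 0, i, 2)"
    if "is_cert w i" "i < ?B" for i
    using rule[of 8 0 0 0 i 0 0] that B by (auto simp: clause_def member_def)
  have blank_cert: "\<alpha> (0, 0, 0, Suc i, 0)"
    if "is_cert w i" "is_cert w (Suc i)" "i < ?B" "\<alpha> (0, 0, 0, i, 0)" for i
    using rule[of 9 0 0 0 i 0 0] that B by (auto simp: clause_def member_def)
  have final: "\<not> \<alpha> (2, time w, k, 0, s)" if "s < ?B" "s \<noteq> accept_state M" for s
    using rule[of 10 0 0 0 0 0 s] that B by (auto simp: clause_def member_def)

  define z where "z = time w + length w + 1"
  \<comment> \<open>The certificate stops at the first cell that the model allows to be blank.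
    Before it, kind 8 leaves 1 or 2, and \<open>u\<close> prefers 2 if both hold; behind it, kind 9
    spreads the blank.\<close>
  define len where "len = (LEAST n. n = cert w \<or> \<alpha> (0, 0, 0, z + n, 0))"
  define u where "u = map (\<lambda>n. \<alpha> (0, 0, 0, z + n, 2)) [0..<len]"
  define v where "v = pair_word x u"
  have len: "len = cert w \<or> \<alpha> (0, 0, 0, z + len, 0)" "len \<le> cert w"
    unfolding len_def by (rule LeastI[of _ "cert w"], simp) (rule Least_le, simp)
  have below: "\<not> \<alpha> (0, 0, 0, z + n, 0)" if "n < len" for n
    using not_less_Least[OF that[unfolded len_def]] by simp
  have cert_z: "is_cert w (z + n) \<longleftrightarrow> n < cert w" for n
    by (auto simp: is_cert_def z_def)
  have above: "\<alpha> (0, 0, 0, z + n, 0)" if "len \<le> n" "n < cert w" for n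
    using that
  proof (induction n rule: dec_induct)
    case base
    then show ?case using len by auto
  next
    case (step n)
    then show ?case using blank_cert[of "z + n"] cert_z[of n] cert_z[of "Suc n"] B(10)
      by (simp add: z_def)
  qed
  have lu: "length u = len" by (simp add: u_def)
  have lu_cert: "length u \<le> cert w" using lu len(2) by simp
  have cell_0: "\<alpha> (0, 0, a, i, cell w v 0 a i)" if a: "a < k" and i: "i < ?B" for a i
  proof (cases "a = 0 \<and> is_cert w i")
    case False
    then show ?thesis
      using cell_start[OF a False i] initial_cell_eq[OF w v_def a False lu_cert] by simp
  next
    case True
    then obtain n where n: "i = z + n" "n < cert w"
      using cert_z unfolding is_cert_def z_def by (metis Suc_eq_plus1 Suc_leI le_Suc_ex)
    have c: "cell w v 0 0 i = (if n < len then if \<alpha> (0, 0, 0, z + n, 2) then 2 else 1 else 0)"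
      unfolding run_0(3)[OF w v_def k_pos] letter_v[OF w v_def] n(1) z_def lu
      by (auto simp: u_def z_def)
    show ?thesis
    proof (cases "n < len")
      case lt: True
      then show ?thesis using cell_cert[of i] True i below[OF lt] c n by auto
    next
      case False
      then show ?thesis using above[of n] n c True by simp
    qed
  qed
  \<comment> \<open>Mere containment suffices for the induction: each fact about time
    \<open>Suc t\<close> is the conclusion of a Horn clause whose premises are facts of the run at
    time \<open>t\<close>. Heads stay at indices up to \<open>2 * time w\<close>, hence among the
    cells below \<open>base w\<close> that are followed.\<close>
  have main: "(\<forall>a<k. \<alpha> (1, t, a, head w v t a, 0) \<and> (\<forall>i<?B. \<alpha> (0, t, a, i, cell w v t a i))) \<and>
      \<alpha> (2, t, k, 0, state v t)" if "t \<le> time w" for t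
    using that
  proof (induction t)
    case 0
    then show ?case using cell_0 head_start state_start run_0[OF w v_def] by simp
  next
    case (Suc t)
    then have t: "t < time w" "t \<le> time w" by simp_all
    note IH = Suc.IH[OF t(2)]
    obtain c where c: "c < c0" "vw c = view (run M v t)" using view_exists[OF w v_def] by blast
    have hB: "head w v t a < ?B" if "a < k" for a
      using head_bounds(2)[OF w v_def that t(2)] B(6) by simp
    have cellB: "cell w v t a i < ?B" if "a < k" for a i
      using run_proper[OF w v_def, of t] that B(7) unfolding proper_def cell_def by (meson less_le_trans)
    have reads: "\<alpha> (2, t, b, 0, read c b)" if "b \<le> k" for b
    proof (cases "b = k")
      case True
      then show ?thesis using IH read_view(1)[OF w v_def c t(2)] by simp
    next
      case False
      then have b: "b < k" using that by simp
      show ?thesis unfolding read_view(2)[OF w v_def c t(2) b]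
        by (rule read_rule[OF t(1) b hB[OF b] cellB[OF b]]) (use IH b hB in blast)+
    qed
    note st = view_step[OF w v_def c t(1)]
    have "\<alpha> (1, Suc t, a, head w v (Suc t) a, 0)" if "a < k" for a
      unfolding st(2)[OF that] by (rule head_rule[OF t(1) c(1) reads that hB[OF that]]) (use IH that in blast)+
    moreover have "\<alpha> (0, Suc t, a, i, cell w v (Suc t) a i)" if a: "a < k" and i: "i < ?B" for a i
    proof (cases "i = head w v t a")
      case True
      have "\<alpha> (0, Suc t, a, i, written c a)"
        by (rule write_rule[OF t(1) c(1) reads a i]) (use IH a True in blast)+
      then show ?thesis unfolding st(3)[OF a] using True by simp
    next
      case False
      have "\<alpha> (0, Suc t, a, i, cell w v t a i)"
        by (rule keep_rule[OF t(1) a i hB[OF a] cellB[OF a] False]) (use IH a i in blast)+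
      then show ?thesis unfolding st(3)[OF a] using False by simp
    qed
    moreover have "\<alpha> (2, Suc t, k, 0, state v (Suc t))"
      unfolding st(1) by (rule state_rule[OF t(1) c(1) reads])
    ultimately show ?case by blast
  qed
  have "state v (time w) < ?B"
    using run_proper[OF w v_def, of "time w"] B(8) unfolding proper_def state_def by simp
  then have "state v (time w) = accept_state M" using main[OF order_refl] final by blast
  then have "accepts M v" using time_suffices[OF w v_def lu_cert] by simp
  then show ?thesis using lu_cert unfolding v_def by blast
qed

theorem model_iff_accepts:
  assumes "w = bits x"
  shows "(\<exists>\<alpha>. model w \<alpha>) \<longleftrightarrow> (\<exists>u. length u \<le> poly p (length x) \<and> accepts M (pair_word x u))"
  using accepts_if_model[OF assms] model_if_accepts[OF assms refl] assms
  by (auto simp: cert_def bits_def)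

section \<open>Definability of the matrix, and the reduction\<close>

lemma def_base: "definable (\<lambda>w e. base w)" and def_time: "definable (\<lambda>w e. time w)"
  and def_cert: "definable (\<lambda>w e. cert w)"
  unfolding base_def time_def cert_def by (intro def_intro)+

lemma def_digit: "definable A \<Longrightarrow> definable (\<lambda>w e. digit (base w) n (A w e))"
  unfolding digit_def by (intro def_intro def_base)

lemma def_read: "definable A \<Longrightarrow> definable A' \<Longrightarrow> definable (\<lambda>w e. read (A w e) (A' w e))"
  unfolding read_def by (rule def_table2)

lemma def_next_state: "definable A \<Longrightarrow> definable (\<lambda>w e. next_state (A w e))"
  unfolding next_state_def by (rule def_table)

lemma def_written: "definable A \<Longrightarrow> definable A' \<Longrightarrow> definable (\<lambda>w e. written (A w e) (A' w e))"
  unfolding written_def by (rule def_table2)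

lemma def_shift: "definable A \<Longrightarrow> definable A' \<Longrightarrow> definable (\<lambda>w e. shift (A w e) (A' w e))"
  unfolding shift_def by (rule def_table2)

lemma def_matrix: "definable_pred (\<lambda>w e. matrix w (e 0) (e 1))"
  unfolding matrix_def clause_def member_def is_cert_def initial_cell_def prod.inject
  by (intro def_intro def_base def_time def_cert def_digit def_read def_next_state def_written def_shift)

lemma reducible:
  assumes L: "\<And>x. x \<in> L \<longleftrightarrow> (\<exists>u. length u \<le> poly p (length x) \<and> accepts M (pair_word x u))"
  shows "poly_time_reducible L (decision_language LB_instance LB_question)"
proof -
  interpret family: clause_matrix_family "\<lambda>w. base w ^ 5" "\<lambda>w. base w ^ 7" matrix
    by unfold_locales (simp_all add: base_pos def_pow def_base def_matrix[unfolded One_nat_def])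
  show ?thesis
    unfolding poly_time_reducible_def
    using family.reduction unfolding satisfiable_iff_model model_iff_accepts[OF refl] L by blast
qed

end

theorem theorem4p5:
  "NP_complete (decision_language
     (\<lambda>V E. bipartite V E \<and> max_degree V E = 3)
     (\<lambda>V E. \<exists>f. two_partition V f \<and> locally_balanced_closed V E f))"
  unfolding NP_complete_def
proof (intro conjI ballI)
  fix L assume "L \<in> NP"
  then obtain M and p q :: "nat poly" where M: "turing_machine M"
    "\<And>x u. halts_within M (pair_word x u) (poly q (length (pair_word x u)))"
    and L: "\<And>x. x \<in> L \<longleftrightarrow> (\<exists>u. length u \<le> poly p (length x) \<and> accepts M (pair_word x u))"
    unfolding NP_def by blast
  obtain vw :: "nat \<Rightarrow> nat \<times> nat list" where "bij_betw vw {0..<card (views M)} (views M)"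
    using ex_bij_betw_nat_finite[OF finite_views] by blast
  then have "views M = vw ` {..<card (views M)}"
    by (simp add: bij_betw_def lessThan_atLeast0)
  then interpret verifier M p q "card (views M)" vw
    using M by unfold_locales
  show "poly_time_reducible L (decision_language LB_instance LB_question)"
    by (rule reducible[OF L])
qed (rule LB_in_NP)

end
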